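(* Let $X$ be a separable real Banach space equipped with a centred nondegenerate Gaussian measure $\gamma$ with Cameron--Martin space $E$. (a) Let $(r_n)_{n \in \mathbb{N}} \subset (0,\infty)$ with $r_n \to 0$ and let $(x_n)_{n \in \mathbb{N}} \subset X$. If $$\liminf_{n \to \infty} \min_{h \in E \cap B_{r_n}(x_n)} \frac{1}{2}\|h\|_E^2 < \infty,$$ then $(x_n)_{n \in \mathbb{N}}$ has an $X$-strong limit point which lies in $E$, i.e. some subsequence of $(x_n)_{n\in\mathbb{N}}$ converges in the norm of $X$ to an element of $E$. (b) Property $M(\gamma, E)$ holds.
   Context: $B_r(x)$ denotes the closed ball of radius $r$ centred at $x$ in the norm of $X$. For a Borel probability measure $\mu$ on $X$, $\operatorname{supp}(\mu) = \{x \in X : \mu(B_r(x)) > 0 \text{ for all } r > 0\}$. Property $M(\mu, D)$, for a nonempty set $D \subseteq \operatorname{supp}(\mu)$, holds if there exists $x^\star \in D$ such that $\lim_{r \to 0} \mu(B_r(x))/\mu(B_r(x^\star)) = 0$ for all $x \in X \setminus D$. A Borel probability measure $\gamma$ on a separable Banach space $X$ is Gaussian if its pushforward under every $f \in X^*$ is a Gaussian measure on $\mathbb{R}$; it is centred if it has mean zero and nondegenerate if $\operatorname{supp}(\gamma) = X$. Let $X_\gamma^*$ be the closure of $X^*$ in $L^2(\gamma)$, and for $f \in X_\gamma^*$ let $R_\gamma f \in X$ be the element representing the functional $g \mapsto \int_X f(x) g(x)\,\gamma(\mathrm{d}x)$ on $X^*$. The Cameron--Martin space of $\gamma$ is $E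 = R_\gamma(X_\gamma^* ) \subset X$, a separable Hilbert space with norm $\|h\|_E = \|R_\gamma^{-1} h\|_{L^2(\gamma)}$. *)

theory Defs
  imports "HOL-Probability.Probability"
begin

definition supp :: "'a::metric_space measure \<Rightarrow> 'a set" where
  "supp \<mu> = {x. \<forall>r>0. measure \<mu> (cball x r) > 0}"

text \<open>The standing requirement that \<open>D\<close> is a nonempty subset of the support is part of the
  property. It also keeps the denominators positive.\<close>

definition property_M :: "'a::metric_space measure \<Rightarrow> 'a set \<Rightarrow> bool" where
  "property_M \<mu> D \<longleftrightarrow> D \<noteq> {} \<and> D \<subseteq> supp \<mu> \<and>
     (\<exists>xs\<in>D. \<forall>x\<in>UNIV - D.
        ((\<lambda>r. measure \<mu> (cball x r) / measure \<mu> (cball xs r)) \<longlongrightarrow> 0) (at_right 0))"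

text \<open>Point masses count as Gaussian measures on the line (variance zero); the pushforward under
  the zero functional is always one.\<close>

definition gaussian_real :: "real measure \<Rightarrow> bool" where
  "gaussian_real \<nu> \<longleftrightarrow>
     (\<exists>m. \<nu> = return borel m) \<or>
     (\<exists>m \<sigma>. \<sigma> > 0 \<and> \<nu> = density lborel (\<lambda>t. ennreal (normal_density m \<sigma> t)))"

definition gaussian_measure :: "'a::{banach, second_countable_topology} measure \<Rightarrow> bool" where
  "gaussian_measure \<gamma> \<longleftrightarrow> prob_space \<gamma> \<and> sets \<gamma> = sets borel \<and>
     (\<forall>f :: 'a \<Rightarrow> real. bounded_linear f \<longrightarrow> gaussian_real (distr \<gamma> borel f))"

text \<open>The mean of \<open>\<gamma>\<close> is the vector \<open>m\<close> with \<open>f m = \<integral>x. f x \<partial>\<gamma>\<close> for all continuous linear \<open>f\<close>.\<close>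

definition centred :: "'a::real_normed_vector measure \<Rightarrow> bool" where
  "centred \<gamma> \<longleftrightarrow> (\<forall>f :: 'a \<Rightarrow> real. bounded_linear f \<longrightarrow> (\<integral>x. f x \<partial>\<gamma>) = 0)"

definition nondegenerate :: "'a::metric_space measure \<Rightarrow> bool" where
  "nondegenerate \<gamma> \<longleftrightarrow> supp \<gamma> = UNIV"

text \<open>Elements of \<open>L\<^sup>2(\<gamma>)\<close> are handled through representatives, without passing to the quotient
  by almost everywhere equality.\<close>

definition L2_funs :: "'a measure \<Rightarrow> ('a \<Rightarrow> real) set" where
  "L2_funs \<gamma> = {f. f \<in> borel_measurable \<gamma> \<and> integrable \<gamma> (\<lambda>x. (f x)\<^sup>2)}"

definition L2_norm :: "'a measure \<Rightarrow> ('a \<Rightarrow> real) \<Rightarrow> real" where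
  "L2_norm \<gamma> f = sqrt (\<integral>x. (f x)\<^sup>2 \<partial>\<gamma>)"

definition dual_closure :: "'a::real_normed_vector measure \<Rightarrow> ('a \<Rightarrow> real) set" where
  "dual_closure \<gamma> = {f \<in> L2_funs \<gamma>.
     \<forall>e>0. \<exists>g \<in> L2_funs \<gamma>. bounded_linear g \<and> L2_norm \<gamma> (\<lambda>x. f x - g x) < e}"

definition R_op :: "'a::real_normed_vector measure \<Rightarrow> ('a \<Rightarrow> real) \<Rightarrow> 'a" where
  "R_op \<gamma> f = (THE h. \<forall>g :: 'a \<Rightarrow> real. bounded_linear g \<longrightarrow> g h = (\<integral>x. f x * g x \<partial>\<gamma>))"

definition CM_space :: "'a::real_normed_vector measure \<Rightarrow> 'a set" where
  "CM_space \<gamma> = R_op \<gamma> ` dual_closure \<gamma>"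

text \<open>\<open>R_op\<close> is injective only modulo almost everywhere equality; \<open>inv_into\<close> picks one
  representative of the preimage class, and the norm does not depend on which.\<close>

definition CM_norm :: "'a::real_normed_vector measure \<Rightarrow> 'a \<Rightarrow> real" where
  "CM_norm \<gamma> h = L2_norm \<gamma> (inv_into (dual_closure \<gamma>) (R_op \<gamma>) h)"

end

theory Submission
  imports Defs
begin

text \<open>The Cameron--Martin space consists of the points \<open>h\<close> with \<open>\<bar>g h\<bar> \<le> C * \<parallel>g\<parallel>\<close> for all continuous
  functionals \<open>g\<close>, where \<open>\<parallel>g\<parallel>\<close> is the \<open>L\<^sup>2\<close> norm. The covariance operator is a uniform limit of
  finite rank operators, so balls of the Cameron--Martin space are relatively compact in \<open>X\<close>; this
  gives (a).

  For (b), a point \<open>x\<close> outside the Cameron--Martin space admits for every \<open>M\<close> a functional \<open>f\<close> with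
  \<open>\<parallel>f\<parallel> \<le> 1\<close> and \<open>f x > M\<close>. A form of Anderson's inequality bounds the mass of a small ball around
  \<open>x\<close> by \<open>exp (- M\<^sup>2 / 2)\<close> times the mass of the ball around \<open>0\<close>. For a finite intersection of
  symmetric slabs in \<open>m\<close> dimensions such a bound holds with an extra factor \<open>(R * sqrt e) ^ m\<close> by
  comparing volumes. Rotating two independent copies expresses the square of the shifted mass
  through shifted masses of intersections of slabs that are larger by \<open>sqrt 2\<close>. Iterating this
  and taking roots sends the extra factor to \<open>1\<close>.\<close>

subsection \<open>Norming functionals\<close>

text \<open>The obstacle in (b) is the dimension. A ball is reached only as a limit of intersections
  of more and more slabs, so the finite-dimensional bound must not depend on their number, while the
  volume comparison costs a factor exponential in the dimension. One rotation turns the squared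
  distance \<open>D\<close> into \<open>2 * D\<close> and the size \<open>R\<close> into
  \<open>sqrt 2 * R\<close>, and it bounds the square of the mass. After the root is taken,
  \<open>exp (- D / 2)\<close> is reproduced exactly, whereas the exponent of the unwanted factor is
  halved up to the growth of \<open>ln R\<close>; after \<open>k\<close> rounds it is of order
  \<open>k / 2 ^ k\<close>. The argument closes because the rotation formula is an identity valid
  for the shift zero too, so the bounds on the sections reassemble without loss.

  The number \<open>D\<close> comes from a single functional: if \<open>f\<close> has
  \<open>L2_norm\<close> at most one and \<open>f \<ge> M\<close> on the ball, then in orthonormal
  coordinates every point of the shifted set has Euclidean norm at least \<open>M\<close>. The
  radius has to be small for \<open>f \<ge> M\<close> to hold on the whole ball, which is why the
  decay is a statement about \<open>r\<close> tending to zero.\<close>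

definition sublinear :: "('a::real_vector \<Rightarrow> real) \<Rightarrow> bool" where
  "sublinear p \<longleftrightarrow> (\<forall>x y. p (x + y) \<le> p x + p y) \<and> (\<forall>c x. c > 0 \<longrightarrow> p (c *\<^sub>R x) = c * p x)"

lemma sublinear_zero: "sublinear p \<Longrightarrow> p 0 = 0"
proof -
  assume "sublinear p"
  then have "p (2 *\<^sub>R 0) = 2 * p 0"
    unfolding sublinear_def by (metis zero_less_numeral)
  then show ?thesis by simp
qed

lemma sublinear_minus: "sublinear p \<Longrightarrow> - p (- x) \<le> p x"
  using sublinear_zero[of p] unfolding sublinear_def
  by (metis add.right_inverse add.commute diff_le_eq diff_0)

lemma sublinear_scale: "sublinear p \<Longrightarrow> c \<ge> 0 \<Longrightarrow> p (c *\<^sub>R x) = c * p x"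
  using sublinear_zero[of p] unfolding sublinear_def by (cases "c = 0") auto

text \<open>For sublinear \<open>p\<close> this is the greatest sublinear minorant \<open>q\<close>
  of \<open>p\<close> with \<open>q (- v) \<le> - p v\<close>: any such \<open>q\<close> satisfies
  \<open>q y \<le> q (y + t *\<^sub>R v) + t * q (- v)\<close>, which is at most the expression
  under the infimum.\<close>

definition shift_inf :: "('a::real_vector \<Rightarrow> real) \<Rightarrow> 'a \<Rightarrow> 'a \<Rightarrow> real" where
  "shift_inf p v y = (INF t\<in>{0..}. p (y + t *\<^sub>R v) - t * p v)"

lemma shift_inf_bdd:
  assumes "sublinear p"
  shows "bdd_below ((\<lambda>t. p (y + t *\<^sub>R v) - t * p v) ` {0..})"
proof (rule bdd_belowI2)
  fix t :: real assume "t \<in> {0..}"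
  then have "t * p v = p ((y + t *\<^sub>R v) + (- y))"
    using sublinear_scale[OF assms] by simp
  also have "\<dots> \<le> p (y + t *\<^sub>R v) + p (- y)"
    using assms unfolding sublinear_def by blast
  finally show "- p (- y) \<le> p (y + t *\<^sub>R v) - t * p v" by simp
qed

lemma shift_inf_le:
  assumes "sublinear p" "t \<ge> 0"
  shows "shift_inf p v y \<le> p (y + t *\<^sub>R v) - t * p v"
  unfolding shift_inf_def by (rule cINF_lower[OF shift_inf_bdd[OF assms(1)]]) (use assms in auto)

text \<open>Parameters \<open>s\<close> for \<open>x\<close> and \<open>t\<close> for
  \<open>y\<close> combine to \<open>s + t\<close> for \<open>x + y\<close>, and scaling by
  \<open>c\<close> turns \<open>t\<close> into \<open>c * t\<close>. The reverse scaling inequality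
  is the first one applied with \<open>1 / c\<close>.\<close>

lemma sublinear_shift_inf:
  assumes "sublinear p"
  shows "sublinear (shift_inf p v)"
proof -
  have add: "shift_inf p v (x + y) \<le> shift_inf p v x + shift_inf p v y" for x y
  proof -
    have "shift_inf p v (x + y) - (p (x + s *\<^sub>R v) - s * p v) \<le> shift_inf p v y" if "s \<ge> 0" for s
      unfolding shift_inf_def[of p v y]
    proof (rule cINF_greatest)
      fix t :: real assume t: "t \<in> {0..}"
      have "shift_inf p v (x + y) \<le> p ((x + y) + (s + t) *\<^sub>R v) - (s + t) * p v"
        using shift_inf_le[OF assms] t that by auto
      also have "(x + y) + (s + t) *\<^sub>R v = (x + s *\<^sub>R v) + (y + t *\<^sub>R v)"
        by (simp add: algebra_simps)
      also have "p \<dots> \<le> p (x + s *\<^sub>R v) + p (y + t *\<^sub>R v)"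
        using assms unfolding sublinear_def by blast
      finally show "shift_inf p v (x + y) - (p (x + s *\<^sub>R v) - s * p v) \<le> p (y + t *\<^sub>R v) - t * p v"
        by (simp add: algebra_simps)
    qed simp
    then have "shift_inf p v (x + y) - shift_inf p v y \<le> shift_inf p v x"
      unfolding shift_inf_def[of p v x] by (intro cINF_greatest) (auto simp: algebra_simps)
    then show ?thesis by simp
  qed
  have scale_le: "shift_inf p v (c *\<^sub>R x) \<le> c * shift_inf p v x" if "c > 0" for c x
  proof -
    have "shift_inf p v (c *\<^sub>R x) / c \<le> shift_inf p v x"
      unfolding shift_inf_def[of p v x]
    proof (rule cINF_greatest)
      fix t :: real assume t: "t \<in> {0..}"
      have "shift_inf p v (c *\<^sub>R x) \<le> p (c *\<^sub>R x + (c * t) *\<^sub>R v) - (c * t) * p v"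
        using shift_inf_le[OF assms] t that by auto
      also have "c *\<^sub>R x + (c * t) *\<^sub>R v = c *\<^sub>R (x + t *\<^sub>R v)"
        by (simp add: algebra_simps)
      also have "p \<dots> = c * p (x + t *\<^sub>R v)"
        using assms that unfolding sublinear_def by blast
      finally show "shift_inf p v (c *\<^sub>R x) / c \<le> p (x + t *\<^sub>R v) - t * p v"
        using that by (simp add: field_simps)
    qed simp
    then show ?thesis using that by (simp add: field_simps)
  qed
  have "shift_inf p v (c *\<^sub>R x) = c * shift_inf p v x" if "c > 0" for c x
  proof (rule antisym[OF scale_le[OF that]])
    have "shift_inf p v ((1 / c) *\<^sub>R (c *\<^sub>R x)) \<le> (1 / c) * shift_inf p v (c *\<^sub>R x)"
      using that by (intro scale_le) auto
    then show "c * shift_inf p v x \<le> shift_inf p v (c *\<^sub>R x)"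
      using that by (simp add: field_simps)
  qed
  with add show ?thesis unfolding sublinear_def by blast
qed

text \<open>Subadditivity does not pass to infima of arbitrary families. In a chain the smaller of
  \<open>p\<close> and \<open>q\<close> bounds \<open>u (x + y)\<close> by \<open>p x + q y\<close>,
  and the two infima can then be taken separately.\<close>

lemma sublinear_Inf_chain:
  assumes C: "C \<noteq> {}" "\<And>p. p \<in> C \<Longrightarrow> sublinear p" "\<And>x. bdd_below ((\<lambda>p. p x) ` C)"
    and chain: "\<And>p q. p \<in> C \<Longrightarrow> q \<in> C \<Longrightarrow> (\<forall>x. p x \<le> q x) \<or> (\<forall>x. q x \<le> p x)"
  shows "sublinear (\<lambda>x. INF p\<in>C. p x)"
proof -
  define u where "u x = (INF p\<in>C. p x)" for x
  have le: "u x \<le> p x" if "p \<in> C" for p x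
    unfolding u_def using that C(3) by (rule cINF_lower[rotated])
  have "u (x + y) \<le> p x + q y" if pq: "p \<in> C" "q \<in> C" for p q x y
    using chain[OF pq]
  proof
    assume "\<forall>x. p x \<le> q x"
    then show ?thesis
      using le[OF pq(1), of "x + y"] C(2)[OF pq(1)] unfolding sublinear_def by (smt (verit))
  next
    assume "\<forall>x. q x \<le> p x"
    then show ?thesis
      using le[OF pq(2), of "x + y"] C(2)[OF pq(2)] unfolding sublinear_def by (smt (verit))
  qed
  then have "u (x + y) - p x \<le> q y" if "p \<in> C" "q \<in> C" for p q x y
    using that by (simp add: diff_le_eq add.commute)
  then have "u (x + y) - p x \<le> u y" if "p \<in> C" for p x y
    unfolding u_def[of y] using C(1) that by (intro cINF_greatest)
  then have "u (x + y) - u y \<le> p x" if "p \<in> C" for p x y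
    using that by (simp add: diff_le_eq add.commute)
  then have "u (x + y) - u y \<le> u x" for x y
    unfolding u_def[of x] using C(1) by (intro cINF_greatest)
  then have add: "u (x + y) \<le> u x + u y" for x y
    by (simp add: algebra_simps)
  have scale_le: "u (c *\<^sub>R x) \<le> c * u x" if "c > 0" for c x
  proof -
    have "u (c *\<^sub>R x) / c \<le> u x"
      unfolding u_def[of x]
    proof (rule cINF_greatest[OF C(1)])
      fix p assume p: "p \<in> C"
      have "p (c *\<^sub>R x) = c * p x"
        using C(2)[OF p] that unfolding sublinear_def by blast
      then show "u (c *\<^sub>R x) / c \<le> p x"
        using le[OF p, of "c *\<^sub>R x"] that by (simp add: field_simps)
    qed
    then show ?thesis using that by (simp add: field_simps)
  qed
  have "u (c *\<^sub>R x) = c * u x" if "c > 0" for c x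
  proof (rule antisym[OF scale_le[OF that]])
    have "u ((1 / c) *\<^sub>R (c *\<^sub>R x)) \<le> (1 / c) * u (c *\<^sub>R x)"
      using that by (intro scale_le) auto
    then show "c * u x \<le> u (c *\<^sub>R x)"
      using that by (simp add: field_simps)
  qed
  with add have "sublinear u" unfolding sublinear_def by blast
  then show ?thesis unfolding u_def .
qed

text \<open>A pointwise minimal sublinear functional below the norm coincides with all its \<open>shift_inf\<close>
  modifications, which makes it odd and hence linear.\<close>

theorem norming_functional:
  fixes d :: "'a::real_normed_vector"
  obtains g :: "'a \<Rightarrow> real" where "bounded_linear g" "\<And>x. \<bar>g x\<bar> \<le> norm x" "g d = norm d"
proof -
  \<comment> \<open>The condition at \<open>- d\<close> is an upper bound, so it survives infima of
    chains. Once the minimal element is odd, it reads \<open>norm d \<le> p d\<close>.\<close>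
  define Q where "Q = {p :: 'a \<Rightarrow> real. sublinear p \<and> (\<forall>x. p x \<le> norm x) \<and> p (- d) \<le> - norm d}"
  \<comment> \<open>The order is reversed: maximal elements for \<open>P\<close> are pointwise
    minimal functionals.\<close>
  define P where "P = (\<lambda>p q :: 'a \<Rightarrow> real. \<forall>x. q x \<le> p x)"
  have sn: "sublinear (norm :: 'a \<Rightarrow> real)"
    unfolding sublinear_def by (simp add: norm_triangle_ineq)
  have shift: "shift_inf p v x \<le> p x" "shift_inf p v (- v) \<le> - p v" if "sublinear p"
    for p :: "'a \<Rightarrow> real" and v x
    using shift_inf_le[OF that, of 0 v x] shift_inf_le[OF that, of 1 v "- v"] sublinear_zero[OF that]
    by auto
  \<comment> \<open>The parameter \<open>t = 1\<close> at the point \<open>- d\<close> gives the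
    value \<open>norm 0 - norm d\<close>. This member of \<open>Q\<close> also bounds the empty
    chain.\<close>
  have p0: "shift_inf norm d \<in> Q"
    unfolding Q_def using sublinear_shift_inf[OF sn] shift[OF sn] by auto
  have lower: "- norm x \<le> p x" if "p \<in> Q" for p x
    using that sublinear_minus[of p x] unfolding Q_def by (smt (verit) mem_Collect_eq norm_minus_cancel)
  have "\<exists>m\<in>Q. \<forall>a\<in>Q. P m a \<longrightarrow> a = m"
  proof (rule predicate_Zorn)
    show "partial_order_on Q (relation_of P Q)"
      by (rule partial_order_on_relation_ofI) (auto simp: P_def fun_eq_iff intro: order_trans antisym)
    fix C assume C: "C \<in> Chains (relation_of P Q)"
    then have CQ: "C \<subseteq> Q" and tot: "\<And>p q. p \<in> C \<Longrightarrow> q \<in> C \<Longrightarrow> P p q \<or> P q p"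
      by (auto simp: Chains_def relation_of_def)
    show "\<exists>u\<in>Q. \<forall>a\<in>C. P a u"
    proof (cases "C = {}")
      case True then show ?thesis using p0 by auto
    next
      case False
      then obtain p where p: "p \<in> C" by auto
      have bdd: "bdd_below ((\<lambda>p. p x) ` C)" for x
        by (rule bdd_belowI2[of _ "- norm x"]) (use lower CQ in auto)
      have le: "(INF p\<in>C. p x) \<le> q x" if "q \<in> C" for q x
        using that bdd by (rule cINF_lower[rotated])
      have "sublinear (\<lambda>x. INF p\<in>C. p x)"
        by (rule sublinear_Inf_chain) (use False CQ tot bdd in \<open>auto simp: Q_def P_def\<close>)
      then have "(\<lambda>x. INF p\<in>C. p x) \<in> Q"
        using p CQ le[OF p] by (auto simp: Q_def intro: order_trans)
      then show ?thesis using le unfolding P_def by (intro bexI[of _ "\<lambda>x. INF p\<in>C. p x"]) auto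
    qed
  qed
  then obtain m where m: "m \<in> Q" "\<And>a. a \<in> Q \<Longrightarrow> P m a \<Longrightarrow> a = m" by auto
  then have sm: "sublinear m" by (simp add: Q_def)
  have "shift_inf m v \<in> Q" for v
    using m(1) shift[OF sm] sublinear_shift_inf[OF sm] unfolding Q_def mem_Collect_eq
    by (meson order_trans)
  then have "shift_inf m v = m" for v
    using m(2) shift(1)[OF sm] by (auto simp: P_def)
  then have "m (- v) \<le> - m v" for v
    using shift(2)[OF sm, of v] by simp
  then have odd: "m (- v) = - m v" for v
    using sublinear_minus[OF sm, of v] by (smt (verit))
  have add: "m (x + y) = m x + m y" for x y
  proof (rule antisym)
    show "m (x + y) \<le> m x + m y" using sm by (simp add: sublinear_def)
    have "m (- x + - y) \<le> m (- x) + m (- y)" using sm unfolding sublinear_def by blast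
    then have "m (- (x + y)) \<le> m (- x) + m (- y)" by (simp add: algebra_simps)
    then show "m x + m y \<le> m (x + y)" unfolding odd by simp
  qed
  have scale: "m (c *\<^sub>R x) = c * m x" for c x
  proof (cases "c \<ge> 0")
    case True then show ?thesis by (rule sublinear_scale[OF sm])
  next
    case False
    then have "m ((- c) *\<^sub>R x) = (- c) * m x" by (intro sublinear_scale[OF sm]) auto
    then show ?thesis using odd[of "c *\<^sub>R x"] by simp
  qed
  have abs: "\<bar>m x\<bar> \<le> norm x" for x
    using lower[OF m(1), of x] m(1) by (auto simp: Q_def abs_le_iff minus_le_iff)
  have "bounded_linear m"
    by (rule bounded_linear_intro[where K=1]) (use add scale abs in auto)
  moreover have "m d = norm d"
    using m(1) odd[of d] abs[of d] by (auto simp: Q_def)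
  ultimately show ?thesis using that abs by blast
qed

section \<open>Separation of points and computation of the norm by continuous functionals\<close>

lemma functionals_separate:
  fixes x y :: "'a::real_normed_vector"
  assumes "\<And>g :: 'a \<Rightarrow> real. bounded_linear g \<Longrightarrow> g x = g y"
  shows "x = y"
proof -
  obtain g :: "'a \<Rightarrow> real" where g: "bounded_linear g" "g (x - y) = norm (x - y)"
    using norming_functional by blast
  then have "norm (x - y) = 0"
    using assms[OF g(1)] linear_diff[of g x y] bounded_linear.linear[OF g(1)] by simp
  then show ?thesis by simp
qed

lemma norm_le_functionals:
  fixes x :: "'a::real_normed_vector"
  assumes "\<And>g :: 'a \<Rightarrow> real. bounded_linear g \<Longrightarrow> onorm g \<le> 1 \<Longrightarrow> \<bar>g x\<bar> \<le> C"
  shows "norm x \<le> C"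
proof -
  obtain g :: "'a \<Rightarrow> real" where g: "bounded_linear g" "\<And>x. \<bar>g x\<bar> \<le> norm x" "g x = norm x"
    using norming_functional by blast
  then have "onorm g \<le> 1"
    by (intro onorm_bound) auto
  then show ?thesis
    using assms[OF g(1)] g(3) by simp
qed

text \<open>One countable family has to serve all \<open>y\<close>, so that a closed ball becomes a
  countable intersection of slabs. Functionals norming the points of a dense sequence do this:
  replacing \<open>y\<close> by a nearby point costs the distance twice, once inside
  \<open>g n\<close> and once in the norm.\<close>

lemma countable_norming_functionals:
  obtains g :: "nat \<Rightarrow> 'a::{real_normed_vector, second_countable_topology} \<Rightarrow> real"
  where "\<And>n. bounded_linear (g n)" "\<And>n. onorm (g n) \<le> 1"
    and "\<And>y r. \<forall>n. \<bar>g n y\<bar> \<le> r \<Longrightarrow> norm y \<le> r"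
proof -
  obtain D :: "'a set" where D: "countable D" "\<And>X. open X \<Longrightarrow> X \<noteq> {} \<Longrightarrow> \<exists>d\<in>D. d \<in> X"
    using countable_dense_setE by blast
  have "D \<noteq> {}" using D(2)[OF open_UNIV] by auto
  define d where "d = from_nat_into D"
  have "\<exists>g :: 'a \<Rightarrow> real. bounded_linear g \<and> (\<forall>x. \<bar>g x\<bar> \<le> norm x) \<and> g (d n) = norm (d n)" for n
    using norming_functional[of "d n"] by metis
  then obtain g :: "nat \<Rightarrow> 'a \<Rightarrow> real" where g: "\<And>n. bounded_linear (g n)"
    "\<And>n x. \<bar>g n x\<bar> \<le> norm x" "\<And>n. g n (d n) = norm (d n)" by metis
  show ?thesis
  proof
    show "bounded_linear (g n)" for n by fact
    show "onorm (g n) \<le> 1" for n using g(2) by (intro onorm_bound) auto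
    fix y r assume r: "\<forall>n. \<bar>g n y\<bar> \<le> r"
    show "norm y \<le> r"
    proof (rule field_le_epsilon)
      fix e :: real assume "e > 0"
      then obtain z where "z \<in> D" "z \<in> ball y (e / 2)"
        using D(2)[of "ball y (e / 2)"] by auto
      then obtain n where n: "d n = z"
        using D(1) \<open>D \<noteq> {}\<close> unfolding d_def by (metis from_nat_into_surj)
      then have *: "norm (y - d n) < e / 2"
        using \<open>z \<in> ball y (e / 2)\<close> by (simp add: dist_norm)
      have "norm (d n) = g n y - g n (y - d n)"
        using g(3)[of n] bounded_linear.linear[OF g(1)[of n]] by (simp add: linear_diff)
      also have "\<dots> \<le> r + norm (y - d n)"
        using r[rule_format, of n] g(2)[of n "y - d n"] by (auto simp: abs_le_iff)
      finally have "norm (d n) \<le> r + e / 2" using * by simp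
      then show "norm y \<le> r + e"
        using norm_triangle_ineq2[of y "d n"] * by simp
    qed
  qed
qed

subsection \<open>Finite-dimensional Gaussian integrals\<close>

text \<open>On boxes the one-dimensional substitutions multiply to the factor
  \<open>\<bar>c\<bar> ^ card I\<close>, and boxes determine the product measure. A common scalar of
  either sign covers reflection, translation, dilation and both halves of the rotation.\<close>

lemma nn_integral_PiM_lborel_affine:
  fixes f :: "('i \<Rightarrow> real) \<Rightarrow> ennreal"
  assumes I: "finite I" and c: "c \<noteq> 0" and f: "f \<in> borel_measurable (PiM I (\<lambda>_. lborel))"
  shows "(\<integral>\<^sup>+y. f y \<partial>PiM I (\<lambda>_. lborel)) =
    ennreal (\<bar>c\<bar> ^ card I) * (\<integral>\<^sup>+y. f (\<lambda>i\<in>I. a i + c * y i) \<partial>PiM I (\<lambda>_. lborel))"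
proof -
  let ?L = "PiM I (\<lambda>_. lborel :: real measure)"
  let ?T = "\<lambda>y. \<lambda>i\<in>I. a i + c * y i"
  interpret product_sigma_finite "\<lambda>_ :: 'i. lborel :: real measure" ..
  have T[measurable]: "?T \<in> ?L \<rightarrow>\<^sub>M ?L"
    by (rule measurable_restrict) simp
  have "density (distr ?L ?L ?T) (\<lambda>_. ennreal (\<bar>c\<bar> ^ card I)) = ?L"
  proof (rule PiM_eqI[OF I])
    fix A :: "'i \<Rightarrow> real set" assume "\<And>i. i \<in> I \<Longrightarrow> A i \<in> sets lborel"
    then have A: "\<And>i. i \<in> I \<Longrightarrow> A i \<in> sets borel" by simp
    define B where "B i = (\<lambda>x. a i + c * x) -` A i" for i
    have [measurable]: "i \<in> I \<Longrightarrow> B i \<in> sets borel" for i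
      unfolding B_def using A by (intro measurable_sets_borel[of _ borel]) auto
    have box: "PiE I A \<in> sets ?L"
      using A I by (intro sets_PiM_I_finite) auto
    have "emeasure (density (distr ?L ?L ?T) (\<lambda>_. ennreal (\<bar>c\<bar> ^ card I))) (PiE I A) =
        ennreal (\<bar>c\<bar> ^ card I) * emeasure ?L (?T -` PiE I A \<inter> space ?L)"
      using box by (simp add: emeasure_density emeasure_distr nn_integral_cmult_indicator)
    also have "?T -` PiE I A \<inter> space ?L = PiE I B"
      by (auto simp: space_PiM B_def PiE_iff)
    also have "emeasure ?L (PiE I B) = (\<Prod>i\<in>I. emeasure lborel (B i))"
      using I by (intro emeasure_PiM) auto
    also have "ennreal (\<bar>c\<bar> ^ card I) * \<dots> = (\<Prod>i\<in>I. ennreal \<bar>c\<bar> * emeasure lborel (B i))"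
      by (simp add: prod.distrib ennreal_power)
    also have "\<dots> = (\<Prod>i\<in>I. emeasure lborel (A i))"
    proof (rule prod.cong)
      fix i assume i: "i \<in> I"
      have "emeasure lborel (A i) =
          emeasure (density (distr lborel borel (\<lambda>x. a i + c * x)) (\<lambda>_. ennreal \<bar>c\<bar>)) (A i)"
        using lborel_real_affine[OF c, of "a i"] by simp
      also have "\<dots> = ennreal \<bar>c\<bar> * emeasure lborel (B i)"
        using A[OF i] by (simp add: emeasure_density emeasure_distr nn_integral_cmult_indicator B_def)
      finally show "ennreal \<bar>c\<bar> * emeasure lborel (B i) = emeasure lborel (A i)" by simp
    qed simp
    finally show "emeasure (density (distr ?L ?L ?T) (\<lambda>_. ennreal (\<bar>c\<bar> ^ card I))) (PiE I A) =
      (\<Prod>i\<in>I. emeasure lborel (A i))" .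
  qed simp
  then have "(\<integral>\<^sup>+y. f y \<partial>?L) = (\<integral>\<^sup>+y. f y \<partial>density (distr ?L ?L ?T) (\<lambda>_. ennreal (\<bar>c\<bar> ^ card I)))"
    by simp
  also have "\<dots> = ennreal (\<bar>c\<bar> ^ card I) * (\<integral>\<^sup>+y. f (?T y) \<partial>?L)"
    using f by (simp add: nn_integral_density nn_integral_distr nn_integral_cmult)
  finally show ?thesis .
qed

text \<open>Only the coordinates in \<open>I\<close> matter, so extensionality is not demanded. A
  half width \<open>\<rho> l\<close> may be negative, which makes the set empty; this happens for
  the sections that arise after a rotation.\<close>

definition slab :: "'i set \<Rightarrow> 'l set \<Rightarrow> ('l \<Rightarrow> 'i \<Rightarrow> real) \<Rightarrow> ('l \<Rightarrow> real) \<Rightarrow> ('i \<Rightarrow> real) set" where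
  "slab I A a \<rho> = {y. \<forall>l\<in>A. \<bar>\<Sum>i\<in>I. a l i * y i\<bar> \<le> \<rho> l}"

text \<open>The normalising constant is left out: it is the same for every shift and cancels in all
  comparisons of masses.\<close>

definition gauss :: "'i set \<Rightarrow> ('i \<Rightarrow> real) \<Rightarrow> real" where
  "gauss I y = exp (- (\<Sum>i\<in>I. (y i)\<^sup>2) / 2)"

definition shifted_mass ::
  "'i set \<Rightarrow> 'l set \<Rightarrow> ('l \<Rightarrow> 'i \<Rightarrow> real) \<Rightarrow> ('l \<Rightarrow> real) \<Rightarrow> ('i \<Rightarrow> real) \<Rightarrow> ennreal" where
  "shifted_mass I A a \<rho> z = (\<integral>\<^sup>+y. ennreal (gauss I y) *
     indicator (slab I A a \<rho>) (\<lambda>i. y i - z i) \<partial>PiM I (\<lambda>_. lborel))"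

text \<open>The half widths are allowed to depend on \<open>x\<close> because after a rotation they
  are functions of the outer integration variable.\<close>

lemma borel_measurable_indicator_slab:
  assumes "finite A" "\<And>i. i \<in> I \<Longrightarrow> (\<lambda>x. f x i) \<in> borel_measurable M"
    and "\<And>l. l \<in> A \<Longrightarrow> (\<lambda>x. \<rho> x l) \<in> borel_measurable M"
  shows "(\<lambda>x. indicator (slab I A a (\<rho> x)) (f x) :: ennreal) \<in> borel_measurable M"
proof -
  have "(\<lambda>x. indicator (slab I A a (\<rho> x)) (f x) :: ennreal) =
      (\<lambda>x. if \<forall>l\<in>A. \<bar>\<Sum>i\<in>I. a l i * f x i\<bar> \<le> \<rho> x l then 1 else 0)"
    by (auto simp: slab_def indicator_def)
  moreover have "Measurable.pred M (\<lambda>x. \<forall>l\<in>A. \<bar>\<Sum>i\<in>I. a l i * f x i\<bar> \<le> \<rho> x l)"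
  proof (rule pred_intros_finite(3)[OF assms(1)])
    fix l assume "l \<in> A"
    note [measurable] = assms(3)[OF this]
    have [measurable]: "(\<lambda>x. \<Sum>i\<in>I. a l i * f x i) \<in> borel_measurable M"
      by (intro borel_measurable_sum borel_measurable_times assms(2)) auto
    show "Measurable.pred M (\<lambda>x. \<bar>\<Sum>i\<in>I. a l i * f x i\<bar> \<le> \<rho> x l)"
      by measurable
  qed
  ultimately show ?thesis by simp
qed

lemma borel_measurable_gauss:
  assumes "\<And>i. i \<in> I \<Longrightarrow> (\<lambda>x. f x i) \<in> borel_measurable M"
  shows "(\<lambda>x. ennreal (gauss I (f x))) \<in> borel_measurable M"
proof -
  have [measurable]: "(\<lambda>x. \<Sum>i\<in>I. (f x i)\<^sup>2) \<in> borel_measurable M"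
    by (intro borel_measurable_sum borel_measurable_power assms)
  show ?thesis unfolding gauss_def by measurable
qed

lemma measurable_PiM_lborel_component:
  "i \<in> I \<Longrightarrow> (\<lambda>y. y i) \<in> borel_measurable (PiM I (\<lambda>_. lborel :: real measure))"
  using measurable_component_singleton[of i I "\<lambda>_. lborel"] by simp

lemmas gauss_measurable =
  borel_measurable_indicator_slab borel_measurable_gauss borel_measurable_times_ennreal
  measurable_PiM_lborel_component borel_measurable_add borel_measurable_diff
  borel_measurable_times borel_measurable_const borel_measurable_sum borel_measurable_abs
  measurable_compose[OF measurable_fst measurable_PiM_lborel_component]
  measurable_compose[OF measurable_snd measurable_PiM_lborel_component]

lemma slab_cong: "(\<And>i. i \<in> I \<Longrightarrow> f i = g i) \<Longrightarrow> f \<in> slab I A a \<rho> \<longleftrightarrow> g \<in> slab I A a \<rho>"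
  by (simp add: slab_def)

lemma gauss_cong: "(\<And>i. i \<in> I \<Longrightarrow> f i = g i) \<Longrightarrow> gauss I f = gauss I g"
  by (simp add: gauss_def)

lemma indicator_slab_cong:
  "(\<And>i. i \<in> I \<Longrightarrow> f i = g i) \<Longrightarrow> indicator (slab I A a \<rho>) f = (indicator (slab I A a \<rho>) g :: ennreal)"
  using slab_cong[of I f g A a \<rho>] by (simp add: indicator_def)

lemma slab_uminus: "(\<lambda>i. - f i) \<in> slab I A a \<rho> \<longleftrightarrow> f \<in> slab I A a \<rho>"
  by (simp add: slab_def sum_negf)

text \<open>Weight and slabs are invariant under reflection. This allows the square of the mass to
  be written with the opposite shifts \<open>z\<close> and \<open>- z\<close>.\<close>

lemma shifted_mass_uminus:
  assumes "finite I" "finite A"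
  shows "shifted_mass I A a \<rho> (\<lambda>i. - z i) = shifted_mass I A a \<rho> z"
proof -
  have "shifted_mass I A a \<rho> z = (\<integral>\<^sup>+y. ennreal (gauss I (\<lambda>i\<in>I. 0 + (-1) * y i)) *
     indicator (slab I A a \<rho>) (\<lambda>i. (\<lambda>i\<in>I. 0 + (-1) * y i) i - z i) \<partial>PiM I (\<lambda>_. lborel))"
    unfolding shifted_mass_def
    by (subst nn_integral_PiM_lborel_affine[OF assms(1), of "-1" _ "\<lambda>_. 0"])
      (auto intro!: gauss_measurable assms)
  also have "\<dots> = shifted_mass I A a \<rho> (\<lambda>i. - z i)"
    unfolding shifted_mass_def
  proof (intro nn_integral_cong arg_cong2[where f="(*)"])
    fix y :: "'a \<Rightarrow> real"
    show "ennreal (gauss I (\<lambda>i\<in>I. 0 + (-1) * y i)) = ennreal (gauss I y)"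
      by (simp add: gauss_def)
    have "(\<lambda>i. (\<lambda>i\<in>I. 0 + (-1) * y i) i - z i) \<in> slab I A a \<rho> \<longleftrightarrow>
        (\<lambda>i. - (y i - - z i)) \<in> slab I A a \<rho>"
      by (rule slab_cong) simp
    then show "indicator (slab I A a \<rho>) (\<lambda>i. (\<lambda>i\<in>I. 0 + (-1) * y i) i - z i) =
        (indicator (slab I A a \<rho>) (\<lambda>i. y i - - z i) :: ennreal)"
      unfolding slab_uminus by (simp add: indicator_def)
  qed
  finally show ?thesis ..
qed

section \<open>Rotation of two independent Gaussian vectors\<close>

lemma abs_add_diff_le_iff: "\<bar>x + y\<bar> \<le> r \<and> \<bar>x - y\<bar> \<le> r \<longleftrightarrow> \<bar>y\<bar> \<le> r - \<bar>x\<bar>" for x y r :: real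
  by linarith

text \<open>With \<open>p\<close> fixed, the constraints on the sum and on the difference merge into
  a single symmetric constraint on \<open>q\<close>. Its half width is reduced by the size of the
  same linear form at \<open>p\<close>, so the class of slab intersections is preserved.\<close>

lemma slab_rotate:
  "(\<lambda>i. (p i + q i) / sqrt 2) \<in> slab I A a \<rho> \<and> (\<lambda>i. (p i - q i) / sqrt 2) \<in> slab I A a \<rho> \<longleftrightarrow>
   q \<in> slab I A a (\<lambda>l. sqrt 2 * \<rho> l - \<bar>\<Sum>i\<in>I. a l i * p i\<bar>)"
proof -
  have "\<bar>\<Sum>i\<in>I. a l i * ((p i + q i) / sqrt 2)\<bar> \<le> \<rho> l \<and> \<bar>\<Sum>i\<in>I. a l i * ((p i - q i) / sqrt 2)\<bar> \<le> \<rho> l \<longleftrightarrow>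
      \<bar>\<Sum>i\<in>I. a l i * q i\<bar> \<le> sqrt 2 * \<rho> l - \<bar>\<Sum>i\<in>I. a l i * p i\<bar>" for l
  proof -
    have "(\<Sum>i\<in>I. a l i * ((p i + q i) / sqrt 2)) = ((\<Sum>i\<in>I. a l i * p i) + (\<Sum>i\<in>I. a l i * q i)) / sqrt 2"
      "(\<Sum>i\<in>I. a l i * ((p i - q i) / sqrt 2)) = ((\<Sum>i\<in>I. a l i * p i) - (\<Sum>i\<in>I. a l i * q i)) / sqrt 2"
      by (simp_all add: sum_divide_distrib sum.distrib[symmetric] sum_subtractf[symmetric] algebra_simps)
    then show ?thesis
      by (simp add: abs_add_diff_le_iff[symmetric] divide_le_eq mult.commute)
  qed
  then show ?thesis unfolding slab_def by auto
qed

lemma gauss_rotate: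
  "gauss I (\<lambda>i. (p i + q i) / sqrt 2) * gauss I (\<lambda>i. (p i - q i) / sqrt 2) = gauss I p * gauss I q"
proof -
  have "(\<Sum>i\<in>I. ((p i + q i) / sqrt 2)\<^sup>2) + (\<Sum>i\<in>I. ((p i - q i) / sqrt 2)\<^sup>2) =
      (\<Sum>i\<in>I. (p i)\<^sup>2) + (\<Sum>i\<in>I. (q i)\<^sup>2)"
    unfolding sum.distrib[symmetric]
    by (rule sum.cong) (auto simp: power_divide power2_eq_square field_simps)
  then show ?thesis
    unfolding gauss_def exp_add[symmetric] by (simp add: field_simps)
qed

text \<open>Writing the square as the mass of a product set under two independent Gaussian vectors \<open>u\<close>,
  \<open>v\<close> and passing to \<open>p = (u + v) / sqrt 2\<close>, \<open>q = (u - v) / sqrt 2\<close>, the section at \<open>p\<close> is again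
  a shifted intersection of symmetric slabs.\<close>

lemma shifted_mass_square:
  assumes I: "finite I" and A: "finite A"
  shows "shifted_mass I A a \<rho> z * shifted_mass I A a \<rho> z =
    (\<integral>\<^sup>+p. ennreal (gauss I p) * shifted_mass I A a (\<lambda>l. sqrt 2 * \<rho> l - \<bar>\<Sum>i\<in>I. a l i * p i\<bar>)
       (\<lambda>i. sqrt 2 * z i) \<partial>PiM I (\<lambda>_. lborel))"
proof -
  let ?L = "PiM I (\<lambda>_. lborel :: real measure)"
  let ?S = "slab I A a \<rho>"
  interpret product_sigma_finite "\<lambda>_ :: 'a. lborel :: real measure" ..
  interpret finite_product_sigma_finite "\<lambda>_ :: 'a. lborel :: real measure" I
    by standard fact
  interpret pair_sigma_finite ?L ?L ..
  \<comment> \<open>With opposite shifts on \<open>u\<close> and \<open>v\<close>, the rotation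
    cancels the shift in \<open>p\<close> and collects \<open>sqrt 2 * z\<close> in
    \<open>q\<close>.\<close>
  define F where "F u v = ennreal (gauss I u) * indicator ?S (\<lambda>i. u i - z i) *
    (ennreal (gauss I v) * indicator ?S (\<lambda>i. v i + z i))" for u v
  have F_cong: "F u v = F u' v'" if "\<And>i. i \<in> I \<Longrightarrow> u i = u' i" "\<And>i. i \<in> I \<Longrightarrow> v i = v' i" for u v u' v'
    unfolding F_def using that
    by (intro arg_cong2[where f="(*)"] arg_cong[where f=ennreal] gauss_cong indicator_slab_cong) auto
  have F_meas: "(\<lambda>x. F (f x) (g x)) \<in> borel_measurable M"
    if "\<And>i. i \<in> I \<Longrightarrow> (\<lambda>x. f x i) \<in> borel_measurable M" "\<And>i. i \<in> I \<Longrightarrow> (\<lambda>x. g x i) \<in> borel_measurable M"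
    for f g and M :: "'x measure"
    unfolding F_def using that by (auto intro!: gauss_measurable A)
  have "shifted_mass I A a \<rho> z * shifted_mass I A a \<rho> z =
      shifted_mass I A a \<rho> z * shifted_mass I A a \<rho> (\<lambda>i. - z i)"
    using shifted_mass_uminus[OF I A] by simp
  also have "\<dots> = (\<integral>\<^sup>+v. (\<integral>\<^sup>+u. F u v \<partial>?L) \<partial>?L)"
    unfolding F_def shifted_mass_def
    by (subst nn_integral_multc, (auto intro!: gauss_measurable A)[1], subst nn_integral_cmult)
      (auto intro!: gauss_measurable A)
  \<comment> \<open>The rotation is split into two substitutions with scalar linear part:
    \<open>u = sqrt 2 * p - v\<close> for fixed \<open>v\<close>, and, after exchanging the
    integrals, \<open>v = (p - q) / sqrt 2\<close> for fixed \<open>p\<close>. Their Jacobian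
    factors cancel.\<close>
  also have "\<dots> = (\<integral>\<^sup>+v. ennreal (sqrt 2 ^ card I) *
      (\<integral>\<^sup>+p. F (\<lambda>i. sqrt 2 * p i - v i) v \<partial>?L) \<partial>?L)"
  proof (rule nn_integral_cong)
    fix v :: "'a \<Rightarrow> real"
    have "(\<integral>\<^sup>+u. F u v \<partial>?L) = ennreal (\<bar>sqrt 2\<bar> ^ card I) *
        (\<integral>\<^sup>+p. F (\<lambda>i\<in>I. (- v i) + sqrt 2 * p i) v \<partial>?L)"
      by (rule nn_integral_PiM_lborel_affine[OF I])
        (auto intro!: F_meas measurable_PiM_lborel_component)
    also have "(\<integral>\<^sup>+p. F (\<lambda>i\<in>I. (- v i) + sqrt 2 * p i) v \<partial>?L) =
        (\<integral>\<^sup>+p. F (\<lambda>i. sqrt 2 * p i - v i) v \<partial>?L)"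
      by (rule nn_integral_cong, rule F_cong) auto
    finally show "(\<integral>\<^sup>+u. F u v \<partial>?L) = ennreal (sqrt 2 ^ card I) *
        (\<integral>\<^sup>+p. F (\<lambda>i. sqrt 2 * p i - v i) v \<partial>?L)" by simp
  qed
  also have "\<dots> = (\<integral>\<^sup>+v. (\<integral>\<^sup>+p. ennreal (sqrt 2 ^ card I) * F (\<lambda>i. sqrt 2 * p i - v i) v \<partial>?L) \<partial>?L)"
    by (intro nn_integral_cong nn_integral_cmult[symmetric])
      (auto intro!: F_meas gauss_measurable)
  also have "\<dots> = (\<integral>\<^sup>+p. (\<integral>\<^sup>+v. ennreal (sqrt 2 ^ card I) * F (\<lambda>i. sqrt 2 * p i - v i) v \<partial>?L) \<partial>?L)"
    by (rule Fubini'[of "\<lambda>p v. ennreal (sqrt 2 ^ card I) * F (\<lambda>i. sqrt 2 * p i - v i) v"])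
      (unfold case_prod_beta, auto intro!: F_meas gauss_measurable)
  also have "\<dots> = (\<integral>\<^sup>+p. ennreal (gauss I p) * shifted_mass I A a
       (\<lambda>l. sqrt 2 * \<rho> l - \<bar>\<Sum>i\<in>I. a l i * p i\<bar>) (\<lambda>i. sqrt 2 * z i) \<partial>?L)"
  proof (rule nn_integral_cong)
    fix p :: "'a \<Rightarrow> real"
    let ?\<rho>' = "\<lambda>l. sqrt 2 * \<rho> l - \<bar>\<Sum>i\<in>I. a l i * p i\<bar>"
    have "(\<integral>\<^sup>+v. ennreal (sqrt 2 ^ card I) * F (\<lambda>i. sqrt 2 * p i - v i) v \<partial>?L) =
        ennreal (\<bar>- 1 / sqrt 2\<bar> ^ card I) * (\<integral>\<^sup>+q. ennreal (sqrt 2 ^ card I) *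
          F (\<lambda>i. sqrt 2 * p i - (\<lambda>i\<in>I. p i / sqrt 2 + (- 1 / sqrt 2) * q i) i)
            (\<lambda>i\<in>I. p i / sqrt 2 + (- 1 / sqrt 2) * q i) \<partial>?L)"
      by (rule nn_integral_PiM_lborel_affine[OF I]) (auto intro!: F_meas gauss_measurable)
    also have "\<dots> = ennreal (\<bar>- 1 / sqrt 2\<bar> ^ card I) * (\<integral>\<^sup>+q. ennreal (sqrt 2 ^ card I) *
          F (\<lambda>i. (p i + q i) / sqrt 2) (\<lambda>i. (p i - q i) / sqrt 2) \<partial>?L)"
      by (intro arg_cong2[where f="(*)"] nn_integral_cong F_cong refl)
        (auto simp: field_simps)
    also have "\<dots> = ennreal (\<bar>- 1 / sqrt 2\<bar> ^ card I) * ennreal (sqrt 2 ^ card I) * (\<integral>\<^sup>+q.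
          F (\<lambda>i. (p i + q i) / sqrt 2) (\<lambda>i. (p i - q i) / sqrt 2) \<partial>?L)"
      by (subst nn_integral_cmult) (auto intro!: F_meas gauss_measurable simp: mult.assoc divide_inverse)
    also have "ennreal (\<bar>- 1 / sqrt 2\<bar> ^ card I) * ennreal (sqrt 2 ^ card I) = 1"
      by (simp add: ennreal_mult[symmetric] power_mult_distrib[symmetric])
    also have "1 * (\<integral>\<^sup>+q. F (\<lambda>i. (p i + q i) / sqrt 2) (\<lambda>i. (p i - q i) / sqrt 2) \<partial>?L) =
      (\<integral>\<^sup>+q. ennreal (gauss I p) * (ennreal (gauss I q) *
        indicator (slab I A a ?\<rho>') (\<lambda>i. q i - sqrt 2 * z i)) \<partial>?L)"
      unfolding mult_1
    proof (rule nn_integral_cong)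
      fix q :: "'a \<Rightarrow> real"
      have "(p i + q i) / sqrt 2 - z i = (p i + (q i - sqrt 2 * z i)) / sqrt 2"
        "(p i - q i) / sqrt 2 + z i = (p i - (q i - sqrt 2 * z i)) / sqrt 2" for i
        by (simp_all add: field_simps)
      then have "indicator ?S (\<lambda>i. (p i + q i) / sqrt 2 - z i) * indicator ?S (\<lambda>i. (p i - q i) / sqrt 2 + z i)
        = (indicator (slab I A a ?\<rho>') (\<lambda>i. q i - sqrt 2 * z i) :: ennreal)"
        using slab_rotate[of p "\<lambda>i. q i - sqrt 2 * z i" I A a \<rho>] by (auto simp: indicator_def)
      moreover have "ennreal (gauss I (\<lambda>i. (p i + q i) / sqrt 2)) * ennreal (gauss I (\<lambda>i. (p i - q i) / sqrt 2)) =
         ennreal (gauss I p) * ennreal (gauss I q)"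
        using gauss_rotate[of I p q] by (simp add: ennreal_mult'[symmetric] gauss_def)
      moreover have "F (\<lambda>i. (p i + q i) / sqrt 2) (\<lambda>i. (p i - q i) / sqrt 2) =
        (ennreal (gauss I (\<lambda>i. (p i + q i) / sqrt 2)) * ennreal (gauss I (\<lambda>i. (p i - q i) / sqrt 2))) *
        (indicator ?S (\<lambda>i. (p i + q i) / sqrt 2 - z i) * indicator ?S (\<lambda>i. (p i - q i) / sqrt 2 + z i))"
        unfolding F_def by (simp only: ac_simps)
      ultimately show "F (\<lambda>i. (p i + q i) / sqrt 2) (\<lambda>i. (p i - q i) / sqrt 2) =
        ennreal (gauss I p) * (ennreal (gauss I q) *
        indicator (slab I A a ?\<rho>') (\<lambda>i. q i - sqrt 2 * z i))"
        by (simp only: mult.assoc)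
    qed
    also have "\<dots> = ennreal (gauss I p) * shifted_mass I A a ?\<rho>' (\<lambda>i. sqrt 2 * z i)"
      unfolding shifted_mass_def by (rule nn_integral_cmult) (auto intro!: gauss_measurable A)
    finally show "(\<integral>\<^sup>+v. ennreal (sqrt 2 ^ card I) * F (\<lambda>i. sqrt 2 * p i - v i) v \<partial>?L) =
      ennreal (gauss I p) * shifted_mass I A a ?\<rho>' (\<lambda>i. sqrt 2 * z i)" .
  qed
  finally show ?thesis .
qed

text \<open>On the shifted set the weight is at most \<open>exp (- D / 2)\<close>, and the Lebesgue
  volume does not see the shift. Shrinking the set by \<open>R\<close> costs
  \<open>R ^ card I\<close> in volume and puts it inside the unit cube, where the weight is at least
  \<open>exp (- card I / 2)\<close>; as slabs are symmetric and \<open>R \<ge> 1\<close>, the shrunk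
  set lies in the original one.\<close>

lemma shifted_mass_crude:
  assumes I: "finite I" and A: "finite A" and R: "R \<ge> 1"
    and bounded: "\<And>y i. y \<in> slab I A a \<rho> \<Longrightarrow> i \<in> I \<Longrightarrow> \<bar>y i\<bar> \<le> R"
    and far: "\<And>y. (\<lambda>i. y i - z i) \<in> slab I A a \<rho> \<Longrightarrow> D \<le> (\<Sum>i\<in>I. (y i)\<^sup>2)"
  shows "shifted_mass I A a \<rho> z \<le>
    ennreal (exp (- D / 2 + card I * (1/2 + ln R))) * shifted_mass I A a \<rho> (\<lambda>_. 0)"
proof -
  let ?L = "PiM I (\<lambda>_. lborel :: real measure)"
  let ?S = "slab I A a \<rho>"
  define V where "V = (\<integral>\<^sup>+y. indicator ?S y \<partial>?L)"
  have "shifted_mass I A a \<rho> z \<le> (\<integral>\<^sup>+y. ennreal (exp (- D / 2)) * indicator ?S (\<lambda>i. y i - z i) \<partial>?L)"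
    unfolding shifted_mass_def
  proof (rule nn_integral_mono)
    fix y :: "'a \<Rightarrow> real"
    show "ennreal (gauss I y) * indicator ?S (\<lambda>i. y i - z i) \<le>
        ennreal (exp (- D / 2)) * indicator ?S (\<lambda>i. y i - z i)"
      using far[of y] by (auto simp: indicator_def gauss_def intro!: ennreal_leI)
  qed
  also have "\<dots> = ennreal (exp (- D / 2)) * (\<integral>\<^sup>+y. indicator ?S (\<lambda>i. y i - z i) \<partial>?L)"
    by (rule nn_integral_cmult) (auto intro!: gauss_measurable A)
  also have "(\<integral>\<^sup>+y. indicator ?S (\<lambda>i. y i - z i) \<partial>?L) =
      ennreal (\<bar>1\<bar> ^ card I) * (\<integral>\<^sup>+y. indicator ?S (\<lambda>i. (\<lambda>i\<in>I. z i + 1 * y i) i - z i) \<partial>?L)"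
    by (rule nn_integral_PiM_lborel_affine[OF I]) (auto intro!: gauss_measurable A)
  also have "\<dots> = V"
    unfolding V_def by (auto intro!: nn_integral_cong indicator_slab_cong)
  also have "V = ennreal (\<bar>R\<bar> ^ card I) * (\<integral>\<^sup>+y. indicator ?S (\<lambda>i\<in>I. 0 + R * y i) \<partial>?L)"
    unfolding V_def using R
    by (intro nn_integral_PiM_lborel_affine[OF I]) (auto intro!: gauss_measurable A)
  also have "\<dots> \<le> ennreal (\<bar>R\<bar> ^ card I) * (\<integral>\<^sup>+y. ennreal (exp (card I / 2)) *
      (ennreal (gauss I y) * indicator ?S (\<lambda>i. y i - 0)) \<partial>?L)"
  proof (intro mult_left_mono nn_integral_mono)
    fix y :: "'a \<Rightarrow> real"
    show "indicator ?S (\<lambda>i\<in>I. 0 + R * y i) \<le>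
      ennreal (exp (card I / 2)) * (ennreal (gauss I y) * indicator ?S (\<lambda>i. y i - 0))"
    proof (cases "(\<lambda>i. R * y i) \<in> ?S")
      case True
      have "\<bar>y i\<bar> \<le> 1" if "i \<in> I" for i
        using bounded[OF True that] R by (simp add: abs_mult)
      then have "(\<Sum>i\<in>I. (y i)\<^sup>2) \<le> (\<Sum>i\<in>I. 1)"
        by (intro sum_mono) (simp add: abs_square_le_1)
      then have "1 \<le> exp (card I / 2) * gauss I y"
        unfolding gauss_def exp_add[symmetric] by simp
      then have "1 \<le> ennreal (exp (card I / 2)) * ennreal (gauss I y)"
        by (simp add: ennreal_mult''[symmetric] gauss_def)
      moreover have "y \<in> ?S"
        unfolding slab_def
      proof clarify
        fix l assume l: "l \<in> A"
        let ?s = "\<Sum>i\<in>I. a l i * y i"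
        have "\<bar>R * ?s\<bar> \<le> \<rho> l"
          using True l by (simp add: slab_def sum_distrib_left mult.left_commute)
        moreover have "\<bar>?s\<bar> \<le> R * \<bar>?s\<bar>"
          using R by (simp add: mult_le_cancel_right1)
        ultimately show "\<bar>?s\<bar> \<le> \<rho> l" using R by (simp add: abs_mult)
      qed
      ultimately show ?thesis by (auto simp: indicator_def)
    next
      case False
      then have "(\<lambda>i\<in>I. 0 + R * y i) \<notin> ?S"
        using slab_cong[of I "\<lambda>i\<in>I. 0 + R * y i" "\<lambda>i. R * y i" A a \<rho>] by simp
      then show ?thesis by simp
    qed
  qed simp
  also have "(\<integral>\<^sup>+y. ennreal (exp (card I / 2)) *
      (ennreal (gauss I y) * indicator ?S (\<lambda>i. y i - 0)) \<partial>?L) =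
      ennreal (exp (card I / 2)) * shifted_mass I A a \<rho> (\<lambda>_. 0)"
    unfolding shifted_mass_def by (rule nn_integral_cmult) (auto intro!: gauss_measurable A)
  finally have "shifted_mass I A a \<rho> z \<le> ennreal (exp (- D / 2)) *
    (ennreal (\<bar>R\<bar> ^ card I) * (ennreal (exp (card I / 2)) * shifted_mass I A a \<rho> (\<lambda>_. 0)))"
    by (simp add: mult_left_mono)
  also have "\<dots> = ennreal (exp (- D / 2) * R ^ card I * exp (card I / 2)) * shifted_mass I A a \<rho> (\<lambda>_. 0)"
    using R by (simp add: ennreal_mult mult.assoc)
  also have "exp (- D / 2) * R ^ card I * exp (card I / 2) = exp (- D / 2 + card I * (1/2 + ln R))"
  proof -
    have "R ^ card I = exp (card I * ln R)"
      using R by (subst exp_of_nat_mult) simp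
    then show ?thesis
      by (simp add: exp_add[symmetric] algebra_simps)
  qed
  finally show ?thesis .
qed

section \<open>Removing the dimensional factor by iterated squaring\<close>

lemma ennreal_le_if_square_le:
  fixes x y :: ennreal
  assumes "x * x \<le> y * y"
  shows "x \<le> y"
proof (cases x; cases y)
  fix a b :: real assume "x = ennreal a" "0 \<le> a" "y = ennreal b" "0 \<le> b"
  then show ?thesis
    using assms power2_le_imp_le[of a b] by (simp add: ennreal_mult[symmetric] power2_eq_square)
qed (use assms in \<open>auto simp: ennreal_mult[symmetric] top_unique\<close>)

text \<open>Each round applies the previous bound to the sections of the squared mass and takes a
  square root. The summand \<open>k * ln 2 / 2\<close> records that the size bound has grown to
  \<open>sqrt 2 ^ k * R\<close> when the crude estimate is finally used.\<close>

lemma shifted_mass_iterated: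
  assumes I: "finite I" and A: "finite A" and "R \<ge> 1"
    and "\<And>y i. y \<in> slab I A a \<rho> \<Longrightarrow> i \<in> I \<Longrightarrow> \<bar>y i\<bar> \<le> R"
    and "\<And>y. (\<lambda>i. y i - z i) \<in> slab I A a \<rho> \<Longrightarrow> D \<le> (\<Sum>i\<in>I. (y i)\<^sup>2)"
  shows "shifted_mass I A a \<rho> z \<le>
    ennreal (exp (- D / 2 + card I * (1/2 + ln R + k * ln 2 / 2) / 2 ^ k)) * shifted_mass I A a \<rho> (\<lambda>_. 0)"
  using assms(3-)
proof (induction k arbitrary: R \<rho> z D)
  case 0
  then show ?case using shifted_mass_crude[OF I A, of R a \<rho> z D] by simp
next
  case (Suc k)
  let ?L = "PiM I (\<lambda>_. lborel :: real measure)"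
  let ?\<rho>' = "\<lambda>p l. sqrt 2 * \<rho> l - \<bar>\<Sum>i\<in>I. a l i * p i\<bar>"
  let ?e = "- D / 2 + card I * (1/2 + ln R + Suc k * ln 2 / 2) / 2 ^ Suc k"
  let ?c = "- (2 * D) / 2 + card I * (1/2 + ln (sqrt 2 * R) + k * ln 2 / 2) / 2 ^ k"
  have "ln (sqrt 2 * R) = ln 2 / 2 + ln R"
    using Suc.prems(1) by (simp add: ln_mult ln_sqrt)
  \<comment> \<open>Here \<open>?c\<close> is the exponent of the induction hypothesis for
    \<open>2 * D\<close> and \<open>sqrt 2 * R\<close>. The extra \<open>ln 2 / 2\<close> from
    \<open>ln (sqrt 2 * R)\<close> turns \<open>k\<close> into \<open>Suc k\<close>.\<close>
  then have e: "?c = ?e + ?e" by (simp add: field_simps)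
  \<comment> \<open>Subtracting an absolute value only narrows the slabs, so every section divided
    by \<open>sqrt 2\<close> lies in the original intersection. Hence the new size and distance
    bounds are uniform in \<open>p\<close>.\<close>
  have scale: "(\<lambda>i. y i / sqrt 2) \<in> slab I A a \<rho>" if "y \<in> slab I A a (?\<rho>' p)" for y p
    using that slab_rotate[of "\<lambda>_. 0" y I A a \<rho>] by (force simp: slab_def)
  have IH: "shifted_mass I A a (?\<rho>' p) (\<lambda>i. sqrt 2 * z i) \<le>
      ennreal (exp ?c) * shifted_mass I A a (?\<rho>' p) (\<lambda>_. 0)" for p
  proof (rule Suc.IH)
    have "1 * 1 \<le> sqrt 2 * R" using Suc.prems(1) by (intro mult_mono) auto
    then show "1 \<le> sqrt 2 * R" by simp
    show "\<bar>y i\<bar> \<le> sqrt 2 * R" if "y \<in> slab I A a (?\<rho>' p)" "i \<in> I" for y i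
      using Suc.prems(2)[OF scale[OF that(1)] that(2)] by (simp add: divide_le_eq mult.commute)
    show "2 * D \<le> (\<Sum>i\<in>I. (y i)\<^sup>2)" if "(\<lambda>i. y i - sqrt 2 * z i) \<in> slab I A a (?\<rho>' p)" for y
    proof -
      have "(\<lambda>i. (y i - sqrt 2 * z i) / sqrt 2) = (\<lambda>i. y i / sqrt 2 - z i)"
        by (simp add: diff_divide_distrib)
      then have "D \<le> (\<Sum>i\<in>I. (y i / sqrt 2)\<^sup>2)"
        using Suc.prems(3)[of "\<lambda>i. y i / sqrt 2"] scale[OF that] by simp
      then show ?thesis by (simp add: power_divide sum_divide_distrib[symmetric])
    qed
  qed
  have "shifted_mass I A a \<rho> z * shifted_mass I A a \<rho> z \<le>
      (\<integral>\<^sup>+p. ennreal (gauss I p) * (ennreal (exp ?c) * shifted_mass I A a (?\<rho>' p) (\<lambda>_. 0)) \<partial>?L)"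
    unfolding shifted_mass_square[OF I A]
    by (intro nn_integral_mono mult_left_mono IH) simp
  also have "\<dots> = (\<integral>\<^sup>+p. ennreal (exp ?c) * (ennreal (gauss I p) * shifted_mass I A a (?\<rho>' p) (\<lambda>_. 0)) \<partial>?L)"
    by (simp add: mult.left_commute)
  also have "\<dots> = ennreal (exp ?c) * (\<integral>\<^sup>+p. ennreal (gauss I p) * shifted_mass I A a (?\<rho>' p) (\<lambda>_. 0) \<partial>?L)"
  proof (rule nn_integral_cmult)
    interpret product_sigma_finite "\<lambda>_ :: 'a. lborel :: real measure" ..
    interpret finite_product_sigma_finite "\<lambda>_ :: 'a. lborel :: real measure" I
      by standard fact
    show "(\<lambda>p. ennreal (gauss I p) * shifted_mass I A a (?\<rho>' p) (\<lambda>_. 0)) \<in> borel_measurable ?L"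
      unfolding shifted_mass_def
      by (intro borel_measurable_times_ennreal borel_measurable_nn_integral)
        (unfold case_prod_beta, auto intro!: gauss_measurable A)
  qed
  \<comment> \<open>The squaring identity for the shift zero, read backwards, recovers the square of
    the unshifted mass exactly.\<close>
  also have "\<dots> = ennreal (exp ?c) * (shifted_mass I A a \<rho> (\<lambda>_. 0) * shifted_mass I A a \<rho> (\<lambda>_. 0))"
    unfolding shifted_mass_square[OF I A, of a \<rho> "\<lambda>_. 0"] by simp
  also have "\<dots> = (ennreal (exp ?e) * shifted_mass I A a \<rho> (\<lambda>_. 0)) * (ennreal (exp ?e) * shifted_mass I A a \<rho> (\<lambda>_. 0))"
    unfolding e exp_add by (simp add: ennreal_mult ac_simps)
  finally show ?case by (rule ennreal_le_if_square_le)
qed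

text \<open>The correction in the exponent is linear in \<open>k\<close> over \<open>2 ^ k\<close>
  and vanishes in the limit. Neither \<open>card I\<close> nor \<open>R\<close> remains in the
  bound, although finiteness of \<open>R\<close> is what starts the iteration. If the unshifted mass
  is infinite, the right-hand side is infinite as well.\<close>

theorem shifted_mass_le:
  assumes I: "finite I" and A: "finite A" and R: "R \<ge> 1"
    and bounded: "\<And>y i. y \<in> slab I A a \<rho> \<Longrightarrow> i \<in> I \<Longrightarrow> \<bar>y i\<bar> \<le> R"
    and far: "\<And>y. (\<lambda>i. y i - z i) \<in> slab I A a \<rho> \<Longrightarrow> D \<le> (\<Sum>i\<in>I. (y i)\<^sup>2)"
  shows "shifted_mass I A a \<rho> z \<le> ennreal (exp (- D / 2)) * shifted_mass I A a \<rho> (\<lambda>_. 0)"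
proof (cases "shifted_mass I A a \<rho> (\<lambda>_. 0)")
  case (real r)
  let ?e = "\<lambda>k. - D / 2 + card I * (1/2 + ln R + real k * ln 2 / 2) / 2 ^ k"
  have eq: "?e = (\<lambda>k. - D / 2 + (card I * (1/2 + ln R) * (1/2) ^ k + card I * (ln 2 / 2) * (real k * (1/2) ^ k)))"
    by (simp add: fun_eq_iff field_simps power_divide)
  have "?e \<longlonglongrightarrow> - D / 2 + (card I * (1/2 + ln R) * 0 + card I * (ln 2 / 2) * 0)"
    unfolding eq by (intro tendsto_intros LIMSEQ_power_zero powser_times_n_limit_0) auto
  then have lim: "?e \<longlonglongrightarrow> - D / 2" by simp
  have "(\<lambda>k. ennreal (exp (?e k) * r)) \<longlonglongrightarrow> ennreal (exp (- D / 2) * r)"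
    by (intro tendsto_ennrealI tendsto_mult tendsto_exp lim tendsto_const)
  moreover have "shifted_mass I A a \<rho> z \<le> ennreal (exp (?e k) * r)" for k
    using shifted_mass_iterated[where k=k, OF I A R, of a \<rho> z D] bounded far real
    by (simp add: ennreal_mult)
  ultimately have "shifted_mass I A a \<rho> z \<le> ennreal (exp (- D / 2) * r)"
    by (intro LIMSEQ_le_const) auto
  then show ?thesis using real by (simp add: ennreal_mult)
qed (simp add: ennreal_mult_top)

subsection \<open>The law of an orthonormal family of functionals\<close>

text \<open>The frequency \<open>s = 0\<close> shows that \<open>c\<close> is the total weight. If
  \<open>c > 0\<close>, then \<open>w / c\<close> is a probability density under which
  \<open>X\<close> has the standard normal characteristic function; if \<open>c = 0\<close>, the
  weight vanishes almost everywhere and both sides are zero.\<close>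

lemma (in prob_space) weighted_gaussian_law:
  fixes X w :: "'a \<Rightarrow> real" and B c :: real
  assumes [measurable]: "X \<in> borel_measurable M" "w \<in> borel_measurable M"
    and w: "\<And>x. 0 \<le> w x" "\<And>x. w x \<le> B"
    and char: "\<And>s. (\<integral>x. w x * iexp (s * X x) \<partial>M) = complex_of_real (c * exp (- s\<^sup>2 / 2))"
    and [measurable]: "A \<in> sets borel"
  shows "(\<integral>x. w x * indicator A (X x) \<partial>M) = c * measure std_normal_distribution A"
proof -
  have int_w: "integrable M w"
    by (rule integrable_const_bound[of _ B]) (use w in auto)
  have "complex_of_real (\<integral>x. w x \<partial>M) = complex_of_real c"
    using char[of 0] by simp
  then have c: "c = (\<integral>x. w x \<partial>M)"
    unfolding of_real_eq_iff by simp
  show ?thesis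
  proof (cases "c = 0")
    case True
    then have "AE x in M. w x = 0"
      using integral_nonneg_eq_0_iff_AE[OF int_w] w c by simp
    then have "(\<integral>x. w x * indicator A (X x) \<partial>M) = (\<integral>x. 0 \<partial>M)"
      by (intro integral_cong_AE) auto
    then show ?thesis using True by simp
  next
    case False
    then have c0: "c > 0"
      using c w(1) Bochner_Integration.integral_nonneg_AE[of w M] by (simp add: less_le)
    define Q where "Q = density M (\<lambda>x. ennreal (w x / c))"
    have "prob_space Q"
    proof
      have "emeasure Q (space Q) = (\<integral>\<^sup>+x. ennreal (w x / c) \<partial>M)"
        unfolding Q_def by (subst emeasure_density) (auto intro!: nn_integral_cong)
      also have "\<dots> = ennreal (\<integral>x. w x / c \<partial>M)"
        using int_w w c0 by (intro nn_integral_eq_integral) auto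
      also have "(\<integral>x. w x / c \<partial>M) = 1"
        using c c0 by simp
      finally show "emeasure Q (space Q) = 1" by simp
    qed
    then interpret Q: prob_space Q .
    have [measurable]: "X \<in> borel_measurable Q"
      unfolding Q_def by simp
    have "real_distribution (distr Q borel X)"
      by (rule Q.real_distribution_distr) simp
    moreover have "char (distr Q borel X) = char std_normal_distribution"
    proof
      fix s
      have "char (distr Q borel X) s = (\<integral>x. iexp (s * X x) \<partial>Q)"
        unfolding char_def by (subst integral_distr) auto
      also have "\<dots> = (\<integral>x. (w x / c) *\<^sub>R iexp (s * X x) \<partial>M)"
        unfolding Q_def using w c0 by (subst integral_density) auto
      also have "\<dots> = (\<integral>x. (1 / c) *\<^sub>R (w x * iexp (s * X x)) \<partial>M)"
        by (simp add: scaleR_conv_of_real mult.assoc)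
      also have "\<dots> = (1 / c) *\<^sub>R complex_of_real (c * exp (- s\<^sup>2 / 2))"
        unfolding integral_scaleR_right char ..
      also have "\<dots> = char std_normal_distribution s"
        using c0 by (simp add: char_std_normal_distribution scaleR_conv_of_real)
      finally show "char (distr Q borel X) s = char std_normal_distribution s" .
    qed
    ultimately have law: "distr Q borel X = std_normal_distribution"
      by (intro Levy_uniqueness real_dist_normal_dist)
    have "measure std_normal_distribution A = (\<integral>x. indicator A x \<partial>distr Q borel X)"
      unfolding law by simp
    also have "\<dots> = (\<integral>x. indicator A (X x) \<partial>Q)"
      by (subst integral_distr) auto
    also have "\<dots> = (\<integral>x. (w x / c) *\<^sub>R indicator A (X x) \<partial>M)"
      unfolding Q_def using w c0 by (subst integral_density) auto
    also have "\<dots> = (\<integral>x. (1 / c) * (w x * indicator A (X x)) \<partial>M)"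
      by simp
    also have "\<dots> = (1 / c) * (\<integral>x. w x * indicator A (X x) \<partial>M)"
      by (rule integral_mult_right_zero)
    finally show ?thesis using c0 by simp
  qed
qed

text \<open>Levy's uniqueness theorem applies to real variables under nonnegative weights, so the
  oscillating factor \<open>iexp Y\<close> enters through \<open>1 + cos Y\<close> and \<open>1 + sin Y\<close>.\<close>

lemma (in prob_space) gaussian_law_step:
  fixes X Y W :: "'a \<Rightarrow> real" and c q :: real
  assumes [measurable]: "X \<in> borel_measurable M" "Y \<in> borel_measurable M" "W \<in> borel_measurable M"
    and W: "\<And>x. 0 \<le> W x" "\<And>x. W x \<le> 1"
    and zero: "\<And>s. (\<integral>x. W x * iexp (s * X x) \<partial>M) = complex_of_real (c * exp (- s\<^sup>2 / 2))"
    and plus: "\<And>s. (\<integral>x. W x * iexp (s * X x + Y x) \<partial>M) = complex_of_real (c * exp (- s\<^sup>2 / 2) * q)"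
    and minus: "\<And>s. (\<integral>x. W x * iexp (s * X x - Y x) \<partial>M) = complex_of_real (c * exp (- s\<^sup>2 / 2) * q)"
    and [measurable]: "A \<in> sets borel"
  shows "(\<integral>x. complex_of_real (W x * indicator A (X x)) * iexp (Y x) \<partial>M) =
    complex_of_real (c * measure std_normal_distribution A * q)"
proof -
  have bd: "\<bar>W x\<bar> \<le> 1" for x using W[of x] by simp
  have int: "integrable M (\<lambda>x. complex_of_real (W x) * iexp (Z x))"
    if [measurable]: "Z \<in> borel_measurable M" for Z
    by (rule integrable_const_bound[of _ 1]) (use bd in \<open>auto simp: norm_mult\<close>)
  have split: "iexp (s * X x + Y x) = iexp (s * X x) * exp (\<i> * complex_of_real (Y x))"
    "iexp (s * X x - Y x) = iexp (s * X x) * exp (- (\<i> * complex_of_real (Y x)))" for s x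
    unfolding exp_add[symmetric] by (simp_all add: algebra_simps)
  have cos_char: "(\<integral>x. complex_of_real (W x * (1 + cos (Y x))) * iexp (s * X x) \<partial>M) =
      complex_of_real ((c * (1 + q)) * exp (- s\<^sup>2 / 2))" for s
  proof -
    have "complex_of_real (W x * (1 + cos (Y x))) * iexp (s * X x) = W x * iexp (s * X x) +
        ((1/2) * (W x * iexp (s * X x + Y x)) + (1/2) * (W x * iexp (s * X x - Y x)))" for x
      unfolding split by (simp add: cos_of_real[symmetric] cos_exp_eq field_simps)
    then have "(\<integral>x. complex_of_real (W x * (1 + cos (Y x))) * iexp (s * X x) \<partial>M) =
        (\<integral>x. W x * iexp (s * X x) + ((1/2) * (W x * iexp (s * X x + Y x)) + (1/2) * (W x * iexp (s * X x - Y x))) \<partial>M)"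
      by presburger
    also have "\<dots> = (\<integral>x. W x * iexp (s * X x) \<partial>M) +
       ((1/2) * (\<integral>x. W x * iexp (s * X x + Y x) \<partial>M) + (1/2) * (\<integral>x. W x * iexp (s * X x - Y x) \<partial>M))"
      using int[of "\<lambda>x. s * X x"] int[of "\<lambda>x. s * X x + Y x"] int[of "\<lambda>x. s * X x - Y x"]
      by (simp add: Bochner_Integration.integral_add)
    finally show ?thesis unfolding zero plus minus
      by (simp add: field_simps)
  qed
  \<comment> \<open>The two exponentials enter with opposite signs and have equal integrals, so they
    cancel and only the constant \<open>c\<close> of the weight \<open>W\<close> is left. This later
    makes the sine part of the claim zero.\<close>
  have sin_char: "(\<integral>x. complex_of_real (W x * (1 + sin (Y x))) * iexp (s * X x) \<partial>M) =
      complex_of_real (c * exp (- s\<^sup>2 / 2))" for s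
  proof -
    have "complex_of_real (W x * (1 + sin (Y x))) * iexp (s * X x) = W x * iexp (s * X x) +
        ((- \<i>/2) * (W x * iexp (s * X x + Y x)) + (\<i>/2) * (W x * iexp (s * X x - Y x)))" for x
      unfolding split by (simp add: sin_of_real[symmetric] sin_exp_eq field_simps)
    then have "(\<integral>x. complex_of_real (W x * (1 + sin (Y x))) * iexp (s * X x) \<partial>M) =
        (\<integral>x. W x * iexp (s * X x) + ((- \<i>/2) * (W x * iexp (s * X x + Y x)) + (\<i>/2) * (W x * iexp (s * X x - Y x))) \<partial>M)"
      by presburger
    also have "\<dots> = (\<integral>x. W x * iexp (s * X x) \<partial>M) +
       ((- \<i>/2) * (\<integral>x. W x * iexp (s * X x + Y x) \<partial>M) + (\<i>/2) * (\<integral>x. W x * iexp (s * X x - Y x) \<partial>M))"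
      using int[of "\<lambda>x. s * X x"] int[of "\<lambda>x. s * X x + Y x"] int[of "\<lambda>x. s * X x - Y x"]
      by (simp add: Bochner_Integration.integral_add)
    finally show ?thesis unfolding zero plus minus
      by (simp add: field_simps)
  qed
  let ?I = "\<lambda>x. indicator A (X x) :: real"
  have bd2: "0 \<le> W x * (1 + cos (Y x))" "W x * (1 + cos (Y x)) \<le> 2"
    "0 \<le> W x * (1 + sin (Y x))" "W x * (1 + sin (Y x)) \<le> 2" for x
  proof -
    have *: "0 \<le> W x * (1 + u) \<and> W x * (1 + u) \<le> 2" if "-1 \<le> u" "u \<le> 1" for u
      using W[of x] that mult_mono[of "W x" 1 "1 + u" 2] by auto
    show "0 \<le> W x * (1 + cos (Y x))" "W x * (1 + cos (Y x)) \<le> 2"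
      "0 \<le> W x * (1 + sin (Y x))" "W x * (1 + sin (Y x)) \<le> 2"
      using *[of "cos (Y x)"] *[of "sin (Y x)"] by auto
  qed
  note base = weighted_gaussian_law[of X W 1 c A, OF _ _ W zero]
  note cosL = weighted_gaussian_law[of X "\<lambda>x. W x * (1 + cos (Y x))" 2 "c * (1 + q)" A, OF _ _ bd2(1,2) cos_char]
  note sinL = weighted_gaussian_law[of X "\<lambda>x. W x * (1 + sin (Y x))" 2 c A, OF _ _ bd2(3,4) sin_char]
  have intR: "integrable M (\<lambda>x. W x * ?I x * f (Y x))"
    if [measurable]: "f \<in> borel_measurable borel" and "\<And>y. \<bar>f y\<bar> \<le> 1" for f :: "real \<Rightarrow> real"
    using bd that(2)
    by (intro integrable_const_bound[of _ 1]) (auto simp: abs_mult indicator_def intro!: mult_le_one)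
  have int1: "integrable M (\<lambda>x. W x * ?I x)" using intR[of "\<lambda>_. 1"] by simp
  have C: "(\<integral>x. W x * ?I x * cos (Y x) \<partial>M) = c * measure std_normal_distribution A * q"
  proof -
    have "(\<integral>x. W x * (1 + cos (Y x)) * ?I x \<partial>M) = (\<integral>x. W x * ?I x + W x * ?I x * cos (Y x) \<partial>M)"
      by (simp add: algebra_simps)
    also have "\<dots> = (\<integral>x. W x * ?I x \<partial>M) + (\<integral>x. W x * ?I x * cos (Y x) \<partial>M)"
      using int1 intR[of cos] by (intro Bochner_Integration.integral_add) auto
    finally show ?thesis using base cosL by (simp add: algebra_simps)
  qed
  have S: "(\<integral>x. W x * ?I x * sin (Y x) \<partial>M) = 0"
  proof -
    have "(\<integral>x. W x * (1 + sin (Y x)) * ?I x \<partial>M) = (\<integral>x. W x * ?I x + W x * ?I x * sin (Y x) \<partial>M)"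
      by (simp add: algebra_simps)
    also have "\<dots> = (\<integral>x. W x * ?I x \<partial>M) + (\<integral>x. W x * ?I x * sin (Y x) \<partial>M)"
      using int1 intR[of sin] by (intro Bochner_Integration.integral_add) auto
    finally show ?thesis using base sinL by (simp add: algebra_simps)
  qed
  have "complex_of_real (W x * ?I x) * iexp (Y x) =
      complex_of_real (W x * ?I x * cos (Y x)) + \<i> * complex_of_real (W x * ?I x * sin (Y x))" for x
    by (simp add: cis_conv_exp[symmetric] complex_eq_iff)
  then have "(\<integral>x. complex_of_real (W x * ?I x) * iexp (Y x) \<partial>M) =
      (\<integral>x. complex_of_real (W x * ?I x * cos (Y x)) + \<i> * complex_of_real (W x * ?I x * sin (Y x)) \<partial>M)"
    by presburger
  also have "\<dots> = (\<integral>x. complex_of_real (W x * ?I x * cos (Y x)) \<partial>M) +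
      \<i> * (\<integral>x. complex_of_real (W x * ?I x * sin (Y x)) \<partial>M)"
    using intR[of cos] intR[of sin]
    by (subst Bochner_Integration.integral_add)
      (simp_all del: of_real_mult add: integrable_mult_right)
  also have "\<dots> = complex_of_real (c * measure std_normal_distribution A * q)"
    using C S by (simp only: integral_complex_of_real) simp
  finally show ?thesis .
qed

text \<open>The joint law is found by trading exponentials for indicators one coordinate at a time:
  \<open>J = {}\<close> is the characteristic function, \<open>J = I\<close> the probability of a
  box. Multivariate uniqueness is thereby reduced to uniqueness on the line.\<close>

lemma (in prob_space) orthonormal_gaussian_box:
  fixes e :: "'i \<Rightarrow> 'a \<Rightarrow> real"
  assumes I: "finite I" and e[measurable]: "\<And>i. i \<in> I \<Longrightarrow> e i \<in> borel_measurable M"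
    and char: "\<And>t. (\<integral>x. iexp (\<Sum>i\<in>I. t i * e i x) \<partial>M) = complex_of_real (exp (- (\<Sum>i\<in>I. (t i)\<^sup>2) / 2))"
    and A[measurable]: "\<And>i. i \<in> I \<Longrightarrow> A i \<in> sets borel" and "J \<subseteq> I"
  shows "(\<integral>x. complex_of_real (\<Prod>j\<in>J. indicator (A j) (e j x)) * iexp (\<Sum>i\<in>I - J. t i * e i x) \<partial>M) =
    complex_of_real ((\<Prod>j\<in>J. measure std_normal_distribution (A j)) * exp (- (\<Sum>i\<in>I - J. (t i)\<^sup>2) / 2))"
proof -
  have "finite J" using assms(5) I finite_subset by auto
  then show ?thesis using assms(5)
  proof (induction J arbitrary: t rule: finite_induct)
    case empty
    then show ?case using char by simp
  next
    case (insert j J)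
    then have j: "j \<in> I" and JI: "J \<subseteq> I" by auto
    define K where "K = I - insert j J"
    have K: "finite K" "j \<notin> K" "I - J = insert j K" "K \<subseteq> I"
      using I insert j unfolding K_def by auto
    define W where "W x = (\<Prod>j\<in>J. indicator (A j) (e j x) :: real)" for x
    define c where "c = (\<Prod>j\<in>J. measure std_normal_distribution (A j))"
    define Y where "Y x = (\<Sum>i\<in>K. t i * e i x)" for x
    define q where "q = exp (- (\<Sum>i\<in>K. (t i)\<^sup>2) / 2)"
    \<comment> \<open>The factor \<open>r\<close> rescales all frequencies still in the exponent;
      the values \<open>0\<close>, \<open>1\<close> and \<open>-1\<close> supply the three
      hypotheses of the one-step lemma.\<close>
    have IH: "(\<integral>x. complex_of_real (W x) * iexp (s * e j x + r * Y x) \<partial>M) =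
        complex_of_real (c * exp (- s\<^sup>2 / 2) * exp (- (r\<^sup>2 * (\<Sum>i\<in>K. (t i)\<^sup>2)) / 2))" for r s
    proof -
      have "(\<Sum>i\<in>I - J. (if i = j then s else r * t i) * e i x) = s * e j x + r * Y x" for x
      proof -
        have "(\<Sum>i\<in>K. (if i = j then s else r * t i) * e i x) = r * Y x"
          unfolding Y_def sum_distrib_left using K(2) by (intro sum.cong) auto
        then show ?thesis using K by simp
      qed
      moreover have "(\<Sum>i\<in>I - J. (if i = j then s else r * t i)\<^sup>2) = s\<^sup>2 + r\<^sup>2 * (\<Sum>i\<in>K. (t i)\<^sup>2)"
      proof -
        have "(\<Sum>i\<in>K. (if i = j then s else r * t i)\<^sup>2) = r\<^sup>2 * (\<Sum>i\<in>K. (t i)\<^sup>2)"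
          unfolding sum_distrib_left using K(2) by (intro sum.cong) (auto simp: power_mult_distrib)
        then show ?thesis using K by simp
      qed
      ultimately show ?thesis
        using insert.IH[OF JI, of "\<lambda>i. if i = j then s else r * t i"]
        by (simp add: W_def c_def exp_add[symmetric] mult.assoc add_divide_distrib del: of_real_mult of_real_exp of_real_prod)
    qed
    have [measurable]: "W \<in> borel_measurable M" "Y \<in> borel_measurable M" "e j \<in> borel_measurable M"
    proof -
      have *: "i \<in> I \<Longrightarrow> (\<lambda>x. indicator (A i) (e i x) :: real) \<in> borel_measurable M" for i
        by measurable
      show "W \<in> borel_measurable M"
        unfolding W_def using JI by (intro borel_measurable_prod *) auto
      show "Y \<in> borel_measurable M"
        unfolding Y_def using K(4) e by (intro borel_measurable_sum borel_measurable_times) auto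
      show "e j \<in> borel_measurable M" using j by (rule e)
    qed
    have W: "0 \<le> W x" "W x \<le> 1" for x
      unfolding W_def by (auto intro!: prod_nonneg prod_le_1 simp: indicator_def)
    have Aj: "A j \<in> sets borel" using A j by auto
    have "(\<integral>x. complex_of_real (W x * indicator (A j) (e j x)) * iexp (Y x) \<partial>M) =
        complex_of_real (c * measure std_normal_distribution (A j) * q)"
      by (rule gaussian_law_step) (use W Aj IH[of _ 0] IH[of _ 1] IH[of _ "-1"] in \<open>simp_all add: q_def\<close>)
    then show ?case
      using insert.hyps unfolding W_def Y_def c_def q_def K_def[symmetric] by (simp add: mult.commute mult.left_commute)
  qed
qed

section \<open>The product law and probabilities of slab intersections\<close>

lemma PiM_std_normal:
  assumes I: "finite I"
  shows "PiM I (\<lambda>_. std_normal_distribution) =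
    density (PiM I (\<lambda>_. lborel)) (\<lambda>y. ennreal ((1 / sqrt (2 * pi)) ^ card I * gauss I y))"
proof -
  let ?L = "PiM I (\<lambda>_. lborel :: real measure)"
  interpret L: product_sigma_finite "\<lambda>_ :: 'a. lborel :: real measure" ..
  interpret N: prob_space std_normal_distribution by (rule prob_space_normal_density) simp
  interpret N: product_sigma_finite "\<lambda>_ :: 'a. std_normal_distribution" ..
  have "(1 / sqrt (2 * pi)) ^ card I * gauss I y = (\<Prod>i\<in>I. std_normal_density (y i))" for y
  proof -
    have "gauss I y = (\<Prod>i\<in>I. exp (- (y i)\<^sup>2 / 2))"
      unfolding gauss_def exp_sum[OF I, symmetric] by (simp add: sum_negf sum_divide_distrib)
    then show ?thesis
      by (simp add: std_normal_density_def prod_dividef power_divide)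
  qed
  then have dens: "ennreal ((1 / sqrt (2 * pi)) ^ card I * gauss I y) =
      (\<Prod>i\<in>I. ennreal (std_normal_density (y i)))" for y
    by (simp add: prod_ennreal normal_density_nonneg)
  have dm: "(\<lambda>y. ennreal ((1 / sqrt (2 * pi)) ^ card I * gauss I y)) \<in> borel_measurable ?L"
    unfolding ennreal_mult''[OF less_imp_le, of "gauss I _", unfolded gauss_def, simplified]
    using borel_measurable_gauss[of I "\<lambda>y. y" ?L] by (auto simp: gauss_def intro!: gauss_measurable)
  have "density ?L (\<lambda>y. ennreal ((1 / sqrt (2 * pi)) ^ card I * gauss I y)) =
      PiM I (\<lambda>_. std_normal_distribution)"
  proof (rule N.PiM_eqI[OF I])
    show "sets (density ?L (\<lambda>y. ennreal ((1 / sqrt (2 * pi)) ^ card I * gauss I y))) =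
        sets (PiM I (\<lambda>_. std_normal_distribution))"
      by (simp, intro sets_PiM_cong) simp_all
    fix A :: "'a \<Rightarrow> real set" assume "\<And>i. i \<in> I \<Longrightarrow> A i \<in> sets std_normal_distribution"
    then have A: "\<And>i. i \<in> I \<Longrightarrow> A i \<in> sets borel" by simp
    have "PiE I A \<in> sets ?L"
      using A I by (intro sets_PiM_I_finite) auto
    then have "emeasure (density ?L (\<lambda>y. ennreal ((1 / sqrt (2 * pi)) ^ card I * gauss I y))) (PiE I A) =
        (\<integral>\<^sup>+y. (\<Prod>i\<in>I. ennreal (std_normal_density (y i))) * indicator (PiE I A) y \<partial>?L)"
      using dm by (subst emeasure_density) (auto simp: dens)
    also have "\<dots> = (\<integral>\<^sup>+y. (\<Prod>i\<in>I. ennreal (std_normal_density (y i)) * indicator (A i) (y i)) \<partial>?L)"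
    proof (rule nn_integral_cong)
      fix y assume y: "y \<in> space ?L"
      show "(\<Prod>i\<in>I. ennreal (std_normal_density (y i))) * indicator (PiE I A) y =
          (\<Prod>i\<in>I. ennreal (std_normal_density (y i)) * indicator (A i) (y i))"
      proof (cases "y \<in> PiE I A")
        case True then show ?thesis
          by (auto intro!: prod.cong simp: PiE_iff)
      next
        case False
        then obtain i where "i \<in> I" "y i \<notin> A i"
          using y by (auto simp: space_PiM PiE_iff)
        then have "(\<Prod>i\<in>I. ennreal (std_normal_density (y i)) * indicator (A i) (y i)) = 0"
          by (intro prod_zero[OF I] bexI[of _ i]) simp_all
        then show ?thesis using False by simp
      qed
    qed
    also have "\<dots> = (\<Prod>i\<in>I. \<integral>\<^sup>+y. ennreal (std_normal_density y) * indicator (A i) y \<partial>lborel)"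
      using A by (intro L.product_nn_integral_prod[OF I]) auto
    also have "\<dots> = (\<Prod>i\<in>I. emeasure std_normal_distribution (A i))"
      using A by (intro prod.cong) (auto simp: emeasure_density)
    finally show "emeasure (density ?L (\<lambda>y. ennreal ((1 / sqrt (2 * pi)) ^ card I * gauss I y))) (PiE I A) =
      (\<Prod>i\<in>I. emeasure std_normal_distribution (A i))" .
  qed
  then show ?thesis ..
qed

text \<open>The box probabilities identify the law of the vector \<open>e\<close> as a standard
  Gaussian product. The prefactor is the same for every shift \<open>z\<close>, so inequalities
  between values of \<open>shifted_mass\<close> transfer to the measure.\<close>

lemma (in prob_space) orthonormal_gaussian_slab:
  fixes e :: "'i \<Rightarrow> 'a \<Rightarrow> real"
  assumes I: "finite I" and e[measurable]: "\<And>i. i \<in> I \<Longrightarrow> e i \<in> borel_measurable M"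
    and char: "\<And>t. (\<integral>x. iexp (\<Sum>i\<in>I. t i * e i x) \<partial>M) = complex_of_real (exp (- (\<Sum>i\<in>I. (t i)\<^sup>2) / 2))"
    and L: "finite L"
  shows "emeasure M {x \<in> space M. (\<lambda>i. e i x - z i) \<in> slab I L a \<rho>} =
    ennreal ((1 / sqrt (2 * pi)) ^ card I) * shifted_mass I L a \<rho> z"
proof -
  let ?N = "PiM I (\<lambda>_. std_normal_distribution)"
  let ?B = "PiM I (\<lambda>_. borel :: real measure)"
  let ?E = "\<lambda>x. \<lambda>i\<in>I. e i x"
  interpret N1: prob_space std_normal_distribution by (rule prob_space_normal_density) simp
  interpret N: product_sigma_finite "\<lambda>_ :: 'i. std_normal_distribution" ..
  have E[measurable]: "?E \<in> M \<rightarrow>\<^sub>M ?B"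
    by (rule measurable_restrict) measurable
  have sets_B: "sets ?B = sets ?N" "sets ?B = sets (PiM I (\<lambda>_. lborel))"
    by (intro sets_PiM_cong; simp)+
  have "distr M ?B ?E = ?N"
  proof (rule N.PiM_eqI[OF I])
    show "sets (distr M ?B ?E) = sets ?N" using sets_B by simp
    fix A :: "'i \<Rightarrow> real set" assume "\<And>i. i \<in> I \<Longrightarrow> A i \<in> sets std_normal_distribution"
    then have A[measurable]: "\<And>i. i \<in> I \<Longrightarrow> A i \<in> sets borel" by simp
    have box: "PiE I A \<in> sets ?B"
      using A I by (intro sets_PiM_I_finite) auto
    define F where "F = ?E -` PiE I A \<inter> space M"
    have F: "F \<in> sets M" unfolding F_def using measurable_sets[OF E box] .
    have "complex_of_real (\<integral>x. (\<Prod>j\<in>I. indicator (A j) (e j x)) \<partial>M) =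
        complex_of_real (\<Prod>i\<in>I. measure std_normal_distribution (A i))"
      using orthonormal_gaussian_box[where t="\<lambda>_. 0" and A=A and J=I and e=e, OF I e char A order.refl]
      unfolding integral_complex_of_real[symmetric] by simp
    then have "(\<Prod>i\<in>I. measure std_normal_distribution (A i)) = (\<integral>x. (\<Prod>j\<in>I. indicator (A j) (e j x)) \<partial>M)"
      unfolding of_real_eq_iff ..
    also have "\<dots> = (\<integral>x. indicator F x \<partial>M)"
    proof (intro Bochner_Integration.integral_cong refl)
      fix x assume x: "x \<in> space M"
      show "(\<Prod>j\<in>I. indicator (A j) (e j x)) = (indicator F x :: real)"
      proof (cases "x \<in> F")
        case True then show ?thesis by (auto simp: F_def PiE_iff intro!: prod.neutral)
      next
        case False
        then obtain i where "i \<in> I" "e i x \<notin> A i"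
          using x by (auto simp: F_def PiE_iff)
        then have "(\<Prod>j\<in>I. indicator (A j) (e j x)) = (0 :: real)"
          by (intro prod_zero[OF I] bexI[of _ i]) simp_all
        then show ?thesis using False by simp
      qed
    qed
    also have "\<dots> = measure M F"
      using F by simp
    finally show "emeasure (distr M ?B ?E) (PiE I A) = (\<Prod>i\<in>I. emeasure std_normal_distribution (A i))"
      using box by (simp add: emeasure_distr F_def[symmetric] emeasure_eq_measure
          N1.emeasure_eq_measure prod_ennreal)
  qed
  then have law: "distr M ?B ?E = density (PiM I (\<lambda>_. lborel)) (\<lambda>y. ennreal ((1 / sqrt (2 * pi)) ^ card I * gauss I y))"
    unfolding PiM_std_normal[OF I] .
  define S where "S y = (indicator (slab I L a \<rho>) (\<lambda>i. y i - z i) :: ennreal)" for y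
  have comp: "i \<in> I \<Longrightarrow> (\<lambda>y. y i) \<in> borel_measurable ?B" for i
    using measurable_component_singleton[of i I "\<lambda>_. borel :: real measure"] by simp
  have SB: "S \<in> borel_measurable ?B"
    unfolding S_def by (intro borel_measurable_indicator_slab L borel_measurable_diff comp) auto
  have SL: "S \<in> borel_measurable (PiM I (\<lambda>_. lborel))"
    using SB sets_B(2) by (simp cong: measurable_cong_sets)
  have gL: "(\<lambda>y. ennreal (gauss I y)) \<in> borel_measurable (PiM I (\<lambda>_. lborel))"
    by (intro gauss_measurable)
  have mass: "ennreal ((1 / sqrt (2 * pi)) ^ card I * gauss I y) =
      ennreal ((1 / sqrt (2 * pi)) ^ card I) * ennreal (gauss I y)" for y
    by (rule ennreal_mult) (auto simp: gauss_def)
  have SE: "S (?E x) = indicator {x \<in> space M. (\<lambda>i. e i x - z i) \<in> slab I L a \<rho>} x" if "x \<in> space M" for x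
    using that slab_cong[of I "\<lambda>i. ?E x i - z i" "\<lambda>i. e i x - z i" L a \<rho>] by (simp add: S_def indicator_def)
  have ms: "{x \<in> space M. (\<lambda>i. e i x - z i) \<in> slab I L a \<rho>} \<in> sets M"
  proof -
    have "(\<lambda>x. indicator (slab I L a \<rho>) (\<lambda>i. e i x - z i) :: ennreal) \<in> borel_measurable M"
      by (intro borel_measurable_indicator_slab L) auto
    then have "{x \<in> space M. (indicator (slab I L a \<rho>) (\<lambda>i. e i x - z i) :: ennreal) = 1} \<in> sets M"
      by measurable
    then show ?thesis by (simp add: indicator_eq_1_iff)
  qed
  have "emeasure M {x \<in> space M. (\<lambda>i. e i x - z i) \<in> slab I L a \<rho>} = (\<integral>\<^sup>+x. S (?E x) \<partial>M)"
    unfolding nn_integral_indicator[OF ms, symmetric] by (intro nn_integral_cong SE[symmetric])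
  also have "\<dots> = (\<integral>\<^sup>+y. S y \<partial>distr M ?B ?E)"
    using SB by (subst nn_integral_distr) auto
  also have "\<dots> = (\<integral>\<^sup>+y. ennreal ((1 / sqrt (2 * pi)) ^ card I) * (ennreal (gauss I y) * S y) \<partial>PiM I (\<lambda>_. lborel))"
    unfolding law using SL gL by (subst nn_integral_density) (auto simp: mass mult.assoc)
  also have "\<dots> = ennreal ((1 / sqrt (2 * pi)) ^ card I) * shifted_mass I L a \<rho> z"
    unfolding shifted_mass_def S_def[symmetric] using SL gL by (intro nn_integral_cmult) auto
  finally show ?thesis .
qed

subsection \<open>Square integrable functions\<close>

lemma L2_funsD: "f \<in> L2_funs M \<Longrightarrow> f \<in> borel_measurable M" "f \<in> L2_funs M \<Longrightarrow> integrable M (\<lambda>x. (f x)\<^sup>2)"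
  by (auto simp: L2_funs_def)

lemma integrable_mult_L2:
  assumes "f \<in> L2_funs M" "g \<in> L2_funs M"
  shows "integrable M (\<lambda>x. f x * g x)"
proof -
  note [measurable] = assms[THEN L2_funsD(1)]
  have "integrable M (\<lambda>x. (f x)\<^sup>2 + (g x)\<^sup>2)"
    using assms by (auto simp: L2_funs_def)
  then show ?thesis
  proof (rule Bochner_Integration.integrable_bound)
    have "2 * \<bar>f x * g x\<bar> \<le> (f x)\<^sup>2 + (g x)\<^sup>2" for x
      using sum_squares_bound[of "\<bar>f x\<bar>" "\<bar>g x\<bar>"] by (simp add: abs_mult)
    then have "\<bar>f x * g x\<bar> \<le> (f x)\<^sup>2 + (g x)\<^sup>2" for x
      using abs_ge_zero[of "f x * g x"] by (smt (verit, ccfv_SIG))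
    then show "AE x in M. norm (f x * g x) \<le> norm ((f x)\<^sup>2 + (g x)\<^sup>2)"
      by simp
  qed measurable
qed

lemma L2_funs_add:
  assumes "f \<in> L2_funs M" "g \<in> L2_funs M"
  shows "(\<lambda>x. f x + g x) \<in> L2_funs M"
  using assms integrable_mult_L2[OF assms] by (auto simp: L2_funs_def power2_sum mult.assoc)

lemma L2_funs_scale: "f \<in> L2_funs M \<Longrightarrow> (\<lambda>x. c * f x) \<in> L2_funs M"
  by (auto simp: L2_funs_def power_mult_distrib)

lemma L2_funs_diff:
  assumes "f \<in> L2_funs M" "g \<in> L2_funs M"
  shows "(\<lambda>x. f x - g x) \<in> L2_funs M"
  using L2_funs_add[OF assms(1) L2_funs_scale[OF assms(2), of "-1"]] by simp

lemma L2_norm_nonneg: "0 \<le> L2_norm M f"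
  by (simp add: L2_norm_def)

lemma L2_norm_square: "(L2_norm M f)\<^sup>2 = (\<integral>x. (f x)\<^sup>2 \<partial>M)"
  by (simp add: L2_norm_def)

lemma L2_norm_scale: "L2_norm M (\<lambda>x. c * f x) = \<bar>c\<bar> * L2_norm M f"
  by (simp add: L2_norm_def power_mult_distrib real_sqrt_mult)

lemma L2_norm_minus_commute: "L2_norm M (\<lambda>x. f x - g x) = L2_norm M (\<lambda>x. g x - f x)"
  by (simp add: L2_norm_def power2_commute)

lemma integral_add_square:
  assumes "f \<in> L2_funs M" "g \<in> L2_funs M"
  shows "(\<integral>x. (f x + t * g x)\<^sup>2 \<partial>M) =
    (\<integral>x. (f x)\<^sup>2 \<partial>M) + 2 * t * (\<integral>x. f x * g x \<partial>M) + t\<^sup>2 * (\<integral>x. (g x)\<^sup>2 \<partial>M)"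
proof -
  have "(\<integral>x. (f x + t * g x)\<^sup>2 \<partial>M) = (\<integral>x. (f x)\<^sup>2 + (2 * t * (f x * g x) + t\<^sup>2 * (g x)\<^sup>2) \<partial>M)"
    by (simp add: power2_eq_square algebra_simps)
  also have "\<dots> = (\<integral>x. (f x)\<^sup>2 \<partial>M) + ((\<integral>x. 2 * t * (f x * g x) \<partial>M) + (\<integral>x. t\<^sup>2 * (g x)\<^sup>2 \<partial>M))"
    using L2_funsD(2)[OF assms(1)] L2_funsD(2)[OF assms(2)] integrable_mult_L2[OF assms]
    by (subst Bochner_Integration.integral_add; simp)+
  finally show ?thesis by simp
qed

lemma L2_Cauchy_Schwarz:
  assumes "f \<in> L2_funs M" "g \<in> L2_funs M"
  shows "\<bar>\<integral>x. f x * g x \<partial>M\<bar> \<le> L2_norm M f * L2_norm M g"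
proof -
  define F B G where "F = (\<integral>x. (f x)\<^sup>2 \<partial>M)" "B = (\<integral>x. f x * g x \<partial>M)" "G = (\<integral>x. (g x)\<^sup>2 \<partial>M)"
  have pos: "0 \<le> F + 2 * t * B + t\<^sup>2 * G" for t
    unfolding F_B_G_def integral_add_square[OF assms, symmetric] by simp
  have "B\<^sup>2 \<le> F * G"
  proof (cases "G = 0")
    case True
    have "B = 0"
    proof (rule ccontr)
      assume "B \<noteq> 0"
      \<comment> \<open>With \<open>G = 0\<close> the polynomial is affine in \<open>t\<close>, and
        at this \<open>t\<close> it equals \<open>- 1\<close>.\<close>
      then show False using pos[of "- (F + 1) / (2 * B)"] True by (simp add: field_simps)
    qed
    then show ?thesis using True by simp
  next
    case False
    moreover have "G \<ge> 0" unfolding F_B_G_def by simp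
    ultimately have G: "G > 0" by simp
    then show ?thesis using pos[of "- B / G"] by (simp add: field_simps power2_eq_square)
  qed
  then have "sqrt (B\<^sup>2) \<le> sqrt (F * G)" by (rule real_sqrt_le_mono)
  then show ?thesis by (simp add: L2_norm_def F_B_G_def real_sqrt_mult)
qed

lemma (in prob_space) L2_funs_bounded:
  assumes [measurable]: "f \<in> borel_measurable M" and "\<And>x. \<bar>f x\<bar> \<le> B"
  shows "f \<in> L2_funs M"
proof -
  have "\<bar>(f x)\<^sup>2\<bar> \<le> B\<^sup>2" for x
    using assms(2)[of x] power_mono[of "\<bar>f x\<bar>" B 2] by simp
  then have "integrable M (\<lambda>x. (f x)\<^sup>2)"
    by (intro integrable_const_bound[of _ "B\<^sup>2"]) auto
  then show ?thesis by (simp add: L2_funs_def)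
qed

lemma (in prob_space) L2_norm_indicator_le:
  assumes "A \<in> sets M" shows "L2_norm M (indicator A) \<le> 1"
proof -
  have "(\<integral>x. (indicator A x :: real)\<^sup>2 \<partial>M) = (\<integral>x. indicator A x \<partial>M)"
    by (intro Bochner_Integration.integral_cong) (auto simp: indicator_def)
  also have "\<dots> = prob A" using assms by simp
  finally show ?thesis by (simp add: L2_norm_def)
qed

text \<open>Riesz--Fischer for representatives. Cauchy--Schwarz against the constant one gives a
  Cauchy sequence in mean, hence an almost everywhere convergent subsequence; Fatou's lemma upgrades
  its limit to a limit in the square norm.\<close>

lemma (in prob_space) L2_complete:
  assumes s: "\<And>n :: nat. s n \<in> L2_funs M"
    and Cauchy: "\<And>e. e > 0 \<Longrightarrow> \<exists>N. \<forall>i\<ge>N. \<forall>j\<ge>N. L2_norm M (\<lambda>x. s i x - s j x) < e"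
  obtains f where "f \<in> L2_funs M" "(\<lambda>n. L2_norm M (\<lambda>x. f x - s n x)) \<longlonglongrightarrow> 0"
proof -
  note [measurable] = L2_funsD(1)[OF s]
  have one: "(\<lambda>_. 1) \<in> L2_funs M" by (rule L2_funs_bounded[of _ 1]) auto
  have L1: "(\<integral>x. norm (u x) \<partial>M) \<le> L2_norm M u" if u: "u \<in> L2_funs M" for u
  proof -
    have "(\<lambda>x. \<bar>u x\<bar>) \<in> L2_funs M" using u by (auto simp: L2_funs_def)
    from L2_Cauchy_Schwarz[OF this one] show ?thesis
      by (simp add: L2_norm_def prob_space)
  qed
  have int: "integrable M (s n)" for n
    using integrable_mult_L2[OF s one, of n] by simp
  have CL1: "\<exists>N. \<forall>i\<ge>N. \<forall>j\<ge>N. LINT x|M. norm (s i x - s j x) < e" if "e > 0" for e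
    using Cauchy[OF that] L1[OF L2_funs_diff[OF s s]] by (meson le_less_trans)
  obtain r :: "nat \<Rightarrow> nat" where r: "strict_mono r" "AE x in M. Cauchy (\<lambda>i. s (r i) x)"
    using cauchy_L1_AE_cauchy_subseq[OF int CL1] by blast
  define f where "f x = lim (\<lambda>i. s (r i) x)" for x
  have [measurable]: "f \<in> borel_measurable M"
    unfolding f_def by (rule borel_measurable_lim_metric) measurable
  have lim: "AE x in M. (\<lambda>i. s (r i) x) \<longlonglongrightarrow> f x"
    using r(2) by eventually_elim (simp add: f_def Cauchy_convergent_iff convergent_LIMSEQ_iff)
  \<comment> \<open>Fatou is applied along the subsequence with \<open>n\<close> held fixed, so the
    estimate covers the full sequence.\<close>
  have close: "(\<integral>\<^sup>+x. ennreal ((f x - s n x)\<^sup>2) \<partial>M) \<le> ennreal (e\<^sup>2)"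
    if N: "\<forall>i\<ge>N. \<forall>j\<ge>N. L2_norm M (\<lambda>x. s i x - s j x) < e" and n: "n \<ge> N" for e N n
  proof -
    have "(\<integral>\<^sup>+x. ennreal ((f x - s n x)\<^sup>2) \<partial>M) =
        (\<integral>\<^sup>+x. liminf (\<lambda>i. ennreal ((s (r i) x - s n x)\<^sup>2)) \<partial>M)"
    proof (rule nn_integral_cong_AE)
      show "AE x in M. ennreal ((f x - s n x)\<^sup>2) = liminf (\<lambda>i. ennreal ((s (r i) x - s n x)\<^sup>2))"
        using lim
      proof eventually_elim
        case (elim x)
        then have "(\<lambda>i. ennreal ((s (r i) x - s n x)\<^sup>2)) \<longlonglongrightarrow> ennreal ((f x - s n x)\<^sup>2)"
          by (intro tendsto_ennrealI tendsto_power tendsto_diff tendsto_const)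
        from lim_imp_Liminf[OF _ this] show ?case by simp
      qed
    qed
    also have "\<dots> \<le> liminf (\<lambda>i. \<integral>\<^sup>+x. ennreal ((s (r i) x - s n x)\<^sup>2) \<partial>M)"
      by (rule nn_integral_liminf) measurable
    also have "\<dots> \<le> liminf (\<lambda>i. ennreal (e\<^sup>2))"
    proof (rule Liminf_mono, rule eventually_sequentiallyI)
      fix i assume "N \<le> i"
      then have "N \<le> r i" using seq_suble[OF r(1), of i] by simp
      then have "L2_norm M (\<lambda>x. s (r i) x - s n x) \<le> e" using N n by (simp add: less_imp_le)
      then have "(L2_norm M (\<lambda>x. s (r i) x - s n x))\<^sup>2 \<le> e\<^sup>2"
        by (rule power_mono) (rule L2_norm_nonneg)
      then show "(\<integral>\<^sup>+x. ennreal ((s (r i) x - s n x)\<^sup>2) \<partial>M) \<le> ennreal (e\<^sup>2)"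
        using L2_funsD(2)[OF L2_funs_diff[OF s s]]
        by (subst nn_integral_eq_integral) (auto simp: L2_norm_square intro!: ennreal_leI)
    qed
    also have "\<dots> = ennreal (e\<^sup>2)" by (rule Liminf_const) simp
    finally show ?thesis .
  qed
  have L2: "(\<lambda>x. f x - s n x) \<in> L2_funs M \<and> L2_norm M (\<lambda>x. f x - s n x) \<le> e"
    if N: "\<forall>i\<ge>N. \<forall>j\<ge>N. L2_norm M (\<lambda>x. s i x - s j x) < e" and n: "n \<ge> N" and e: "e > 0" for e N n
  proof
    have int: "integrable M (\<lambda>x. (f x - s n x)\<^sup>2)"
      using le_less_trans[OF close[OF N n]] by (intro integrableI_bounded) auto
    then show "(\<lambda>x. f x - s n x) \<in> L2_funs M" by (simp add: L2_funs_def)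
    have "(\<integral>x. (f x - s n x)\<^sup>2 \<partial>M) \<le> e\<^sup>2"
      using close[OF N n] by (subst (asm) nn_integral_eq_integral[OF int]) (auto simp: ennreal_le_iff)
    then show "L2_norm M (\<lambda>x. f x - s n x) \<le> e"
      unfolding L2_norm_def using e by (simp add: real_le_lsqrt)
  qed
  obtain N where "\<forall>i\<ge>N. \<forall>j\<ge>N. L2_norm M (\<lambda>x. s i x - s j x) < 1"
    using Cauchy[of 1] by auto
  from L2[OF this order.refl] have "(\<lambda>x. f x - s N x) \<in> L2_funs M" by simp
  from L2_funs_add[OF this s[of N]] have "f \<in> L2_funs M" by simp
  moreover have "(\<lambda>n. L2_norm M (\<lambda>x. f x - s n x)) \<longlonglongrightarrow> 0"
  proof (rule LIMSEQ_I)
    fix e :: real assume e: "e > 0"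
    obtain N where N: "\<forall>i\<ge>N. \<forall>j\<ge>N. L2_norm M (\<lambda>x. s i x - s j x) < e / 2"
      using Cauchy[of "e / 2"] e by auto
    have "norm (L2_norm M (\<lambda>x. f x - s n x) - 0) < e" if "n \<ge> N" for n
      using conjunct2[OF L2[OF N that]] e L2_norm_nonneg[of M "\<lambda>x. f x - s n x"] by simp
    then show "\<exists>N. \<forall>n\<ge>N. norm (L2_norm M (\<lambda>x. f x - s n x) - 0) < e" by blast
  qed
  ultimately show ?thesis by (rule that)
qed

subsection \<open>Gaussian functionals\<close>

text \<open>Taking \<open>\<sigma> = 0\<close> for the point mass puts both kinds of Gaussian law
  into one form, a scaled standard normal variable.\<close>

lemma gaussian_real_mean_zero:
  assumes "gaussian_real \<nu>" "(\<integral>x. x \<partial>\<nu>) = 0"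
  obtains \<sigma> where "\<sigma> \<ge> 0" "\<nu> = distr std_normal_distribution borel (\<lambda>x. \<sigma> * x)"
proof -
  interpret N: prob_space std_normal_distribution by (rule prob_space_normal_density) simp
  show ?thesis
    using assms(1) unfolding gaussian_real_def
  proof (elim disjE exE conjE)
    fix m assume m: "\<nu> = return borel m"
    then have "m = 0" using assms(2) by (simp add: integral_return)
    then show ?thesis
      using that[of 0] m by (simp add: N.distr_const)
  next
    fix m \<sigma> :: real assume \<sigma>: "\<sigma> > 0" and \<nu>: "\<nu> = density lborel (\<lambda>t. ennreal (normal_density m \<sigma> t))"
    interpret V: prob_space \<nu> unfolding \<nu> by (rule prob_space_normal_density[OF \<sigma>])
    have dist: "distributed \<nu> lborel (\<lambda>x. x) (normal_density m \<sigma>)"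
      unfolding distributed_def using \<nu> by (auto simp: distr_id2)
    have "m = 0"
      using V.normal_distributed_expectation[OF \<sigma> dist] assms(2) by simp
    then have "distributed \<nu> lborel (\<lambda>x. x / \<sigma>) std_normal_density"
      using V.normal_standard_normal_convert[OF \<sigma>, of "\<lambda>x. x" m] dist by simp
    then have N: "distr \<nu> lborel (\<lambda>x. x / \<sigma>) = std_normal_distribution"
      by (simp add: distributed_def)
    have sets: "sets \<nu> = sets borel" unfolding \<nu> by simp
    have "distr std_normal_distribution borel (\<lambda>x. \<sigma> * x) = distr \<nu> borel (\<lambda>x. \<sigma> * (x / \<sigma>))"
      unfolding N[symmetric] using sets by (subst distr_distr) (auto simp: comp_def cong: measurable_cong_sets)
    also have "\<dots> = \<nu>"
      using \<sigma> sets by (simp add: distr_id2)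
    finally show ?thesis using that[of \<sigma>] \<sigma> by simp
  qed
qed

locale nondegenerate_gaussian = prob_space \<gamma>
  for \<gamma> :: "'a::{banach, second_countable_topology} measure" +
  assumes gaussian: "gaussian_measure \<gamma>" and mean_zero: "centred \<gamma>" and full_support: "nondegenerate \<gamma>"
begin

section \<open>Laws and moments of continuous functionals\<close>

lemma sets_gaussian[measurable_cong, simp]: "sets \<gamma> = sets borel"
  using gaussian by (simp add: gaussian_measure_def)

lemma space_gaussian[simp]: "space \<gamma> = UNIV"
  using sets_eq_imp_space_eq[OF sets_gaussian] by simp

lemma functional_borel[measurable]:
  fixes g :: "'a \<Rightarrow> real"
  assumes "bounded_linear g" shows "g \<in> borel_measurable borel"
  using assms by (intro borel_measurable_continuous_onI linear_continuous_on)

lemma functional_law: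
  fixes g :: "'a \<Rightarrow> real"
  assumes "bounded_linear g"
  obtains \<sigma> where "\<sigma> \<ge> 0" "distr \<gamma> borel g = distr std_normal_distribution borel (\<lambda>x. \<sigma> * x)"
proof -
  note [measurable] = functional_borel[OF assms]
  have "gaussian_real (distr \<gamma> borel g)"
    using gaussian assms by (auto simp: gaussian_measure_def)
  moreover have "(\<integral>x. x \<partial>distr \<gamma> borel g) = 0"
    using mean_zero assms by (simp add: integral_distr centred_def)
  ultimately show ?thesis using gaussian_real_mean_zero that by metis
qed

text \<open>All quantities are read off a standard normal variable scaled by
  \<open>\<sigma>\<close>; the second moment identifies \<open>\<sigma>\<close> with the
  \<open>L2_norm\<close> of \<open>g\<close>.\<close>

lemma functional_moments:
  fixes g :: "'a \<Rightarrow> real"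
  assumes g: "bounded_linear g"
  shows "integrable \<gamma> (\<lambda>x. g x ^ k)"
    and "(\<integral>x. g x ^ 4 \<partial>\<gamma>) = 3 * (L2_norm \<gamma> g) ^ 4"
    and "(\<integral>x. iexp (g x) \<partial>\<gamma>) = complex_of_real (exp (- (L2_norm \<gamma> g)\<^sup>2 / 2))"
proof -
  note [measurable] = functional_borel[OF g]
  obtain \<sigma> where \<sigma>: "\<sigma> \<ge> 0" and law: "distr \<gamma> borel g = distr std_normal_distribution borel (\<lambda>x. \<sigma> * x)"
    using functional_law[OF g] .
  have int: "integrable \<gamma> (\<lambda>x. f (g x)) \<longleftrightarrow> integrable std_normal_distribution (\<lambda>x. f (\<sigma> * x))"
    and eq: "(\<integral>x. f (g x) \<partial>\<gamma>) = (\<integral>x. f (\<sigma> * x) \<partial>std_normal_distribution)"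
    if [measurable]: "f \<in> borel_measurable borel" for f :: "real \<Rightarrow> 'b::{banach, second_countable_topology}"
  proof -
    have "integrable \<gamma> (\<lambda>x. f (g x)) \<longleftrightarrow> integrable (distr \<gamma> borel g) f"
      by (subst integrable_distr_eq) auto
    also have "\<dots> \<longleftrightarrow> integrable std_normal_distribution (\<lambda>x. f (\<sigma> * x))"
      unfolding law by (subst integrable_distr_eq) auto
    finally show "integrable \<gamma> (\<lambda>x. f (g x)) \<longleftrightarrow> integrable std_normal_distribution (\<lambda>x. f (\<sigma> * x))" .
    have "(\<integral>x. f (g x) \<partial>\<gamma>) = (\<integral>x. f x \<partial>distr \<gamma> borel g)"
      by (subst integral_distr) auto
    also have "\<dots> = (\<integral>x. f (\<sigma> * x) \<partial>std_normal_distribution)"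
      unfolding law by (subst integral_distr) auto
    finally show "(\<integral>x. f (g x) \<partial>\<gamma>) = (\<integral>x. f (\<sigma> * x) \<partial>std_normal_distribution)" .
  qed
  show "integrable \<gamma> (\<lambda>x. g x ^ k)"
    using int[of "\<lambda>x. x ^ k"] integrable_std_normal_distribution_moment[of k]
    by (simp add: power_mult_distrib)
  have "(\<integral>x. (g x)\<^sup>2 \<partial>\<gamma>) = \<sigma>\<^sup>2"
    using eq[of "\<lambda>x. x ^ 2"] std_normal_distribution_even_moments(1)[of 1]
    by (simp add: power_mult_distrib)
  then have norm: "L2_norm \<gamma> g = \<sigma>"
    using \<sigma> by (simp add: L2_norm_def)
  show "(\<integral>x. g x ^ 4 \<partial>\<gamma>) = 3 * (L2_norm \<gamma> g) ^ 4"
    using eq[of "\<lambda>x. x ^ 4"] std_normal_distribution_even_moments(1)[of 2]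
    by (simp add: norm power_mult_distrib fact_numeral)
  show "(\<integral>x. iexp (g x) \<partial>\<gamma>) = complex_of_real (exp (- (L2_norm \<gamma> g)\<^sup>2 / 2))"
    using eq[of "\<lambda>x. iexp x"] fun_cong[OF char_std_normal_distribution, of \<sigma>]
    by (simp add: char_def norm)
qed

lemma functional_L2: "bounded_linear g \<Longrightarrow> g \<in> L2_funs \<gamma>" for g :: "'a \<Rightarrow> real"
  using functional_moments(1)[of g 2] functional_borel[of g]
  by (auto simp: L2_funs_def cong: measurable_cong_sets)

text \<open>This is where nondegeneracy enters: a functional that is nonzero at \<open>x\<close> is
  nonzero on a ball around \<open>x\<close>, and that ball has positive measure.\<close>

lemma functional_zero:
  fixes g :: "'a \<Rightarrow> real"
  assumes g: "bounded_linear g" and zero: "L2_norm \<gamma> g = 0"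
  shows "g x = 0"
proof (rule ccontr)
  assume x: "g x \<noteq> 0"
  note [measurable] = functional_borel[OF g]
  have "AE y in \<gamma>. (g y)\<^sup>2 = 0"
    using zero integral_nonneg_eq_0_iff_AE[of \<gamma> "\<lambda>y. (g y)\<^sup>2"] functional_moments(1)[OF g, of 2]
    by (simp add: L2_norm_def)
  then have AE: "AE y in \<gamma>. g y = 0" by simp
  have "open {y. g y \<noteq> 0}"
    using linear_continuous_on[OF g, of UNIV] by (intro open_Collect_neq) auto
  then obtain r where r: "r > 0" "cball x r \<subseteq> {y. g y \<noteq> 0}"
    using x unfolding open_contains_cball by blast
  have "measure \<gamma> (cball x r) > 0"
    using full_support r(1) by (auto simp: nondegenerate_def supp_def)
  moreover have "measure \<gamma> (cball x r) = 0"
  proof -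
    have "emeasure \<gamma> {y. g y \<noteq> 0} = 0"
      using AE AE_iff_measurable[of "{y. g y \<noteq> 0}" \<gamma> "\<lambda>y. g y = 0"] by simp
    then have "emeasure \<gamma> (cball x r) = 0"
      using emeasure_mono[OF r(2), of \<gamma>] by simp
    then show ?thesis by (simp add: measure_def)
  qed
  ultimately show False by simp
qed

text \<open>Cauchy--Schwarz applied to \<open>g\<close> squared and the indicator; the Gaussian
  fourth moment contributes \<open>sqrt 3\<close>, which is rounded up to \<open>2\<close>.\<close>

lemma functional_tail:
  fixes g :: "'a \<Rightarrow> real"
  assumes g: "bounded_linear g" and [measurable]: "B \<in> sets borel"
  shows "(\<integral>x. (g x)\<^sup>2 * indicator B x \<partial>\<gamma>) \<le> 2 * (L2_norm \<gamma> g)\<^sup>2 * sqrt (measure \<gamma> B)"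
proof -
  note [measurable] = functional_borel[OF g]
  have g2: "(\<lambda>x. (g x)\<^sup>2) \<in> L2_funs \<gamma>"
    using functional_moments(1)[OF g, of 4] by (simp add: L2_funs_def)
  have B: "indicator B \<in> L2_funs \<gamma>"
    by (rule L2_funs_bounded[of _ 1]) (auto simp: indicator_def)
  have ind: "(\<lambda>x. (indicator B x :: real)\<^sup>2) = indicator B"
    by (auto simp: indicator_def)
  have "(\<integral>x. (g x)\<^sup>2 * indicator B x \<partial>\<gamma>) \<le> L2_norm \<gamma> (\<lambda>x. (g x)\<^sup>2) * L2_norm \<gamma> (indicator B)"
    using L2_Cauchy_Schwarz[OF g2 B] by simp
  also have "L2_norm \<gamma> (\<lambda>x. (g x)\<^sup>2) = sqrt 3 * (L2_norm \<gamma> g)\<^sup>2"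
  proof -
    have "((L2_norm \<gamma> g)\<^sup>2)\<^sup>2 = (L2_norm \<gamma> g) ^ 4" by simp
    then have "L2_norm \<gamma> (\<lambda>x. (g x)\<^sup>2) = sqrt (3 * ((L2_norm \<gamma> g)\<^sup>2)\<^sup>2)"
      unfolding L2_norm_def[of \<gamma> "\<lambda>x. (g x)\<^sup>2"] using functional_moments(2)[OF g] by simp
    then show ?thesis by (simp only: real_sqrt_mult real_sqrt_abs abs_power2)
  qed
  also have "L2_norm \<gamma> (indicator B) = sqrt (measure \<gamma> B)"
    unfolding L2_norm_def ind by simp
  also have "sqrt 3 * (L2_norm \<gamma> g)\<^sup>2 * sqrt (measure \<gamma> B) \<le> 2 * (L2_norm \<gamma> g)\<^sup>2 * sqrt (measure \<gamma> B)"
    by (intro mult_right_mono real_le_lsqrt) auto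
  finally show ?thesis .
qed

text \<open>The fourth moment makes the part of \<open>g\<close> outside a large ball negligible, so no integrability
  of the norm of \<open>X\<close> is needed.\<close>

lemma functional_L2_norm_le:
  obtains c where "c > 0" "\<And>g :: 'a \<Rightarrow> real. bounded_linear g \<Longrightarrow> L2_norm \<gamma> g \<le> c * onorm g"
proof -
  have "(\<lambda>n. measure \<gamma> (cball 0 (real n))) \<longlonglongrightarrow> measure \<gamma> (\<Union>n. cball 0 (real n))"
    by (rule finite_Lim_measure_incseq) (auto simp: incseq_def)
  moreover have "(\<Union>n. cball (0 :: 'a) (real n)) = UNIV"
    by (auto simp: real_arch_simple)
  ultimately have "(\<lambda>n. measure \<gamma> (cball 0 (real n))) \<longlonglongrightarrow> 1"
    using prob_space by simp
  \<comment> \<open>The complement then has measure below \<open>1/16\<close>, with square root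
    below \<open>1/4\<close>, so the tail estimate is at most half of the squared norm and can be
    absorbed on the left.\<close>
  then have "eventually (\<lambda>n. measure \<gamma> (cball 0 (real n)) > 15/16) sequentially"
    by (rule order_tendstoD) simp
  then obtain n where n: "measure \<gamma> (cball 0 (real n)) > 15/16"
    using eventually_sequentially by auto
  have B: "measure \<gamma> (- cball 0 (real n)) < 1/16"
    using n prob_compl[of "cball 0 (real n)"] by (simp add: Compl_eq_Diff_UNIV)
  show ?thesis
  proof
    \<comment> \<open>Absorbing the tail leaves a factor \<open>sqrt 2\<close>, rounded up to
      \<open>2\<close>; the summand \<open>1\<close> keeps the constant positive when
      \<open>n = 0\<close>.\<close>
    show "2 * real n + 1 > 0" by simp
    fix g :: "'a \<Rightarrow> real" assume g: "bounded_linear g"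
    note [measurable] = functional_borel[OF g]
    let ?B = "- cball 0 (real n) :: 'a set"
    have "(L2_norm \<gamma> g)\<^sup>2 = (\<integral>x. (g x)\<^sup>2 \<partial>\<gamma>)" by (rule L2_norm_square)
    also have "\<dots> \<le> (\<integral>x. (onorm g * n)\<^sup>2 + (g x)\<^sup>2 * indicator ?B x \<partial>\<gamma>)"
    proof (rule integral_mono)
      show "integrable \<gamma> (\<lambda>x. (g x)\<^sup>2)" using functional_moments(1)[OF g] .
      then show "integrable \<gamma> (\<lambda>x. (onorm g * n)\<^sup>2 + (g x)\<^sup>2 * indicator ?B x)"
        by (intro Bochner_Integration.integrable_add integrable_const integrable_real_mult_indicator) auto
      fix x
      show "(g x)\<^sup>2 \<le> (onorm g * n)\<^sup>2 + (g x)\<^sup>2 * indicator ?B x"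
      proof (cases "x \<in> ?B")
        case False
        then have "\<bar>g x\<bar> \<le> onorm g * n"
          using onorm[OF g, of x] onorm_pos_le[OF g] by (auto intro: order_trans mult_left_mono)
        then have "\<bar>g x\<bar>\<^sup>2 \<le> (onorm g * n)\<^sup>2" by (rule power_mono) simp
        then show ?thesis using False by simp
      qed simp
    qed
    also have "\<dots> = (onorm g * n)\<^sup>2 + (\<integral>x. (g x)\<^sup>2 * indicator ?B x \<partial>\<gamma>)"
      using functional_moments(1)[OF g, of 2] prob_space
      by (subst Bochner_Integration.integral_add) (auto intro!: integrable_real_mult_indicator)
    also have "\<dots> \<le> (onorm g * n)\<^sup>2 + 2 * (L2_norm \<gamma> g)\<^sup>2 * sqrt (measure \<gamma> ?B)"
      using functional_tail[OF g, of ?B] by simp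
    also have "\<dots> \<le> (onorm g * n)\<^sup>2 + 2 * (L2_norm \<gamma> g)\<^sup>2 * (1/4)"
      using B by (intro add_left_mono mult_left_mono real_le_lsqrt) (auto simp: power2_eq_square)
    finally have "(L2_norm \<gamma> g)\<^sup>2 \<le> 2 * (onorm g * n)\<^sup>2" by simp
    also have "\<dots> \<le> ((2 * real n + 1) * onorm g)\<^sup>2"
    proof -
      have "2 * (onorm g * n)\<^sup>2 \<le> (2 * (onorm g * n))\<^sup>2" by (simp add: power_mult_distrib)
      also have "\<dots> \<le> ((2 * real n + 1) * onorm g)\<^sup>2"
        using onorm_pos_le[OF g] by (intro power_mono) (auto simp: algebra_simps)
      finally show ?thesis .
    qed
    finally show "L2_norm \<gamma> g \<le> (2 * real n + 1) * onorm g"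
      by (rule power2_le_imp_le) (use onorm_pos_le[OF g] in simp)
  qed
qed

subsection \<open>The Cameron--Martin space\<close>

text \<open>The parallelogram law, in which the values at \<open>h\<close> cancel. If the energies
  of \<open>g\<close> and \<open>k\<close> are both close to the infimum, the midpoint cannot fall
  below it, so \<open>g\<close> and \<open>k\<close> are close in \<open>L2_norm\<close>.\<close>

lemma midpoint_energy:
  fixes g k :: "'a \<Rightarrow> real"
  assumes g: "bounded_linear g" and k: "bounded_linear k"
  shows "(L2_norm \<gamma> (\<lambda>x. g x - k x))\<^sup>2 / 4 = ((L2_norm \<gamma> g)\<^sup>2 / 2 - g h) + ((L2_norm \<gamma> k)\<^sup>2 / 2 - k h)
    - 2 * ((L2_norm \<gamma> (\<lambda>x. (1/2) * (g x + k x)))\<^sup>2 / 2 - (1/2) * (g h + k h))"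
proof -
  note L2 = functional_L2[OF g] functional_L2[OF k]
  have "(L2_norm \<gamma> (\<lambda>x. g x - k x))\<^sup>2 = (L2_norm \<gamma> g)\<^sup>2 - 2 * (\<integral>x. g x * k x \<partial>\<gamma>) + (L2_norm \<gamma> k)\<^sup>2"
    using integral_add_square[OF L2, of "-1"] by (simp add: L2_norm_square)
  moreover have "(L2_norm \<gamma> (\<lambda>x. g x + k x))\<^sup>2 = (L2_norm \<gamma> g)\<^sup>2 + 2 * (\<integral>x. g x * k x \<partial>\<gamma>) + (L2_norm \<gamma> k)\<^sup>2"
    using integral_add_square[OF L2, of 1] by (simp add: L2_norm_square)
  moreover have "(L2_norm \<gamma> (\<lambda>x. (1/2) * (g x + k x)))\<^sup>2 = (L2_norm \<gamma> (\<lambda>x. g x + k x))\<^sup>2 / 4"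
    unfolding L2_norm_scale by (simp add: power_divide)
  ultimately show ?thesis by (simp add: field_simps)
qed

text \<open>The representing function is the \<open>L\<^sup>2\<close> limit of a minimising sequence of
  \<open>g \<mapsto> \<parallel>g\<parallel>\<^sup>2 / 2 - g h\<close> over the continuous functionals.\<close>

lemma L2_representation:
  assumes h: "\<And>g :: 'a \<Rightarrow> real. bounded_linear g \<Longrightarrow> \<bar>g h\<bar> \<le> C * L2_norm \<gamma> g"
  obtains f where "f \<in> dual_closure \<gamma>" "\<And>g. bounded_linear g \<Longrightarrow> g h = (\<integral>x. f x * g x \<partial>\<gamma>)"
proof -
  define J where "J g = (L2_norm \<gamma> g)\<^sup>2 / 2 - g h" for g :: "'a \<Rightarrow> real"
  define V where "V = {g :: 'a \<Rightarrow> real. bounded_linear g}"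
  define m where "m = (INF g\<in>V. J g)"
  \<comment> \<open>Completing the square; this is where the bound on \<open>g h\<close> makes the
    infimum finite.\<close>
  have "- (C\<^sup>2 / 2) \<le> J g" if "g \<in> V" for g
  proof -
    have "g h \<le> C * L2_norm \<gamma> g" using h[of g] that by (auto simp: V_def)
    moreover have "0 \<le> (L2_norm \<gamma> g - C)\<^sup>2" by simp
    ultimately show ?thesis unfolding J_def by (simp add: power2_eq_square field_simps)
  qed
  then have bdd: "bdd_below (J ` V)" by (intro bdd_belowI2)
  have m_le: "m \<le> J g" if "bounded_linear g" for g
    unfolding m_def using bdd that by (intro cINF_lower) (auto simp: V_def)
  have "(\<lambda>_. 0) \<in> V" using bounded_linear_zero unfolding V_def by simp
  then have "V \<noteq> {}" by blast
  have "\<exists>g\<in>V. J g < m + 1 / (real n + 1)" for n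
  proof -
    have "m < m + 1 / (real n + 1)" by simp
    then show ?thesis unfolding m_def using cINF_less_iff[OF \<open>V \<noteq> {}\<close> bdd] by blast
  qed
  then obtain s where s: "\<And>n. bounded_linear (s n)" and sJ: "\<And>n. J (s n) < m + 1 / (real n + 1)"
    unfolding V_def by (metis mem_Collect_eq)
  have diff: "(L2_norm \<gamma> (\<lambda>x. s i x - s j x))\<^sup>2 / 4 \<le> 1 / (real i + 1) + 1 / (real j + 1)" for i j
  proof -
    have "m \<le> (L2_norm \<gamma> (\<lambda>x. (1/2) * (s i x + s j x)))\<^sup>2 / 2 - (1/2) * (s i h + s j h)"
      using m_le[OF bounded_linear_const_mult[OF bounded_linear_add[OF s[of i] s[of j]]], of "1/2"]
      unfolding J_def .
    moreover have "A = P + Q - 2 * R \<Longrightarrow> m \<le> R \<Longrightarrow> P < m + a \<Longrightarrow> Q < m + b \<Longrightarrow> A \<le> a + b"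
      for A P Q R a b :: real by linarith
    ultimately show ?thesis
      using midpoint_energy[OF s[of i] s[of j], of h] sJ[of i] sJ[of j]
      unfolding J_def by blast
  qed
  have Cauchy: "\<exists>N. \<forall>i\<ge>N. \<forall>j\<ge>N. L2_norm \<gamma> (\<lambda>x. s i x - s j x) < e" if "e > 0" for e
  proof -
    \<comment> \<open>By \<open>diff\<close>, a quarter of the squared distance is at most two such
      terms, hence below a quarter of the square of \<open>e\<close>.\<close>
    obtain N where N: "1 / (real N + 1) < e\<^sup>2 / 8"
      using reals_Archimedean[of "e\<^sup>2 / 8"] \<open>e > 0\<close> by (auto simp: inverse_eq_divide add.commute)
    have "L2_norm \<gamma> (\<lambda>x. s i x - s j x) < e" if "i \<ge> N" "j \<ge> N" for i j
    proof -
      have "1 / (real i + 1) \<le> 1 / (real N + 1)" "1 / (real j + 1) \<le> 1 / (real N + 1)"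
        using that by (auto intro!: divide_left_mono)
      then have "(L2_norm \<gamma> (\<lambda>x. s i x - s j x))\<^sup>2 < e\<^sup>2"
        using diff[of i j] N by linarith
      then show ?thesis by (rule power2_less_imp_less) (use \<open>e > 0\<close> in simp)
    qed
    then show ?thesis by blast
  qed
  obtain f where f: "f \<in> L2_funs \<gamma>" and lim: "(\<lambda>n. L2_norm \<gamma> (\<lambda>x. f x - s n x)) \<longlonglongrightarrow> 0"
    using L2_complete[OF functional_L2[OF s] Cauchy] by blast
  have "f \<in> dual_closure \<gamma>"
    unfolding dual_closure_def
  proof (intro CollectI conjI allI impI f)
    fix e :: real assume "e > 0"
    then have "eventually (\<lambda>n. L2_norm \<gamma> (\<lambda>x. f x - s n x) < e) sequentially"
      using order_tendstoD(2)[OF lim] by auto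
    then obtain n where "L2_norm \<gamma> (\<lambda>x. f x - s n x) < e"
      using eventually_sequentially by auto
    then show "\<exists>g\<in>L2_funs \<gamma>. bounded_linear g \<and> L2_norm \<gamma> (\<lambda>x. f x - g x) < e"
      using s functional_L2 by blast
  qed
  moreover have "g h = (\<integral>x. f x * g x \<partial>\<gamma>)" if g: "bounded_linear g" for g :: "'a \<Rightarrow> real"
  proof -
    have gL: "g \<in> L2_funs \<gamma>" by (rule functional_L2[OF g])
    have conv: "(\<lambda>n. \<integral>x. s n x * g x \<partial>\<gamma>) \<longlonglongrightarrow> (\<integral>x. f x * g x \<partial>\<gamma>)"
    proof (rule LIM_zero_cancel, rule Lim_null_comparison)
      show "\<forall>\<^sub>F n in sequentially. norm ((\<integral>x. s n x * g x \<partial>\<gamma>) - (\<integral>x. f x * g x \<partial>\<gamma>)) \<le>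
          L2_norm \<gamma> (\<lambda>x. f x - s n x) * L2_norm \<gamma> g"
      proof (rule always_eventually, rule allI)
        fix n
        have "(\<integral>x. s n x * g x \<partial>\<gamma>) - (\<integral>x. f x * g x \<partial>\<gamma>) = (\<integral>x. (s n x - f x) * g x \<partial>\<gamma>)"
          using integrable_mult_L2[OF functional_L2[OF s[of n]] gL] integrable_mult_L2[OF f gL]
          by (simp add: left_diff_distrib)
        then show "norm ((\<integral>x. s n x * g x \<partial>\<gamma>) - (\<integral>x. f x * g x \<partial>\<gamma>)) \<le>
            L2_norm \<gamma> (\<lambda>x. f x - s n x) * L2_norm \<gamma> g"
          using L2_Cauchy_Schwarz[OF L2_funs_diff[OF functional_L2[OF s[of n]] f] gL]
            L2_norm_minus_commute[of \<gamma> f "s n"] by simp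
      qed
      show "(\<lambda>n. L2_norm \<gamma> (\<lambda>x. f x - s n x) * L2_norm \<gamma> g) \<longlonglongrightarrow> 0"
        using tendsto_mult_left_zero[OF lim] .
    qed
    define a where "a = (\<integral>x. f x * g x \<partial>\<gamma>) - g h"
    define b where "b = (L2_norm \<gamma> g)\<^sup>2"
    \<comment> \<open>First variation: moving the almost minimal \<open>s n\<close> by
      \<open>t * g\<close> cannot lower the energy by more than \<open>1 / (real n + 1)\<close>, and
      this loss vanishes in the limit.\<close>
    have ineq: "0 \<le> t * a + t\<^sup>2 * b / 2" for t
    proof (rule LIMSEQ_le_const)
      show "(\<lambda>n. t * ((\<integral>x. s n x * g x \<partial>\<gamma>) - g h) + t\<^sup>2 * b / 2 + 1 / (real n + 1)) \<longlonglongrightarrow> t * a + t\<^sup>2 * b / 2"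
      proof -
        have "(\<lambda>n. 1 / (real n + 1)) \<longlonglongrightarrow> 0"
          using LIMSEQ_inverse_real_of_nat by (simp add: inverse_eq_divide add.commute)
        then have "(\<lambda>n. t * ((\<integral>x. s n x * g x \<partial>\<gamma>) - g h) + t\<^sup>2 * b / 2 + 1 / (real n + 1)) \<longlonglongrightarrow>
            t * a + t\<^sup>2 * b / 2 + 0"
          unfolding a_def by (intro tendsto_add tendsto_mult tendsto_diff tendsto_const conv)
        then show ?thesis by simp
      qed
      have "0 \<le> t * ((\<integral>x. s n x * g x \<partial>\<gamma>) - g h) + t\<^sup>2 * b / 2 + 1 / (real n + 1)" for n
      proof -
        have "m \<le> J (\<lambda>x. s n x + t * g x)"
          by (rule m_le) (intro bounded_linear_add s bounded_linear_const_mult g)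
        moreover have "J (\<lambda>x. s n x + t * g x) = J (s n) + t * ((\<integral>x. s n x * g x \<partial>\<gamma>) - g h) + t\<^sup>2 * b / 2"
          unfolding J_def b_def L2_norm_square integral_add_square[OF functional_L2[OF s[of n]] gL]
          by (simp add: field_simps)
        ultimately show ?thesis using sJ[of n] by linarith
      qed
      then show "\<exists>N. \<forall>n\<ge>N. 0 \<le> t * ((\<integral>x. s n x * g x \<partial>\<gamma>) - g h) + t\<^sup>2 * b / 2 + 1 / (real n + 1)" by blast
    qed
    have "a = 0"
    proof (rule ccontr)
      assume "a \<noteq> 0"
      have "b \<ge> 0" unfolding b_def by simp
      \<comment> \<open>The minimising step would be \<open>- a / b\<close>; the denominator
        \<open>b + 1\<close> also covers \<open>b = 0\<close>.\<close>
      have "0 \<le> (- a / (b + 1)) * a + (- a / (b + 1))\<^sup>2 * b / 2" by (rule ineq)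
      also have "\<dots> = a\<^sup>2 * (- (1 / (b + 1)) + (b / (b + 1)) / (b + 1) / 2)"
        by (simp add: power2_eq_square algebra_simps)
      finally have "0 \<le> - (1 / (b + 1)) + (b / (b + 1)) / (b + 1) / 2"
        using \<open>a \<noteq> 0\<close> by (simp add: zero_le_mult_iff)
      moreover have "(b / (b + 1)) / (b + 1) / 2 \<le> 1 / (b + 1) / 2"
        using \<open>b \<ge> 0\<close> by (intro divide_right_mono) auto
      moreover have "1 / (b + 1) > 0" using \<open>b \<ge> 0\<close> by simp
      moreover have "0 \<le> - k + w \<Longrightarrow> w \<le> k / 2 \<Longrightarrow> k > 0 \<Longrightarrow> False" for k w :: real by linarith
      ultimately show False by blast
    qed
    then show ?thesis unfolding a_def by simp
  qed
  ultimately show ?thesis by (rule that)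
qed

section \<open>The covariance operator and membership in the Cameron--Martin space\<close>

lemma R_op_eqI:
  assumes "\<And>g :: 'a \<Rightarrow> real. bounded_linear g \<Longrightarrow> g h = (\<integral>x. f x * g x \<partial>\<gamma>)"
  shows "R_op \<gamma> f = h"
  unfolding R_op_def
proof (rule the_equality)
  fix k assume k: "\<forall>g :: 'a \<Rightarrow> real. bounded_linear g \<longrightarrow> g k = (\<integral>x. f x * g x \<partial>\<gamma>)"
  show "k = h"
  proof (rule functionals_separate)
    fix g :: "'a \<Rightarrow> real" assume g: "bounded_linear g"
    show "g k = g h" unfolding assms[OF g] using k g by blast
  qed
qed (use assms in blast)

text \<open>Used for limits of Cameron--Martin points and, by contraposition, to find for a point
  outside the space a functional violating the bound for any given \<open>C\<close>.\<close>

lemma CM_spaceI: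
  assumes "\<And>g :: 'a \<Rightarrow> real. bounded_linear g \<Longrightarrow> \<bar>g h\<bar> \<le> C * L2_norm \<gamma> g"
  shows "h \<in> CM_space \<gamma>"
proof -
  obtain f where f: "f \<in> dual_closure \<gamma>" "\<And>g. bounded_linear g \<Longrightarrow> g h = (\<integral>x. f x * g x \<partial>\<gamma>)"
    by (rule L2_representation[of h C]) (erule assms, rule that)
  have "R_op \<gamma> f = h" by (rule R_op_eqI) (rule f(2))
  then show ?thesis using f(1) unfolding CM_space_def by blast
qed

text \<open>Replacing \<open>x\<close> by one of finitely many nearby points \<open>c i\<close> approximates the covariance
  operator by operators of finite rank, uniformly in both arguments.\<close>

lemma finite_rank_approximation:
  assumes "\<delta> > 0"
  obtains N :: nat and c :: "nat \<Rightarrow> 'a" and A where "\<And>i. A i \<in> sets borel"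
    and "\<And>f g. f \<in> L2_funs \<gamma> \<Longrightarrow> bounded_linear g \<Longrightarrow>
      \<bar>(\<integral>x. f x * g x \<partial>\<gamma>) - (\<Sum>i<N. g (c i) * (\<integral>x. f x * indicator (A i) x \<partial>\<gamma>))\<bar>
        \<le> \<delta> * L2_norm \<gamma> f * onorm g"
proof -
  obtain b where b: "b > 0" "\<And>g :: 'a \<Rightarrow> real. bounded_linear g \<Longrightarrow> L2_norm \<gamma> g \<le> b * onorm g"
    by (rule functional_L2_norm_le) (rule that)
  obtain D :: "'a set" where D: "countable D" "\<And>X. open X \<Longrightarrow> X \<noteq> {} \<Longrightarrow> \<exists>d\<in>D. d \<in> X"
    using countable_dense_setE by blast
  have "D \<noteq> {}" using D(2)[OF open_UNIV] by auto
  define c where "c = from_nat_into D"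
  define B where "B i = ball (c i) (\<delta> / 2)" for i
  define A where "A = disjointed B"
  have B_sets: "range B \<subseteq> sets \<gamma>" unfolding B_def by auto
  have A_sets[measurable]: "A i \<in> sets borel" for i
    using sets.range_disjointed_sets[OF B_sets] unfolding A_def by auto
  have B_cover: "(\<Union>i. B i) = UNIV"
  proof -
    have "x \<in> (\<Union>i. B i)" for x
    proof -
      obtain d where "d \<in> D" "d \<in> ball x (\<delta> / 2)"
        using D(2)[of "ball x (\<delta> / 2)"] assms by auto
      then obtain n where "c n = d"
        using D(1) \<open>D \<noteq> {}\<close> unfolding c_def by (metis from_nat_into_surj)
      then show ?thesis using \<open>d \<in> ball x (\<delta> / 2)\<close> by (auto simp: B_def dist_commute)
    qed
    then show ?thesis by auto
  qed
  define U where "U n = (\<Union>i<n. B i)" for n :: nat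
  have U_sets[measurable]: "U n \<in> sets borel" for n
    unfolding U_def B_def by measurable
  \<comment> \<open>Chosen so that the tail contributes a quarter of the square of
    \<open>\<delta> * onorm g\<close>. The oscillation of \<open>g\<close> on balls of radius
    \<open>\<delta> / 2\<close> contributes another quarter.\<close>
  define \<eta> where "\<eta> = (\<delta>\<^sup>2 / (8 * b\<^sup>2))\<^sup>2"
  have "\<eta> > 0" using assms b(1) by (simp add: \<eta>_def)
  have "(\<lambda>n. measure \<gamma> (U n)) \<longlonglongrightarrow> measure \<gamma> (\<Union>n. U n)"
  proof (rule finite_Lim_measure_incseq)
    show "range U \<subseteq> sets \<gamma>" using U_sets by auto
    show "incseq U" unfolding incseq_def U_def by force
  qed
  moreover have "(\<Union>n. U n) = UNIV"
    using B_cover by (fastforce simp: U_def)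
  ultimately have "(\<lambda>n. measure \<gamma> (U n)) \<longlonglongrightarrow> 1"
    using prob_space by simp
  then have "eventually (\<lambda>n. measure \<gamma> (U n) > 1 - \<eta>) sequentially"
    by (rule order_tendstoD) (use \<open>\<eta> > 0\<close> in simp)
  then obtain N where "measure \<gamma> (U N) > 1 - \<eta>"
    using eventually_sequentially by auto
  then have N: "measure \<gamma> (- U N) < \<eta>"
    using prob_compl[of "U N"] by (simp add: Compl_eq_Diff_UNIV)
  have U_A: "U N = (\<Union>i<N. A i)"
    using finite_UN_disjointed_eq[of B N] unfolding U_def A_def by (simp add: lessThan_atLeast0)
  have A_disj: "i = j" if "x \<in> A i" "x \<in> A j" for x i j
    using disjoint_family_disjointed[of B] that unfolding A_def disjoint_family_on_def by blast
  have "\<bar>(\<integral>x. f x * g x \<partial>\<gamma>) - (\<Sum>i<N. g (c i) * (\<integral>x. f x * indicator (A i) x \<partial>\<gamma>))\<bar>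
        \<le> \<delta> * L2_norm \<gamma> f * onorm g" if f: "f \<in> L2_funs \<gamma>" and g: "bounded_linear g" for f g
  proof -
    note [measurable] = functional_borel[OF g]
    have gL: "g \<in> L2_funs \<gamma>" by (rule functional_L2[OF g])
    have AL: "indicator (A i) \<in> L2_funs \<gamma>" for i
      by (rule L2_funs_bounded[of _ 1]) (auto simp: indicator_def)
    have op: "0 \<le> onorm g" by (rule onorm_pos_le[OF g])
    \<comment> \<open>Since the sets \<open>A i\<close> are disjoint, \<open>v\<close> takes the
      value \<open>g (c i)\<close> on \<open>A i\<close> for \<open>i < N\<close> and vanishes off
      \<open>U N\<close>, where the error is \<open>g\<close> itself.\<close>
    define v where "v x = (\<Sum>i<N. g (c i) * indicator (A i) x)" for x
    have v_in: "\<bar>g x - v x\<bar> \<le> onorm g * (\<delta> / 2)" if "x \<in> U N" for x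
    proof -
      obtain i where i: "i < N" "x \<in> A i" using \<open>x \<in> U N\<close> unfolding U_A by blast
      have "v x = (\<Sum>k<N. if k = i then g (c i) else 0)"
        unfolding v_def using A_disj i(2) by (intro sum.cong) (auto simp: indicator_def)
      then have "v x = g (c i)" using i(1) by simp
      then have "\<bar>g x - v x\<bar> = norm (g (x - c i))"
        using bounded_linear.linear[OF g] by (simp add: linear_diff)
      also have "\<dots> \<le> onorm g * norm (x - c i)" by (rule onorm[OF g])
      also have "\<dots> \<le> onorm g * (\<delta> / 2)"
      proof (intro mult_left_mono op)
        have "x \<in> B i" using i(2) disjointed_subset[of B i] unfolding A_def by auto
        then show "norm (x - c i) \<le> \<delta> / 2" by (simp add: B_def dist_norm norm_minus_commute)
      qed
      finally show ?thesis .
    qed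
    have v_out: "v x = 0" if "x \<notin> U N" for x
      unfolding v_def using that U_A by (intro sum.neutral) auto
    have vL: "v \<in> L2_funs \<gamma>"
    proof (rule L2_funs_bounded)
      show "v \<in> borel_measurable \<gamma>" unfolding v_def by measurable
      show "\<bar>v x\<bar> \<le> (\<Sum>i<N. \<bar>g (c i)\<bar>)" for x
        unfolding v_def by (rule order_trans[OF sum_abs]) (auto intro!: sum_mono simp: indicator_def)
    qed
    define u where "u x = g x - v x" for x
    have uL: "u \<in> L2_funs \<gamma>" unfolding u_def by (rule L2_funs_diff[OF gL vL])
    have "(L2_norm \<gamma> u)\<^sup>2 = (\<integral>x. (u x)\<^sup>2 \<partial>\<gamma>)" by (rule L2_norm_square)
    also have "\<dots> \<le> (\<integral>x. (onorm g * (\<delta> / 2))\<^sup>2 + (g x)\<^sup>2 * indicator (- U N) x \<partial>\<gamma>)"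
    proof (rule integral_mono)
      show "integrable \<gamma> (\<lambda>x. (u x)\<^sup>2)" by (rule L2_funsD(2)[OF uL])
      show "integrable \<gamma> (\<lambda>x. (onorm g * (\<delta> / 2))\<^sup>2 + (g x)\<^sup>2 * indicator (- U N) x)"
        using L2_funsD(2)[OF gL]
        by (intro Bochner_Integration.integrable_add integrable_const integrable_real_mult_indicator) auto
      show "(u x)\<^sup>2 \<le> (onorm g * (\<delta> / 2))\<^sup>2 + (g x)\<^sup>2 * indicator (- U N) x" for x
      proof (cases "x \<in> U N")
        case True
        then have "\<bar>u x\<bar>\<^sup>2 \<le> (onorm g * (\<delta> / 2))\<^sup>2"
          unfolding u_def by (intro power_mono v_in) auto
        then show ?thesis using True by simp
      next
        case False
        then show ?thesis by (simp add: u_def v_out)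
      qed
    qed
    also have "\<dots> = (onorm g * (\<delta> / 2))\<^sup>2 + (\<integral>x. (g x)\<^sup>2 * indicator (- U N) x \<partial>\<gamma>)"
      using L2_funsD(2)[OF gL] prob_space
      by (subst Bochner_Integration.integral_add) (auto intro!: integrable_real_mult_indicator)
    also have "\<dots> \<le> (onorm g * (\<delta> / 2))\<^sup>2 + 2 * (L2_norm \<gamma> g)\<^sup>2 * sqrt (measure \<gamma> (- U N))"
      using functional_tail[OF g, of "- U N"] by simp
    also have "\<dots> \<le> (onorm g * (\<delta> / 2))\<^sup>2 + 2 * (b * onorm g)\<^sup>2 * (\<delta>\<^sup>2 / (8 * b\<^sup>2))"
    proof (intro add_left_mono mult_mono)
      show "(L2_norm \<gamma> g)\<^sup>2 \<le> (b * onorm g)\<^sup>2"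
        by (intro power_mono b(2) g L2_norm_nonneg)
      show "sqrt (measure \<gamma> (- U N)) \<le> \<delta>\<^sup>2 / (8 * b\<^sup>2)"
        using N unfolding \<eta>_def by (intro real_le_lsqrt) auto
    qed auto
    also have "\<dots> = (onorm g)\<^sup>2 * \<delta>\<^sup>2 / 2"
      using b(1) by (simp add: power_mult_distrib field_simps)
    also have "\<dots> \<le> (\<delta> * onorm g)\<^sup>2"
      by (simp add: power_mult_distrib)
    finally have un: "L2_norm \<gamma> u \<le> \<delta> * onorm g"
      by (rule power2_le_imp_le) (use assms op in simp)
    have "(\<integral>x. f x * v x \<partial>\<gamma>) = (\<integral>x. (\<Sum>i<N. g (c i) * (f x * indicator (A i) x)) \<partial>\<gamma>)"
      unfolding v_def sum_distrib_left by (simp only: mult.left_commute)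
    also have "\<dots> = (\<Sum>i<N. g (c i) * (\<integral>x. f x * indicator (A i) x \<partial>\<gamma>))"
      using integrable_mult_L2[OF f AL] by (subst Bochner_Integration.integral_sum) auto
    finally have "(\<integral>x. f x * g x \<partial>\<gamma>) - (\<Sum>i<N. g (c i) * (\<integral>x. f x * indicator (A i) x \<partial>\<gamma>)) =
        (\<integral>x. f x * u x \<partial>\<gamma>)"
      unfolding u_def using integrable_mult_L2[OF f gL] integrable_mult_L2[OF f vL]
      by (simp add: right_diff_distrib)
    then have "\<bar>(\<integral>x. f x * g x \<partial>\<gamma>) - (\<Sum>i<N. g (c i) * (\<integral>x. f x * indicator (A i) x \<partial>\<gamma>))\<bar>
        \<le> L2_norm \<gamma> f * L2_norm \<gamma> u"
      using L2_Cauchy_Schwarz[OF f uL] by simp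
    also have "\<dots> \<le> L2_norm \<gamma> f * (\<delta> * onorm g)"
      by (intro mult_left_mono un L2_norm_nonneg)
    finally show ?thesis by (simp add: mult.commute mult.left_commute)
  qed
  with A_sets show ?thesis by (rule that)
qed

text \<open>Linearity moves \<open>g\<close> outside the sum, so the approximant is the value of
  \<open>g\<close> at a vector of \<open>X\<close> in the span of finitely many \<open>c i\<close>.
  The coefficients are bounded by the norm of \<open>f\<close>, which yields compactness
  later.\<close>

lemma finite_rank_points:
  assumes "\<delta> > 0"
  obtains N :: nat and c :: "nat \<Rightarrow> 'a" and a where
    "\<And>f i. f \<in> L2_funs \<gamma> \<Longrightarrow> \<bar>a f i\<bar> \<le> L2_norm \<gamma> f"
    "\<And>f g. f \<in> L2_funs \<gamma> \<Longrightarrow> bounded_linear g \<Longrightarrow>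
      \<bar>(\<integral>x. f x * g x \<partial>\<gamma>) - g (\<Sum>i<N. a f i *\<^sub>R c i)\<bar> \<le> \<delta> * L2_norm \<gamma> f * onorm g"
proof -
  obtain N :: nat and c :: "nat \<Rightarrow> 'a" and A where A[measurable]: "\<And>i. A i \<in> sets borel"
    and approx: "\<And>f g. f \<in> L2_funs \<gamma> \<Longrightarrow> bounded_linear g \<Longrightarrow>
      \<bar>(\<integral>x. f x * g x \<partial>\<gamma>) - (\<Sum>i<N. g (c i) * (\<integral>x. f x * indicator (A i) x \<partial>\<gamma>))\<bar>
        \<le> \<delta> * L2_norm \<gamma> f * onorm g"
    by (rule finite_rank_approximation[OF assms]) (rule that)
  define a where "a f i = (\<integral>x. f x * indicator (A i) x \<partial>\<gamma>)" for f :: "'a \<Rightarrow> real" and i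
  show ?thesis
  proof
    fix f :: "'a \<Rightarrow> real" and i :: nat assume f: "f \<in> L2_funs \<gamma>"
    have "indicator (A i) \<in> L2_funs \<gamma>"
      by (rule L2_funs_bounded[of _ 1]) (auto simp: indicator_def)
    then have "\<bar>a f i\<bar> \<le> L2_norm \<gamma> f * L2_norm \<gamma> (indicator (A i))"
      unfolding a_def by (rule L2_Cauchy_Schwarz[OF f])
    also have "\<dots> \<le> L2_norm \<gamma> f * 1"
      by (intro mult_left_mono L2_norm_indicator_le L2_norm_nonneg) simp
    finally show "\<bar>a f i\<bar> \<le> L2_norm \<gamma> f" by simp
  next
    fix f g :: "'a \<Rightarrow> real" assume f: "f \<in> L2_funs \<gamma>" and g: "bounded_linear g"
    have "g (\<Sum>i<N. a f i *\<^sub>R c i) = (\<Sum>i<N. g (c i) * a f i)"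
      using bounded_linear.linear[OF g] by (simp add: linear_sum linear_scale mult.commute)
    then show "\<bar>(\<integral>x. f x * g x \<partial>\<gamma>) - g (\<Sum>i<N. a f i *\<^sub>R c i)\<bar> \<le> \<delta> * L2_norm \<gamma> f * onorm g"
      using approx[OF f g] by (simp add: a_def)
  qed
qed

text \<open>Approximating points with error \<open>1 / (real n + 1)\<close> form a Cauchy sequence,
  as is seen by testing differences against functionals of norm at most one. Completeness of
  \<open>X\<close> gives the limit, which ensures that the definite description in
  \<open>R_op\<close> denotes something.\<close>

lemma R_op_exists:
  assumes f: "f \<in> L2_funs \<gamma>"
  obtains h where "\<And>g. bounded_linear g \<Longrightarrow> g h = (\<integral>x. f x * g x \<partial>\<gamma>)"
proof -
  let ?F = "L2_norm \<gamma> f"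
  have "\<exists>p. \<forall>g. bounded_linear g \<longrightarrow> \<bar>(\<integral>x. f x * g x \<partial>\<gamma>) - g p\<bar> \<le> (1 / (real n + 1)) * ?F * onorm g" for n
    by (rule finite_rank_points[of "1 / (real n + 1)"]) (simp, use f in blast)
  then obtain p :: "nat \<Rightarrow> 'a" where p: "\<And>n g. bounded_linear g \<Longrightarrow>
      \<bar>(\<integral>x. f x * g x \<partial>\<gamma>) - g (p n)\<bar> \<le> (1 / (real n + 1)) * ?F * onorm g" by metis
  have F: "0 \<le> ?F" by (rule L2_norm_nonneg)
  have dist: "norm (p i - p j) \<le> (1 / (real i + 1) + 1 / (real j + 1)) * ?F" for i j
  proof (rule norm_le_functionals)
    fix g :: "'a \<Rightarrow> real" assume g: "bounded_linear g" "onorm g \<le> 1"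
    have "\<bar>g (p i - p j)\<bar> = \<bar>g (p i) - g (p j)\<bar>"
      using bounded_linear.linear[OF g(1)] by (simp add: linear_diff)
    also have "\<dots> \<le> (1 / (real i + 1)) * ?F * onorm g + (1 / (real j + 1)) * ?F * onorm g"
      using p[OF g(1), of i] p[OF g(1), of j] by linarith
    also have "\<dots> \<le> (1 / (real i + 1)) * ?F * 1 + (1 / (real j + 1)) * ?F * 1"
      using g(2) F by (intro add_mono mult_left_mono) auto
    finally show "\<bar>g (p i - p j)\<bar> \<le> (1 / (real i + 1) + 1 / (real j + 1)) * ?F"
      by (simp add: algebra_simps)
  qed
  have inv_lim: "(\<lambda>n. 1 / (real n + 1)) \<longlonglongrightarrow> 0"
    using LIMSEQ_inverse_real_of_nat by (simp add: inverse_eq_divide add.commute)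
  have "Cauchy p"
  proof (rule metric_CauchyI)
    fix e :: real assume "e > 0"
    have "(\<lambda>n. (1 / (real n + 1)) * ?F) \<longlonglongrightarrow> 0"
      using tendsto_mult_left_zero[OF inv_lim] .
    then have "eventually (\<lambda>n. (1 / (real n + 1)) * ?F < e / 2) sequentially"
      by (rule order_tendstoD) (use \<open>e > 0\<close> in simp)
    then obtain N where N: "\<And>n. n \<ge> N \<Longrightarrow> (1 / (real n + 1)) * ?F < e / 2"
      using eventually_sequentially by auto
    show "\<exists>M. \<forall>m\<ge>M. \<forall>n\<ge>M. dist (p m) (p n) < e"
    proof (intro exI[of _ N] allI impI)
      fix m n assume "m \<ge> N" "n \<ge> N"
      then show "dist (p m) (p n) < e"
        using dist[of m n] N[of m] N[of n] unfolding dist_norm distrib_right by linarith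
    qed
  qed
  then obtain h where h: "p \<longlonglongrightarrow> h"
    using Cauchy_convergent_iff convergent_def by blast
  have "g h = (\<integral>x. f x * g x \<partial>\<gamma>)" if g: "bounded_linear g" for g :: "'a \<Rightarrow> real"
  proof (rule LIMSEQ_unique)
    show "(\<lambda>n. g (p n)) \<longlonglongrightarrow> g h"
      using bounded_linear.tendsto[OF g h] .
    show "(\<lambda>n. g (p n)) \<longlonglongrightarrow> (\<integral>x. f x * g x \<partial>\<gamma>)"
    proof (rule LIM_zero_cancel, rule Lim_null_comparison)
      show "\<forall>\<^sub>F n in sequentially. norm (g (p n) - (\<integral>x. f x * g x \<partial>\<gamma>)) \<le> (1 / (real n + 1)) * (?F * onorm g)"
        using p[OF g] by (intro always_eventually) (simp add: abs_minus_commute mult.assoc)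
      show "(\<lambda>n. (1 / (real n + 1)) * (?F * onorm g)) \<longlonglongrightarrow> 0"
        using tendsto_mult_left_zero[OF inv_lim] .
    qed
  qed
  then show ?thesis by (rule that)
qed

text \<open>The equation \<open>R_op \<gamma> f = h\<close> by itself carries no information unless
  the description is satisfied. Existence and uniqueness of the represented point turn it into the
  integral formula, with the same representative that defines \<open>CM_norm\<close>.\<close>

lemma CM_space_representative:
  assumes "h \<in> CM_space \<gamma>"
  obtains f where "f \<in> L2_funs \<gamma>" "L2_norm \<gamma> f = CM_norm \<gamma> h"
    "\<And>g. bounded_linear g \<Longrightarrow> g h = (\<integral>x. f x * g x \<partial>\<gamma>)"
proof -
  let ?f = "inv_into (dual_closure \<gamma>) (R_op \<gamma>) h"
  have f: "?f \<in> dual_closure \<gamma>" "R_op \<gamma> ?f = h"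
    using assms by (auto simp: CM_space_def inv_into_into f_inv_into_f)
  then have L2: "?f \<in> L2_funs \<gamma>" by (simp add: dual_closure_def)
  obtain k where k: "\<And>g. bounded_linear g \<Longrightarrow> g k = (\<integral>x. ?f x * g x \<partial>\<gamma>)"
    by (rule R_op_exists[OF L2]) (rule that)
  have "R_op \<gamma> ?f = k" by (rule R_op_eqI) (rule k)
  then have kh: "k = h" using f(2) by simp
  show ?thesis
  proof
    show "?f \<in> L2_funs \<gamma>" by fact
    show "L2_norm \<gamma> ?f = CM_norm \<gamma> h" by (simp add: CM_norm_def)
    show "g h = (\<integral>x. ?f x * g x \<partial>\<gamma>)" if "bounded_linear g" for g
      using k[OF that] unfolding kh .
  qed
qed

lemma CM_space_bound:
  assumes "h \<in> CM_space \<gamma>" "bounded_linear g"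
  shows "\<bar>g h\<bar> \<le> CM_norm \<gamma> h * L2_norm \<gamma> g"
proof -
  obtain f where f: "f \<in> L2_funs \<gamma>" "L2_norm \<gamma> f = CM_norm \<gamma> h"
    "\<And>g. bounded_linear g \<Longrightarrow> g h = (\<integral>x. f x * g x \<partial>\<gamma>)"
    by (rule CM_space_representative[OF assms(1)]) (rule that)
  show ?thesis
    using L2_Cauchy_Schwarz[OF f(1) functional_L2[OF assms(2)]] f(2) f(3)[OF assms(2)] by simp
qed

end

text \<open>The set is a Minkowski sum of \<open>N\<close> compact segments, built by induction. It
  is empty for negative \<open>C\<close>.\<close>

lemma compact_coefficient_sums:
  fixes c :: "nat \<Rightarrow> 'b::real_normed_vector"
  shows "compact {\<Sum>i<N. a i *\<^sub>R c i |a. \<forall>i. \<bar>a i\<bar> \<le> C}"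
proof (cases "C < 0")
  case True
  then have empty: "{\<Sum>i<N. a i *\<^sub>R c i |a. \<forall>i. \<bar>a i\<bar> \<le> C} = {}" by (auto simp: not_le intro: less_le_trans)
  show ?thesis unfolding empty by (rule compact_empty)
next
  case False
  then show ?thesis
  proof (induction N)
    case 0
    then have "{\<Sum>i<0. a i *\<^sub>R c i |a. \<forall>i. \<bar>a i\<bar> \<le> C} = {0}" by (auto intro!: exI[of _ "\<lambda>_. 0"])
    then show ?case by simp
  next
    case (Suc N)
    let ?S = "\<lambda>N. {\<Sum>i<N. a i *\<^sub>R c i |a. \<forall>i. \<bar>a i\<bar> \<le> C}"
    have "?S (Suc N) = {x + y |x y. x \<in> ?S N \<and> y \<in> (\<lambda>t. t *\<^sub>R c N) ` {- C..C}}"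
    proof (intro set_eqI iffI)
      fix z assume "z \<in> ?S (Suc N)"
      then show "z \<in> {x + y |x y. x \<in> ?S N \<and> y \<in> (\<lambda>t. t *\<^sub>R c N) ` {- C..C}}"
        by (force simp: abs_le_iff)
    next
      fix z assume "z \<in> {x + y |x y. x \<in> ?S N \<and> y \<in> (\<lambda>t. t *\<^sub>R c N) ` {- C..C}}"
      then obtain a t where at: "z = (\<Sum>i<N. a i *\<^sub>R c i) + t *\<^sub>R c N" "\<forall>i. \<bar>a i\<bar> \<le> C" "\<bar>t\<bar> \<le> C"
        by auto
      then have "z = (\<Sum>i<Suc N. (a(N := t)) i *\<^sub>R c i)" "\<forall>i. \<bar>(a(N := t)) i\<bar> \<le> C"
        by auto
      then show "z \<in> ?S (Suc N)" by blast
    qed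
    moreover have "compact ((\<lambda>t. t *\<^sub>R c N) ` {- C..C})"
      by (intro compact_continuous_image continuous_intros) auto
    ultimately show ?case
      using compact_sums[OF Suc.IH[OF Suc.prems]] by simp
  qed
qed

context nondegenerate_gaussian
begin

section \<open>Compactness of Cameron--Martin balls and limit points\<close>

lemma CM_balls_relatively_compact:
  "compact (closure {h \<in> CM_space \<gamma>. CM_norm \<gamma> h \<le> C})"
proof -
  let ?S = "{h \<in> CM_space \<gamma>. CM_norm \<gamma> h \<le> C}"
  have cover: "\<exists>k. finite k \<and> ?S \<subseteq> (\<Union>x\<in>k. ball x e)" if e: "e > 0" for e
  proof -
    \<comment> \<open>The value \<open>\<bar>C\<bar> + 1\<close> bounds the norms in question and is
      positive for every \<open>C\<close>. The remaining \<open>e / 2\<close> is used for the net of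
      the compact set of approximants.\<close>
    define \<delta> where "\<delta> = e / (2 * (\<bar>C\<bar> + 1))"
    have \<delta>: "\<delta> > 0" "\<delta> * (\<bar>C\<bar> + 1) = e / 2" using e by (auto simp: \<delta>_def field_simps)
    obtain N :: nat and c :: "nat \<Rightarrow> 'a" and a where
      a: "\<And>f i. f \<in> L2_funs \<gamma> \<Longrightarrow> \<bar>a f i\<bar> \<le> L2_norm \<gamma> f" and
      approx: "\<And>f g. f \<in> L2_funs \<gamma> \<Longrightarrow> bounded_linear g \<Longrightarrow>
        \<bar>(\<integral>x. f x * g x \<partial>\<gamma>) - g (\<Sum>i<N. a f i *\<^sub>R c i)\<bar> \<le> \<delta> * L2_norm \<gamma> f * onorm g"
      by (rule finite_rank_points[OF \<delta>(1)]) (rule that)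
    let ?F = "{\<Sum>i<N. a i *\<^sub>R c i |a. \<forall>i. \<bar>a i\<bar> \<le> C}"
    obtain k where k: "finite k" "?F \<subseteq> (\<Union>x\<in>k. ball x (e / 2))"
      using compact_coefficient_sums[of c N C] e unfolding compact_eq_totally_bounded
      by (meson half_gt_zero)
    have "?S \<subseteq> (\<Union>x\<in>k. ball x e)"
    proof
      fix h assume h: "h \<in> ?S"
      then have "h \<in> CM_space \<gamma>" by simp
      then obtain f where f: "f \<in> L2_funs \<gamma>" "L2_norm \<gamma> f = CM_norm \<gamma> h"
        "\<And>g. bounded_linear g \<Longrightarrow> g h = (\<integral>x. f x * g x \<partial>\<gamma>)"
        by (rule CM_space_representative) (rule that)
      define p where "p = (\<Sum>i<N. a f i *\<^sub>R c i)"
      have fC: "L2_norm \<gamma> f \<le> C" using f(2) h by simp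
      then have "p \<in> ?F" unfolding p_def using a[OF f(1)] by (blast intro: order_trans)
      then obtain x where x: "x \<in> k" "dist x p < e / 2" using k(2) by auto
      have "norm (h - p) \<le> e / 2"
      proof (rule norm_le_functionals)
        fix g :: "'a \<Rightarrow> real" assume g: "bounded_linear g" "onorm g \<le> 1"
        have "\<bar>g (h - p)\<bar> = \<bar>(\<integral>x. f x * g x \<partial>\<gamma>) - g p\<bar>"
          using bounded_linear.linear[OF g(1)] f(3)[OF g(1)] by (simp add: linear_diff)
        also have "\<dots> \<le> \<delta> * L2_norm \<gamma> f * onorm g"
          unfolding p_def by (rule approx[OF f(1) g(1)])
        also have "\<dots> \<le> \<delta> * (\<bar>C\<bar> + 1) * 1"
          using g(2) fC \<delta>(1) onorm_pos_le[OF g(1)] L2_norm_nonneg[of \<gamma> f]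
          by (intro mult_mono) auto
        finally show "\<bar>g (h - p)\<bar> \<le> e / 2" using \<delta>(2) by simp
      qed
      then have "dist x h < e"
        using x(2) dist_triangle[of x h p] by (simp add: dist_norm norm_minus_commute)
      then show "h \<in> (\<Union>x\<in>k. ball x e)" using x(1) by auto
    qed
    then show ?thesis using k(1) by blast
  qed
  show ?thesis
    unfolding compact_eq_totally_bounded
  proof (intro conjI allI impI)
    show "Topological_Spaces.complete (closure ?S)" by (simp add: complete_eq_closed)
    fix e :: real assume e: "e > 0"
    obtain k where k: "finite k" "?S \<subseteq> (\<Union>x\<in>k. ball x (e / 2))"
      using cover[of "e / 2"] e by auto
    \<comment> \<open>Closed balls of half the radius contain the closure and still lie in the open
      balls of radius \<open>e\<close>.\<close>
    have "closure ?S \<subseteq> (\<Union>x\<in>k. cball x (e / 2))"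
    proof (rule closure_minimal)
      show "?S \<subseteq> (\<Union>x\<in>k. cball x (e / 2))"
        using k(2) ball_subset_cball by (rule order_trans[OF _ UN_mono[OF order.refl]])
      show "closed (\<Union>x\<in>k. cball x (e / 2))"
        using k(1) by (intro closed_UN) auto
    qed
    also have "\<dots> \<subseteq> (\<Union>x\<in>k. ball x e)" using e by auto
    finally show "\<exists>k. finite k \<and> closure ?S \<subseteq> (\<Union>x\<in>k. ball x e)" using k(1) by blast
  qed
qed

text \<open>A finite lower limit bounds the infimum by one \<open>B\<close> for infinitely many
  \<open>n\<close>. For these \<open>n\<close> some point of the ball has energy below
  \<open>B\<close>, so attainment of the infimum is not an issue; where the intersection is empty
  the infimum is infinite and \<open>n\<close> is not selected. As the radii vanish, compactness for
  the chosen points carries over to the centres.\<close>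

theorem limit_point_in_CM_space:
  fixes r :: "nat \<Rightarrow> real" and x :: "nat \<Rightarrow> 'a"
  assumes r: "r \<longlonglongrightarrow> 0"
    and liminf: "liminf (\<lambda>n. INF h \<in> CM_space \<gamma> \<inter> cball (x n) (r n).
                      ereal (1/2 * (CM_norm \<gamma> h)\<^sup>2)) < \<infinity>"
  shows "\<exists>s l. strict_mono s \<and> l \<in> CM_space \<gamma> \<and> (x \<circ> s) \<longlonglongrightarrow> l"
proof -
  let ?I = "\<lambda>n. INF h \<in> CM_space \<gamma> \<inter> cball (x n) (r n). ereal (1/2 * (CM_norm \<gamma> h)\<^sup>2)"
  obtain B :: real where B: "liminf ?I < ereal B"
    using liminf less_PInf_Ex_of_nat by auto
  have "\<not> eventually (\<lambda>n. ereal B \<le> ?I n) sequentially"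
    using Liminf_bounded[of "ereal B" ?I sequentially] B by auto
  then have "frequently (\<lambda>n. ?I n < ereal B) sequentially"
    by (simp add: frequently_def not_less)
  then have "infinite {n. ?I n < ereal B}"
    by (simp add: frequently_sequentially infinite_nat_iff_unbounded_le)
  then obtain s1 :: "nat \<Rightarrow> nat" where s1: "strict_mono s1" "\<And>n. ?I (s1 n) < ereal B"
    using infinite_enumerate by blast
  define C where "C = sqrt (2 * B)"
  have "\<exists>h. h \<in> CM_space \<gamma> \<and> CM_norm \<gamma> h \<le> C \<and> dist (x (s1 n)) h \<le> r (s1 n)" for n
  proof -
    obtain h where h: "h \<in> CM_space \<gamma> \<inter> cball (x (s1 n)) (r (s1 n))" "1/2 * (CM_norm \<gamma> h)\<^sup>2 < B"
      using s1(2)[of n] unfolding INF_less_iff by auto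
    have "CM_norm \<gamma> h \<le> C"
      unfolding C_def using h(2) by (intro real_le_rsqrt) simp
    then show ?thesis using h(1) by auto
  qed
  then obtain h where h: "\<And>n. h n \<in> CM_space \<gamma>" "\<And>n. CM_norm \<gamma> (h n) \<le> C"
    "\<And>n. dist (x (s1 n)) (h n) \<le> r (s1 n)" by metis
  have "h n \<in> closure {h \<in> CM_space \<gamma>. CM_norm \<gamma> h \<le> C}" for n
    using h(1,2) by (intro subsetD[OF closure_subset]) simp
  then obtain l s2 where s2: "strict_mono s2" "(h \<circ> s2) \<longlonglongrightarrow> l"
    using compact_imp_seq_compact[OF CM_balls_relatively_compact[of C]] by (blast elim: seq_compactE)
  \<comment> \<open>For each fixed \<open>g\<close> the bound by
    \<open>C * L2_norm \<gamma> g\<close> passes to the limit, so \<open>l\<close> does not leave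
    the space even though convergence is only in \<open>X\<close>.\<close>
  have "l \<in> CM_space \<gamma>"
  proof (rule CM_spaceI)
    fix g :: "'a \<Rightarrow> real" assume g: "bounded_linear g"
    show "\<bar>g l\<bar> \<le> C * L2_norm \<gamma> g"
    proof (rule LIMSEQ_le_const2)
      show "(\<lambda>n. \<bar>g ((h \<circ> s2) n)\<bar>) \<longlonglongrightarrow> \<bar>g l\<bar>"
        by (intro tendsto_rabs bounded_linear.tendsto[OF g] s2(2))
      have "\<bar>g (h n)\<bar> \<le> C * L2_norm \<gamma> g" for n
        using CM_space_bound[OF h(1) g, of n] mult_right_mono[OF h(2) L2_norm_nonneg[of \<gamma> g]]
        by (rule order_trans)
      then show "\<exists>N. \<forall>n\<ge>N. \<bar>g ((h \<circ> s2) n)\<bar> \<le> C * L2_norm \<gamma> g" by simp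
    qed
  qed
  moreover have s: "strict_mono (s1 \<circ> s2)"
    using s1(1) s2(1) by (rule strict_mono_o)
  moreover have "(x \<circ> (s1 \<circ> s2)) \<longlonglongrightarrow> l"
  proof -
    have "(\<lambda>n. (x \<circ> (s1 \<circ> s2)) n - (h \<circ> s2) n) \<longlonglongrightarrow> 0"
    proof (rule Lim_null_comparison)
      show "\<forall>\<^sub>F n in sequentially. norm ((x \<circ> (s1 \<circ> s2)) n - (h \<circ> s2) n) \<le> (r \<circ> (s1 \<circ> s2)) n"
        using h(3) by (intro always_eventually) (simp add: dist_norm)
      show "(r \<circ> (s1 \<circ> s2)) \<longlonglongrightarrow> 0"
        by (rule LIMSEQ_subseq_LIMSEQ[OF r s])
    qed
    from tendsto_add[OF this s2(2)] show ?thesis by (simp add: comp_def)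
  qed
  ultimately show ?thesis by blast
qed

subsection \<open>Small balls\<close>

lemma functional_linear_combination:
  fixes e :: "nat \<Rightarrow> 'a \<Rightarrow> real"
  assumes "\<And>i. i < m \<Longrightarrow> bounded_linear (e i)"
  shows "bounded_linear (\<lambda>x. \<Sum>i<m. c i * e i x)"
  using assms by (intro bounded_linear_sum bounded_linear_const_mult) auto

lemma orthonormal_inner:
  fixes e :: "nat \<Rightarrow> 'a \<Rightarrow> real"
  assumes e: "\<And>i. i < m \<Longrightarrow> bounded_linear (e i)"
    and orth: "\<And>i j. i < m \<Longrightarrow> j < m \<Longrightarrow> (\<integral>x. e i x * e j x \<partial>\<gamma>) = of_bool (i = j)"
    and "j < m"
  shows "(\<integral>x. (\<Sum>i<m. c i * e i x) * e j x \<partial>\<gamma>) = c j"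
proof -
  have "(\<integral>x. (\<Sum>i<m. c i * e i x) * e j x \<partial>\<gamma>) = (\<integral>x. (\<Sum>i<m. c i * (e i x * e j x)) \<partial>\<gamma>)"
    unfolding sum_distrib_right mult.assoc ..
  also have "\<dots> = (\<Sum>i<m. \<integral>x. c i * (e i x * e j x) \<partial>\<gamma>)"
    using integrable_mult_L2[OF functional_L2[OF e] functional_L2[OF e]] assms(3)
    by (intro Bochner_Integration.integral_sum integrable_mult_right) auto
  also have "\<dots> = (\<Sum>i<m. if i = j then c i else 0)"
    using orth assms(3) by (intro sum.cong) auto
  finally show ?thesis using assms(3) by simp
qed

lemma orthonormal_norm:
  fixes e :: "nat \<Rightarrow> 'a \<Rightarrow> real"
  assumes e: "\<And>i. i < m \<Longrightarrow> bounded_linear (e i)"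
    and orth: "\<And>i j. i < m \<Longrightarrow> j < m \<Longrightarrow> (\<integral>x. e i x * e j x \<partial>\<gamma>) = of_bool (i = j)"
  shows "(L2_norm \<gamma> (\<lambda>x. \<Sum>i<m. c i * e i x))\<^sup>2 = (\<Sum>i<m. (c i)\<^sup>2)"
proof -
  let ?g = "\<lambda>x. \<Sum>i<m. c i * e i x"
  have gL: "?g \<in> L2_funs \<gamma>"
    by (rule functional_L2) (rule functional_linear_combination[OF e])
  have "G * ?g x = (\<Sum>j<m. c j * (G * e j x))" for G x
    unfolding sum_distrib_left by (simp only: mult.left_commute)
  from this[of "?g _"] have "(L2_norm \<gamma> ?g)\<^sup>2 = (\<integral>x. (\<Sum>j<m. c j * (?g x * e j x)) \<partial>\<gamma>)"
    unfolding L2_norm_square by (simp only: power2_eq_square)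
  also have "\<dots> = (\<Sum>j<m. \<integral>x. c j * (?g x * e j x) \<partial>\<gamma>)"
    using integrable_mult_L2[OF gL functional_L2[OF e]]
    by (intro Bochner_Integration.integral_sum integrable_mult_right) auto
  also have "\<dots> = (\<Sum>j<m. c j * c j)"
    using orthonormal_inner[OF e orth] by (intro sum.cong) auto
  finally show ?thesis by (simp add: power2_eq_square)
qed

text \<open>Orthonormalisation in the \<open>L2_norm\<close>. The expansions hold at every point and
  not merely almost everywhere: a remainder of norm zero vanishes identically by nondegeneracy.
  Pointwise validity is needed because \<open>x\<close> may lie in a null set.\<close>

lemma gram_schmidt:
  fixes A :: "('a \<Rightarrow> real) set"
  assumes "finite A" "\<forall>g\<in>A. bounded_linear g"
  shows "\<exists>(m :: nat) e. (\<forall>i<m. bounded_linear (e i)) \<and>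
    (\<forall>i<m. \<forall>j<m. (\<integral>x. e i x * e j x \<partial>\<gamma>) = of_bool (i = j)) \<and>
    (\<forall>g\<in>A. \<exists>c. \<forall>x. g x = (\<Sum>i<m. c i * e i x))"
  using assms
proof (induction A rule: finite_induct)
  case empty
  then show ?case by (intro exI[of _ 0]) auto
next
  case (insert g A)
  then have g: "bounded_linear g" by simp
  have "\<forall>g\<in>A. bounded_linear g" using insert.prems by blast
  from insert.IH[OF this] obtain m :: nat and e where E: "\<forall>i<m. bounded_linear (e i)"
    "\<forall>i<m. \<forall>j<m. (\<integral>x. e i x * e j x \<partial>\<gamma>) = of_bool (i = j)"
    "\<forall>g\<in>A. \<exists>c. \<forall>x. g x = (\<Sum>i<m. c i * e i x)"
    by (elim exE conjE) (rule that)
  have e: "bounded_linear (e i)" if "i < m" for i using E(1) that by blast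
  have orth: "(\<integral>x. e i x * e j x \<partial>\<gamma>) = of_bool (i = j)" if "i < m" "j < m" for i j
    using E(2) that by blast
  have span: "\<exists>c. \<forall>x. g x = (\<Sum>i<m. c i * e i x)" if "g \<in> A" for g
    using E(3) that by blast
  define b where "b i = (\<integral>x. g x * e i x \<partial>\<gamma>)" for i
  define p where "p x = (\<Sum>i<m. b i * e i x)" for x
  define k where "k x = g x - p x" for x
  have p: "bounded_linear p" unfolding p_def by (rule functional_linear_combination[OF e])
  have k: "bounded_linear k" unfolding k_def by (intro bounded_linear_sub g p)
  have k_orth: "(\<integral>x. k x * e j x \<partial>\<gamma>) = 0" if "j < m" for j
  proof -
    note int = integrable_mult_L2[OF functional_L2[OF _] functional_L2[OF e[OF that]]]
    have "(\<integral>x. k x * e j x \<partial>\<gamma>) = b j - (\<integral>x. p x * e j x \<partial>\<gamma>)"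
      unfolding k_def b_def left_diff_distrib
      by (rule Bochner_Integration.integral_diff[OF int[OF g] int[OF p]])
    then show ?thesis
      using orthonormal_inner[OF e orth that, of b] unfolding p_def by simp
  qed
  show ?case
  proof (cases "L2_norm \<gamma> k = 0")
    case True
    then have "\<forall>x. g x = (\<Sum>i<m. b i * e i x)"
      using functional_zero[OF k True] unfolding k_def p_def by simp
    then show ?thesis
      using e orth span by (intro exI[of _ m] exI[of _ e]) auto
  next
    case False
    define \<sigma> where "\<sigma> = L2_norm \<gamma> k"
    have \<sigma>: "\<sigma> > 0" using False L2_norm_nonneg[of \<gamma> k] by (simp add: \<sigma>_def)
    define e' where "e' i = (if i = m then (\<lambda>x. (1 / \<sigma>) * k x) else e i)" for i
    have e'_m: "e' m = (\<lambda>x. (1 / \<sigma>) * k x)" and e'_other: "\<And>i. i \<noteq> m \<Longrightarrow> e' i = e i"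
      by (auto simp: e'_def)
    have e': "bounded_linear (e' i)" if "i < Suc m" for i
      using that e[of i] bounded_linear_const_mult[OF k, of "1 / \<sigma>"] unfolding e'_def
      by (cases "i = m") (simp_all only: if_True if_False less_Suc_eq simp_thms)
    have kk: "(\<integral>x. ((1 / \<sigma>) * k x) * ((1 / \<sigma>) * k x) \<partial>\<gamma>) = 1"
    proof -
      have "(\<integral>x. ((1 / \<sigma>) * k x) * ((1 / \<sigma>) * k x) \<partial>\<gamma>) = (L2_norm \<gamma> (\<lambda>x. (1 / \<sigma>) * k x))\<^sup>2"
        unfolding L2_norm_square by (simp only: power2_eq_square)
      also have "\<dots> = 1" unfolding L2_norm_scale using \<sigma> by (simp add: \<sigma>_def[symmetric])
      finally show ?thesis .
    qed
    have ke: "(\<integral>x. ((1 / \<sigma>) * k x) * e j x \<partial>\<gamma>) = 0" "(\<integral>x. e j x * ((1 / \<sigma>) * k x) \<partial>\<gamma>) = 0"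
      if "j < m" for j
    proof -
      have "(\<integral>x. ((1 / \<sigma>) * k x) * e j x \<partial>\<gamma>) = (1 / \<sigma>) * (\<integral>x. k x * e j x \<partial>\<gamma>)"
        unfolding mult.assoc by (rule integral_mult_right_zero)
      then show "(\<integral>x. ((1 / \<sigma>) * k x) * e j x \<partial>\<gamma>) = 0" using k_orth[OF that] by simp
      then show "(\<integral>x. e j x * ((1 / \<sigma>) * k x) \<partial>\<gamma>) = 0" by (simp only: mult.commute)
    qed
    have orth': "(\<integral>x. e' i x * e' j x \<partial>\<gamma>) = of_bool (i = j)" if "i < Suc m" "j < Suc m" for i j
    proof (cases "i = m"; cases "j = m")
      assume "i = m" "j = m"
      then show ?thesis using kk by (simp only: e'_m of_bool_eq simp_thms)
    next
      assume "i = m" "j \<noteq> m"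
      then show ?thesis using ke(1)[of j] e'_other[of j] that by (simp add: e'_m)
    next
      assume "i \<noteq> m" "j = m"
      then show ?thesis using ke(2)[of i] e'_other[of i] that by (simp add: e'_m)
    next
      assume "i \<noteq> m" "j \<noteq> m"
      then show ?thesis using orth[of i j] that by (simp add: e'_other)
    qed
    have ext: "(\<Sum>i<Suc m. (c(m := t)) i * e' i x) = (\<Sum>i<m. c i * e i x) + t * ((1 / \<sigma>) * k x)" for c t x
    proof -
      have "(\<Sum>i<m. (c(m := t)) i * e' i x) = (\<Sum>i<m. c i * e i x)"
        by (intro sum.cong) (auto simp: e'_def)
      then show ?thesis by (simp add: e'_def)
    qed
    have span': "\<exists>c. \<forall>x. q x = (\<Sum>i<Suc m. c i * e' i x)" if "q \<in> insert g A" for q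
    proof (cases "q = g")
      case True
      have "q x = (\<Sum>i<Suc m. (b(m := \<sigma>)) i * e' i x)" for x
        unfolding ext using \<sigma> True by (simp add: k_def p_def)
      then show ?thesis by blast
    next
      case False
      then obtain c where "\<And>x. q x = (\<Sum>i<m. c i * e i x)"
        using span[of q] \<open>q \<in> insert g A\<close> by auto
      then have "q x = (\<Sum>i<Suc m. (c(m := 0)) i * e' i x)" for x
        unfolding ext by simp
      then show ?thesis by blast
    qed
    show ?thesis
      using e' orth' span' by (intro exI[of _ "Suc m"] exI[of _ e']) blast
  qed
qed

text \<open>In orthonormal coordinates the ball around \<open>x\<close> lies in a shifted slab
  intersection and the dimension-free bound applies. Only the slabs of \<open>F\<close> are kept on
  the right, so that they can later be refined to a ball.\<close>

lemma ball_le_cylinder: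
  fixes f :: "'a \<Rightarrow> real"
  assumes F: "finite F" "\<And>g. g \<in> F \<Longrightarrow> bounded_linear g"
    and f: "bounded_linear f" "L2_norm \<gamma> f \<le> 1"
    and M: "0 \<le> M" "M \<le> f x - onorm f * r" and r: "0 < r"
  shows "measure \<gamma> (cball x r) \<le> exp (- M\<^sup>2 / 2) * measure \<gamma> {y. \<forall>g\<in>F. \<bar>g y\<bar> \<le> onorm g * r}"
proof -
  let ?A = "insert f F"
  have A: "finite ?A" "\<forall>g\<in>?A. bounded_linear g" using F f by auto
  from gram_schmidt[OF A] obtain m :: nat and e where E: "\<forall>i<m. bounded_linear (e i)"
    "\<forall>i<m. \<forall>j<m. (\<integral>x. e i x * e j x \<partial>\<gamma>) = of_bool (i = j)"
    "\<forall>g\<in>?A. \<exists>c. \<forall>x. g x = (\<Sum>i<m. c i * e i x)"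
    by (elim exE conjE) (rule that)
  have e: "bounded_linear (e i)" if "i < m" for i using E(1) that by blast
  have orth: "(\<integral>x. e i x * e j x \<partial>\<gamma>) = of_bool (i = j)" if "i < m" "j < m" for i j
    using E(2) that by blast
  obtain c where c: "\<And>g x. g \<in> ?A \<Longrightarrow> g x = (\<Sum>i<m. c g i * e i x)"
    using bchoice[OF E(3)] by blast
  \<comment> \<open>The left summand carries the slabs of \<open>f\<close> and \<open>F\<close>; the
    right one adds a slab for each coordinate functional, which makes the intersection
    bounded.\<close>
  define L where "L = ?A <+> {..<m}"
  have L: "finite L" unfolding L_def using A(1) by simp
  define a where "a l i = (case l of Inl g \<Rightarrow> c g i | Inr j \<Rightarrow> of_bool (i = j))"
    for l :: "('a \<Rightarrow> real) + nat" and i :: nat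
  define \<rho> where "\<rho> l = (case l of Inl g \<Rightarrow> onorm g * r | Inr j \<Rightarrow> onorm (e j) * r)"
    for l :: "('a \<Rightarrow> real) + nat"
  let ?I = "{..<m}"
  let ?S = "slab ?I L a \<rho>"
  have a_Inr: "(\<Sum>i<m. a (Inr j) i * y i) = y j" if "j < m" for j and y :: "nat \<Rightarrow> real"
  proof -
    have "(\<Sum>i<m. a (Inr j) i * y i) = (\<Sum>i<m. if i = j then y i else 0)"
      by (intro sum.cong) (auto simp: a_def)
    then show ?thesis using that by simp
  qed
  have char: "(\<integral>x. iexp (\<Sum>i\<in>?I. t i * e i x) \<partial>\<gamma>) = complex_of_real (exp (- (\<Sum>i\<in>?I. (t i)\<^sup>2) / 2))"
    for t
  proof -
    have "bounded_linear (\<lambda>x. \<Sum>i<m. t i * e i x)"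
      by (rule functional_linear_combination) (rule e)
    moreover have "(L2_norm \<gamma> (\<lambda>x. \<Sum>i<m. t i * e i x))\<^sup>2 = (\<Sum>i<m. (t i)\<^sup>2)"
      by (intro orthonormal_norm e orth)
    ultimately show ?thesis
      using functional_moments(3) by metis
  qed
  have meas: "emeasure \<gamma> {y. (\<lambda>i. e i y - z i) \<in> ?S} =
      ennreal ((1 / sqrt (2 * pi)) ^ card ?I) * shifted_mass ?I L a \<rho> z" for z
    using orthonormal_gaussian_slab[of ?I e L z a \<rho>, OF _ _ char L] functional_borel[OF e]
    by (simp cong: measurable_cong_sets)
  \<comment> \<open>The sum dominates every coordinate bound at once; the summand \<open>1\<close>
    secures \<open>R \<ge> 1\<close>.\<close>
  define R where "R = 1 + (\<Sum>j<m. onorm (e j) * r)"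
  have pos: "0 \<le> onorm (e j) * r" if "j < m" for j
    using onorm_pos_le[OF e[OF that]] r by simp
  have "R \<ge> 1" unfolding R_def using sum_nonneg[of ?I "\<lambda>j. onorm (e j) * r"] pos by simp
  moreover have "\<bar>y i\<bar> \<le> R" if "y \<in> ?S" "i \<in> ?I" for y i
  proof -
    have "\<bar>\<Sum>k<m. a (Inr i) k * y k\<bar> \<le> \<rho> (Inr i)"
      using that unfolding slab_def L_def by blast
    then have "\<bar>y i\<bar> \<le> onorm (e i) * r"
      using a_Inr that(2) by (simp add: \<rho>_def)
    also have "\<dots> \<le> (\<Sum>j<m. onorm (e j) * r)"
      using that(2) pos by (intro member_le_sum) auto
    finally show ?thesis by (simp add: R_def)
  qed
  \<comment> \<open>Only the slab of \<open>f\<close> matters here: its linear form is at least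
    \<open>f x - onorm f * r\<close> on the shifted set, and its coefficient vector has Euclidean
    norm at most one, so Cauchy--Schwarz bounds the norm of \<open>y\<close> from below.\<close>
  moreover have "M\<^sup>2 \<le> (\<Sum>i\<in>?I. (y i)\<^sup>2)" if "(\<lambda>i. y i - e i x) \<in> ?S" for y
  proof -
    have "\<bar>\<Sum>i<m. a (Inl f) i * (y i - e i x)\<bar> \<le> \<rho> (Inl f)"
      using that unfolding slab_def L_def by blast
    moreover have "(\<Sum>i<m. a (Inl f) i * (y i - e i x)) = (\<Sum>i<m. c f i * y i) - f x"
      using c[of f x] by (simp add: a_def right_diff_distrib sum_subtractf)
    ultimately have "M \<le> (\<Sum>i<m. c f i * y i)"
      using M(2) by (simp add: \<rho>_def)
    then have "M\<^sup>2 \<le> (\<Sum>i<m. c f i * y i)\<^sup>2"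
      using M(1) by (intro power_mono)
    also have "\<dots> \<le> (\<Sum>i<m. (c f i)\<^sup>2) * (\<Sum>i<m. (y i)\<^sup>2)"
      by (rule Cauchy_Schwarz_ineq_sum)
    also have "\<dots> \<le> 1 * (\<Sum>i<m. (y i)\<^sup>2)"
    proof (rule mult_right_mono)
      have "(\<lambda>x. \<Sum>i<m. c f i * e i x) = f" using c[of f] by auto
      moreover have "(L2_norm \<gamma> (\<lambda>x. \<Sum>i<m. c f i * e i x))\<^sup>2 = (\<Sum>i<m. (c f i)\<^sup>2)"
        by (intro orthonormal_norm e orth)
      ultimately have "(\<Sum>i<m. (c f i)\<^sup>2) = (L2_norm \<gamma> f)\<^sup>2" by simp
      also have "\<dots> \<le> 1" using f(2) L2_norm_nonneg[of \<gamma> f] by (simp add: power_le_one)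
      finally show "(\<Sum>i<m. (c f i)\<^sup>2) \<le> 1" .
    qed (simp add: sum_nonneg)
    finally show ?thesis by simp
  qed
  ultimately have "shifted_mass ?I L a \<rho> (\<lambda>i. e i x) \<le>
      ennreal (exp (- M\<^sup>2 / 2)) * shifted_mass ?I L a \<rho> (\<lambda>_. 0)"
    by (intro shifted_mass_le L) auto
  then have "emeasure \<gamma> {y. (\<lambda>i. e i y - e i x) \<in> ?S} \<le>
      ennreal (exp (- M\<^sup>2 / 2)) * emeasure \<gamma> {y. (\<lambda>i. e i y - 0) \<in> ?S}"
    unfolding meas by (simp add: mult_left_mono mult.left_commute)
  then have "ennreal (measure \<gamma> {y. (\<lambda>i. e i y - e i x) \<in> ?S}) \<le>
      ennreal (exp (- M\<^sup>2 / 2) * measure \<gamma> {y. (\<lambda>i. e i y - 0) \<in> ?S})"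
    unfolding emeasure_eq_measure by (simp add: ennreal_mult)
  then have main: "measure \<gamma> {y. (\<lambda>i. e i y - e i x) \<in> ?S} \<le>
      exp (- M\<^sup>2 / 2) * measure \<gamma> {y. (\<lambda>i. e i y - 0) \<in> ?S}"
    by (simp add: ennreal_le_iff)
  have Smeas: "{y. (\<lambda>i. e i y - z i) \<in> ?S} \<in> sets borel" for z
  proof -
    have "(\<lambda>y. indicator ?S (\<lambda>i. e i y - z i) :: ennreal) \<in> borel_measurable borel"
      using functional_borel[OF e] by (intro borel_measurable_indicator_slab L) auto
    then have "{y \<in> space borel. (indicator ?S (\<lambda>i. e i y - z i) :: ennreal) = 1} \<in> sets borel"
      by measurable
    then show ?thesis by (simp add: indicator_eq_1_iff)
  qed
  have "cball x r \<subseteq> {y. (\<lambda>i. e i y - e i x) \<in> ?S}"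
  proof
    fix y assume "y \<in> cball x r"
    then have y: "norm (y - x) \<le> r" by (simp add: dist_norm norm_minus_commute)
    have bound: "\<bar>g y - g x\<bar> \<le> onorm g * r" if g: "bounded_linear g" for g :: "'a \<Rightarrow> real"
    proof -
      have "\<bar>g y - g x\<bar> = norm (g (y - x))"
        using bounded_linear.linear[OF g] by (simp add: linear_diff)
      also have "\<dots> \<le> onorm g * norm (y - x)" by (rule onorm[OF g])
      also have "\<dots> \<le> onorm g * r" by (intro mult_left_mono y onorm_pos_le[OF g])
      finally show ?thesis .
    qed
    have "\<bar>\<Sum>i<m. a l i * (e i y - e i x)\<bar> \<le> \<rho> l" if "l \<in> L" for l
    proof (cases l)
      case (Inl g)
      then have g: "g \<in> ?A" using that by (auto simp: L_def)
      have "(\<Sum>i<m. a l i * (e i y - e i x)) = g y - g x"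
        by (subst (1 2) c[OF g]) (simp add: Inl a_def right_diff_distrib sum_subtractf)
      then show ?thesis using bound[OF bspec[OF A(2) g]] by (simp add: Inl \<rho>_def)
    next
      case (Inr j)
      then have "j < m" using that by (auto simp: L_def)
      then show ?thesis using a_Inr[of j "\<lambda>i. e i y - e i x"] bound[OF e] by (simp add: Inr \<rho>_def)
    qed
    then show "y \<in> {y. (\<lambda>i. e i y - e i x) \<in> ?S}" by (simp add: slab_def)
  qed
  then have "measure \<gamma> (cball x r) \<le> measure \<gamma> {y. (\<lambda>i. e i y - e i x) \<in> ?S}"
    by (rule finite_measure_mono) (use Smeas in simp)
  also note main
  \<comment> \<open>Around the origin the slabs of \<open>f\<close> and of the coordinates are
    dropped, which only enlarges the set.\<close>
  also have "exp (- M\<^sup>2 / 2) * measure \<gamma> {y. (\<lambda>i. e i y - 0) \<in> ?S} \<le>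
      exp (- M\<^sup>2 / 2) * measure \<gamma> {y. \<forall>g\<in>F. \<bar>g y\<bar> \<le> onorm g * r}"
  proof (intro mult_left_mono finite_measure_mono)
    show "{y. (\<lambda>i. e i y - 0) \<in> ?S} \<subseteq> {y. \<forall>g\<in>F. \<bar>g y\<bar> \<le> onorm g * r}"
    proof clarify
      fix y g assume y: "(\<lambda>i. e i y - 0) \<in> ?S" and g: "g \<in> F"
      have "\<bar>\<Sum>i<m. a (Inl g) i * (e i y - 0)\<bar> \<le> \<rho> (Inl g)"
        using y g unfolding slab_def L_def by blast
      then show "\<bar>g y\<bar> \<le> onorm g * r"
        using c[of g y] g by (simp add: a_def \<rho>_def)
    qed
    have "{y. \<forall>g\<in>F. \<bar>g y\<bar> \<le> onorm g * r} = (\<Inter>g\<in>F. {y. \<bar>g y\<bar> \<le> onorm g * r})" by auto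
    moreover have "closed {y. \<bar>g y\<bar> \<le> onorm g * r}" if "g \<in> F" for g
      using linear_continuous_on[OF F(2)[OF that], of UNIV]
      by (intro closed_Collect_le continuous_on_rabs continuous_on_const) auto
    ultimately have "closed {y. \<forall>g\<in>F. \<bar>g y\<bar> \<le> onorm g * r}" by auto
    then show "{y. \<forall>g\<in>F. \<bar>g y\<bar> \<le> onorm g * r} \<in> sets \<gamma>" by simp
  qed simp
  finally show ?thesis .
qed

text \<open>The constant is the same for every finite set of functionals, so the bound passes to the
  decreasing limit of the cylinders. A countable norming family makes that limit a subset of the
  ball around the origin.\<close>

lemma ball_decay:
  fixes f :: "'a \<Rightarrow> real"
  assumes f: "bounded_linear f" "L2_norm \<gamma> f \<le> 1"
    and M: "0 \<le> M" "M \<le> f x - onorm f * r" and r: "0 < r"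
  shows "measure \<gamma> (cball x r) \<le> exp (- M\<^sup>2 / 2) * measure \<gamma> (cball 0 r)"
proof -
  obtain g :: "nat \<Rightarrow> 'a \<Rightarrow> real" where g: "\<And>n. bounded_linear (g n)" "\<And>n. onorm (g n) \<le> 1"
    and norming: "\<And>y r. \<forall>n. \<bar>g n y\<bar> \<le> r \<Longrightarrow> norm y \<le> r"
    by (rule countable_norming_functionals) (rule that)
  define S where "S n = {y. \<forall>h\<in>g ` {..n}. \<bar>h y\<bar> \<le> onorm h * r}" for n
  have S_sets: "S n \<in> sets \<gamma>" for n
  proof -
    have "S n = (\<Inter>k\<in>{..n}. {y. \<bar>g k y\<bar> \<le> onorm (g k) * r})" unfolding S_def by auto
    moreover have "closed {y. \<bar>g k y\<bar> \<le> onorm (g k) * r}" for k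
      using linear_continuous_on[OF g(1), of UNIV]
      by (intro closed_Collect_le continuous_on_rabs continuous_on_const) auto
    ultimately have "closed (S n)" by auto
    then show ?thesis by simp
  qed
  have "(\<lambda>n. measure \<gamma> (S n)) \<longlonglongrightarrow> measure \<gamma> (\<Inter>n. S n)"
  proof (rule finite_Lim_measure_decseq)
    show "range S \<subseteq> sets \<gamma>" using S_sets by auto
    show "decseq S" unfolding decseq_def S_def by force
  qed
  then have "(\<lambda>n. exp (- M\<^sup>2 / 2) * measure \<gamma> (S n)) \<longlonglongrightarrow> exp (- M\<^sup>2 / 2) * measure \<gamma> (\<Inter>n. S n)"
    by (intro tendsto_mult tendsto_const)
  moreover have le: "measure \<gamma> (cball x r) \<le> exp (- M\<^sup>2 / 2) * measure \<gamma> (S n)" for n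
    unfolding S_def by (rule ball_le_cylinder[OF _ _ f M r]) (use g(1) in auto)
  ultimately have "measure \<gamma> (cball x r) \<le> exp (- M\<^sup>2 / 2) * measure \<gamma> (\<Inter>n. S n)"
    by (intro LIMSEQ_le_const[of "\<lambda>n. exp (- M\<^sup>2 / 2) * measure \<gamma> (S n)"]) blast+
  also have "\<dots> \<le> exp (- M\<^sup>2 / 2) * measure \<gamma> (cball 0 r)"
  proof (intro mult_left_mono finite_measure_mono)
    show "(\<Inter>n. S n) \<subseteq> cball 0 r"
    proof
      fix y assume y: "y \<in> (\<Inter>n. S n)"
      have "norm y \<le> r"
      proof (rule norming, rule allI)
        fix n
        have "\<bar>g n y\<bar> \<le> onorm (g n) * r" using y unfolding S_def by auto
        also have "\<dots> \<le> 1 * r" using g(2) r by (intro mult_right_mono) auto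
        finally show "\<bar>g n y\<bar> \<le> r" by simp
      qed
      then show "y \<in> cball 0 r" by simp
    qed
  qed auto
  finally show ?thesis .
qed

theorem property_M_CM_space: "property_M \<gamma> (CM_space \<gamma>)"
  unfolding property_M_def
proof (intro conjI bexI ballI)
  \<comment> \<open>The origin serves as the reference point in property M.\<close>
  show zero: "0 \<in> CM_space \<gamma>"
    by (rule CM_spaceI[of _ 0]) (simp add: linear_0 bounded_linear.linear)
  then show "CM_space \<gamma> \<noteq> {}" by blast
  show "CM_space \<gamma> \<subseteq> supp \<gamma>" using full_support by (simp add: nondegenerate_def)
  fix x assume "x \<in> UNIV - CM_space \<gamma>"
  then have x: "x \<notin> CM_space \<gamma>" by simp
  show "((\<lambda>r. measure \<gamma> (cball x r) / measure \<gamma> (cball 0 r)) \<longlongrightarrow> 0) (at_right 0)"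
  proof (rule tendstoI)
    fix \<epsilon> :: real assume \<epsilon>: "\<epsilon> > 0"
    \<comment> \<open>Then \<open>M\<^sup>2 / 2\<close> is
      \<open>\<bar>ln \<epsilon>\<bar> + 1\<close>, which exceeds \<open>- ln \<epsilon>\<close>, so
      the decay factor is strictly below \<open>\<epsilon>\<close>.\<close>
    define M where "M = sqrt (2 * (\<bar>ln \<epsilon>\<bar> + 1))"
    have M: "0 \<le> M" "M\<^sup>2 = 2 * (\<bar>ln \<epsilon>\<bar> + 1)" unfolding M_def by simp_all
    have "exp (- M\<^sup>2 / 2) < exp (ln \<epsilon>)" unfolding M(2) by simp
    then have small: "exp (- M\<^sup>2 / 2) < \<epsilon>" using \<epsilon> by simp
    obtain g :: "'a \<Rightarrow> real" where g: "bounded_linear g" "M * L2_norm \<gamma> g < \<bar>g x\<bar>"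
      using CM_spaceI[of x M] x by (meson not_le)
    define \<sigma> where "\<sigma> = L2_norm \<gamma> g"
    \<comment> \<open>Otherwise \<open>g\<close> would vanish at \<open>x\<close>, against the
      strict inequality in the choice of \<open>g\<close>.\<close>
    have "\<sigma> \<noteq> 0" using g functional_zero[OF g(1), of x] by (auto simp: \<sigma>_def)
    then have \<sigma>: "\<sigma> > 0" using L2_norm_nonneg[of \<gamma> g] by (simp add: \<sigma>_def)
    define f where "f y = (sgn (g x) / \<sigma>) * g y" for y
    have f: "bounded_linear f" unfolding f_def by (intro bounded_linear_const_mult g)
    have "L2_norm \<gamma> f = \<bar>sgn (g x) / \<sigma>\<bar> * \<sigma>" unfolding f_def L2_norm_scale \<sigma>_def ..
    also have "\<dots> \<le> 1" using \<sigma> by (simp add: abs_sgn_eq)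
    finally have f1: "L2_norm \<gamma> f \<le> 1" .
    have "f x = \<bar>g x\<bar> / \<sigma>" unfolding f_def by (simp add: abs_sgn mult.commute)
    then have fx: "M < f x" using g(2) \<sigma> by (simp add: \<sigma>_def[symmetric] less_divide_eq)
    \<comment> \<open>Below this radius \<open>f\<close> exceeds \<open>M\<close> on the whole ball
      around \<open>x\<close>; the summand \<open>1\<close> avoids a separate treatment of a
      vanishing denominator.\<close>
    define r0 where "r0 = (f x - M) / (onorm f + 1)"
    have on: "0 \<le> onorm f" by (rule onorm_pos_le[OF f])
    then have "r0 > 0" using fx by (simp add: r0_def)
    then show "\<forall>\<^sub>F r in at_right 0. dist (measure \<gamma> (cball x r) / measure \<gamma> (cball 0 r)) 0 < \<epsilon>"
      unfolding eventually_at_right_field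
    proof (intro exI[of _ r0] conjI allI impI)
      fix r :: real assume r: "0 < r" "r < r0"
      have "onorm f * r \<le> (onorm f + 1) * r0"
        using r on by (intro mult_mono) auto
      also have "\<dots> = f x - M" using on by (simp add: r0_def)
      finally have "measure \<gamma> (cball x r) \<le> exp (- M\<^sup>2 / 2) * measure \<gamma> (cball 0 r)"
        by (intro ball_decay[OF f f1 M(1)] r) simp
      moreover have "measure \<gamma> (cball 0 r) > 0"
        using full_support r(1) by (auto simp: nondegenerate_def supp_def)
      ultimately have "measure \<gamma> (cball x r) / measure \<gamma> (cball 0 r) \<le> exp (- M\<^sup>2 / 2)"
        by (simp add: divide_le_eq)
      then show "dist (measure \<gamma> (cball x r) / measure \<gamma> (cball 0 r)) 0 < \<epsilon>"
        using small by simp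
    qed
  qed
qed

end

theorem corollary3p3:
  fixes \<gamma> :: "'a::{banach, second_countable_topology} measure"
  assumes "gaussian_measure \<gamma>" and "centred \<gamma>" and "nondegenerate \<gamma>"
  shows "(\<forall>(r :: nat \<Rightarrow> real) (x :: nat \<Rightarrow> 'a).
            (\<forall>n. r n > 0) \<longrightarrow> r \<longlonglongrightarrow> 0 \<longrightarrow>
            liminf (\<lambda>n. INF h \<in> CM_space \<gamma> \<inter> cball (x n) (r n).
                      ereal (1/2 * (CM_norm \<gamma> h)\<^sup>2)) < \<infinity> \<longrightarrow>
            (\<exists>s l. strict_mono s \<and> l \<in> CM_space \<gamma> \<and> (x \<circ> s) \<longlonglongrightarrow> l))
         \<and> property_M \<gamma> (CM_space \<gamma>)"
proof -
  interpret prob_space \<gamma> using assms(1) by (simp add: gaussian_measure_def)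
  interpret nondegenerate_gaussian \<gamma> using assms by unfold_locales
  show ?thesis using limit_point_in_CM_space property_M_CM_space by blast
qed

end
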